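(* Let $\mathcal O$ be a bounded domain, let $f_\epsilon(x)=\log\big(\frac{\epsilon+x}{1+\epsilon x}\big)$, $x>0$, let $\widetilde g(x)=\mathrm i x$ or $\widetilde g=1$, and assume the data hypotheses (D) and solvability hypothesis (E) listed in the context. Then the regularized Crank--Nicolson type scheme (CN) preserves the evolution law of the mass $M(u)=\|u\|^2$ of the exact solution, that is, for all $n$, $$\mathbb E\big[M(u^\epsilon_{n+1})\big]=\mathbb E\big[M(u^\epsilon_n)\big]+\tau\sum_{i\in\mathbb N^+}\|Q^{\frac12}e_i\|^2\,\chi_{\{\widetilde g=1\}},$$ where $\chi_{\{\widetilde g=1\}}=1$ in the additive noise case and $\chi_{\{\widetilde g=1\}}=0$ in the multiplicative noise case.
   Context: Setting. $d\in\mathbb N^+$; $\mathcal O\subset\mathbb R^d$ is a bounded domain with homogeneous Dirichlet or periodic boundary condition; $\Delta$ is the Laplacian on $\mathcal O$; $\lambda\in\mathbb R\setminus\{0\}$; $T>0$. $\mathbb H=L^2(\mathcal O;\mathbb C)$ with $\langle u,v\rangle=\mathrm{Re}\int_{\mathcal O}u\bar v\,dx$ and norm $\|\cdot\|$; $\mathbb H^1=W^{1,2}$. On a filtered probability space $(\Omega,\mathcal F,(\mathcal F_t)_{t\ge0},\mathbb P)$, $W(t)=\sum_{k}Q^{1/2}e_k\beta_k(t)$ is an $\mathbb H$-valued Wiener process, where $\{e_k\}_{k\in\mathbb N^+}$ is an orthonormal basis of $\mathbb H$, $\beta_k$ are independent Brownian motions, and $Q^{1/2}$ is a bounded operator on $\mathbb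 H$ with $\sum_i\|Q^{1/2}e_i\|^2<\infty$. Noise: if $\widetilde g=1$, $\widetilde g(u)\star dW(t):=dW(t)$; if $\widetilde g(x)=\mathrm i x$, $\widetilde g(u)\star dW(t):=-\tfrac12\sum_i|Q^{1/2}e_i|^2u\,dt+\mathrm i u\,dW(t)$ (Itô integral). Scheme (CN), discretizing (for $0<\epsilon\ll1$) $du^\epsilon=\mathrm i\Delta u^\epsilon dt+\mathrm i\lambda u^\epsilon f_\epsilon(|u^\epsilon|^2)dt+\widetilde g(u^\epsilon)\star dW(t)$, $u^\epsilon(0)=u_0$: time step $\tau=T/N$, $t_k=k\tau$, $u^\epsilon_0=u_0$. For $\mathcal F_{t_k}$-measurable $v$, $\Phi_{S,\mathcal F_{t_k}}^s(v)$, $s\in[0,\tau]$, is the value at time $t_k+s$ of the solution of $dy=\widetilde g(y)\star dW$ on $[t_k,t_{k+1}]$, $y(t_k)=v$. With $v_k:=\Phi_{S,\mathcal F_{t_k}}^\tau(u^\epsilon_k)$, $u^\epsilon_{k+1}$ is defined by $$u^\epsilon_{k+1}=v_k+\mathrm i\tau\Delta\frac{v_k+u^\epsilon_{k+1}}2+\mathrm i\lambda\tau\int_0^1f_\epsilon\big(\theta|v_k|^2+(1-\theta)|u^\epsilon_{k+1}|^2\big)d\theta\;\frac{v_k+u^\epsilon_{k+1}}2.$$ (E) There is a small $\tau_0=\tau_0(T,\lambda,g,Q,u_0,\epsilon)>0$ such that for $\tau<\tau_0$ a numerical solution of the scheme exists, and $\tau<\tau_0$. (D) $u_0\in\mathbb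 H^1$ is deterministic; $\sum_i\|Q^{1/2}e_i\|_{\mathbb H^1}^2<\infty$ if $\widetilde g=1$; $\sum_i\|Q^{1/2}e_i\|_{\mathbb H^1}^2+\|Q^{1/2}e_i\|_{W^{1,\infty}}^2<\infty$ if $\widetilde g(x)=\mathrm i x$. *)

theory Defs
  imports "HOL-Probability.Probability"
begin

section \<open>The Hilbert space of square integrable complex functions\<close>

lemma cnj_measurable [measurable]: "cnj \<in> borel_measurable borel"
  by (intro borel_measurable_continuous_onI continuous_intros)

text \<open>Square integrable functions on the whole space modulo equality almost everywhere.  For a
  domain \<open>D\<close>, the space \<open>L2(D; C)\<close> is identified, by extension by zero, with the closed subspace
  \<open>L2_on D\<close> of the classes that vanish almost everywhere outside \<open>D\<close>.\<close>

definition sq_int :: "(real ^ 'd::finite \<Rightarrow> complex) \<Rightarrow> bool" where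
  "sq_int f \<longleftrightarrow> f \<in> borel_measurable lborel \<and> integrable lborel (\<lambda>x. (cmod (f x))\<^sup>2)"

lemma sq_int_zero [simp]: "sq_int (\<lambda>x. 0)"
  by (simp add: sq_int_def)

lemma sq_int_scale:
  assumes "sq_int f"
  shows "sq_int (\<lambda>x. c * f x)"
  using assms by (auto simp: sq_int_def norm_mult power_mult_distrib)

lemma sq_int_add:
  assumes f: "sq_int f" and g: "sq_int g"
  shows "sq_int (\<lambda>x. f x + g x)"
proof -
  have [measurable]: "f \<in> borel_measurable borel" "g \<in> borel_measurable borel"
    using f g by (auto simp: sq_int_def)
  have "integrable lborel (\<lambda>x. 2 * (cmod (f x))\<^sup>2 + 2 * (cmod (g x))\<^sup>2)"
    using f g by (auto simp: sq_int_def)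
  then have "integrable lborel (\<lambda>x. (cmod (f x + g x))\<^sup>2)"
  proof (rule Bochner_Integration.integrable_bound)
    have "(cmod (f x + g x))\<^sup>2 \<le> 2 * (cmod (f x))\<^sup>2 + 2 * (cmod (g x))\<^sup>2" for x
    proof -
      have "(cmod (f x + g x))\<^sup>2 \<le> (cmod (f x) + cmod (g x))\<^sup>2"
        by (intro power_mono norm_triangle_ineq) auto
      also have "\<dots> \<le> 2 * (cmod (f x))\<^sup>2 + 2 * (cmod (g x))\<^sup>2"
        using sum_squares_bound[of "cmod (f x)" "cmod (g x)"] by (simp add: power2_sum)
      finally show ?thesis .
    qed
    then show "AE x in lborel. norm ((cmod (f x + g x))\<^sup>2)
        \<le> norm (2 * (cmod (f x))\<^sup>2 + 2 * (cmod (g x))\<^sup>2)"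
      by simp
  qed simp
  then show ?thesis by (simp add: sq_int_def)
qed

lemma sq_int_uminus:
  assumes "sq_int f"
  shows "sq_int (\<lambda>x. - f x)"
  using sq_int_scale[OF assms, of "-1"] by simp

lemma sq_int_diff:
  assumes "sq_int f" "sq_int g"
  shows "sq_int (\<lambda>x. f x - g x)"
  using sq_int_add[OF assms(1) sq_int_uminus[OF assms(2)]] by simp

lemma sq_int_product:
  assumes f: "sq_int f" and g: "sq_int g"
  shows "integrable lborel (\<lambda>x. f x * cnj (g x))"
proof -
  have [measurable]: "f \<in> borel_measurable borel" "g \<in> borel_measurable borel"
    using f g by (auto simp: sq_int_def)
  have "integrable lborel (\<lambda>x. (cmod (f x))\<^sup>2 + (cmod (g x))\<^sup>2)"
    using f g by (auto simp: sq_int_def)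
  then show ?thesis
  proof (rule Bochner_Integration.integrable_bound)
    have "cmod (f x * cnj (g x)) \<le> (cmod (f x))\<^sup>2 + (cmod (g x))\<^sup>2" for x
    proof -
      have "2 * (cmod (f x) * cmod (g x)) \<le> (cmod (f x))\<^sup>2 + (cmod (g x))\<^sup>2"
        using sum_squares_bound[of "cmod (f x)" "cmod (g x)"] by (simp add: mult.assoc)
      moreover have "0 \<le> cmod (f x) * cmod (g x)" by simp
      ultimately have "cmod (f x) * cmod (g x) \<le> (cmod (f x))\<^sup>2 + (cmod (g x))\<^sup>2" by linarith
      then show ?thesis by (simp add: norm_mult)
    qed
    then show "AE x in lborel. norm (f x * cnj (g x))
        \<le> norm ((cmod (f x))\<^sup>2 + (cmod (g x))\<^sup>2)"
      by (smt (verit, best) AE_I2 real_norm_def)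
  qed simp
qed

quotient_type (overloaded) 'd L2 = "real ^ 'd::finite \<Rightarrow> complex" /
  partial: "\<lambda>f g :: real ^ 'd::finite \<Rightarrow> complex. sq_int f \<and> sq_int g \<and> (AE x in lborel. f x = g x)"
proof (rule part_equivpI)
  show "\<exists>f :: real ^ 'd \<Rightarrow> complex. sq_int f \<and> sq_int f \<and> (AE x in lborel. f x = f x)"
    by (intro exI[of _ "\<lambda>_. 0"]) simp
  show "symp (\<lambda>f g :: real ^ 'd \<Rightarrow> complex. sq_int f \<and> sq_int g \<and> (AE x in lborel. f x = g x))"
    by (rule sympI) (auto elim: eventually_mono)
  show "transp (\<lambda>f g :: real ^ 'd \<Rightarrow> complex. sq_int f \<and> sq_int g \<and> (AE x in lborel. f x = g x))"
    by (rule transpI) (auto elim: eventually_elim2)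
qed

lift_definition cinner :: "'d::finite L2 \<Rightarrow> 'd L2 \<Rightarrow> complex" is
  "\<lambda>f g. (LINT x|lborel. f x * cnj (g x))"
proof (elim conjE)
  fix f f' g g' :: "real ^ 'd \<Rightarrow> complex"
  assume "sq_int f" "sq_int f'" "sq_int g" "sq_int g'"
  then have [measurable]: "f \<in> borel_measurable borel" "f' \<in> borel_measurable borel"
    "g \<in> borel_measurable borel" "g' \<in> borel_measurable borel"
    by (auto simp: sq_int_def)
  assume "AE x in lborel. f x = f' x" "AE x in lborel. g x = g' x"
  then show "(LINT x|lborel. f x * cnj (g x)) = (LINT x|lborel. f' x * cnj (g' x))"
    by (intro integral_cong_AE) (measurable, auto elim: eventually_elim2)
qed

instantiation L2 :: (finite) real_inner
begin

lift_definition zero_L2 :: "'a L2" is "\<lambda>x. 0" by simp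

lift_definition plus_L2 :: "'a L2 \<Rightarrow> 'a L2 \<Rightarrow> 'a L2" is "\<lambda>f g x. f x + g x"
  by (auto intro: sq_int_add elim: eventually_elim2)

lift_definition minus_L2 :: "'a L2 \<Rightarrow> 'a L2 \<Rightarrow> 'a L2" is "\<lambda>f g x. f x - g x"
  by (auto intro: sq_int_diff elim: eventually_elim2)

lift_definition uminus_L2 :: "'a L2 \<Rightarrow> 'a L2" is "\<lambda>f x. - f x"
  by (auto intro: sq_int_uminus)

lift_definition scaleR_L2 :: "real \<Rightarrow> 'a L2 \<Rightarrow> 'a L2" is "\<lambda>r f x. complex_of_real r * f x"
  by (auto intro: sq_int_scale elim: AE_mp)

definition inner_L2 :: "'a L2 \<Rightarrow> 'a L2 \<Rightarrow> real" where
  "inner_L2 u v = Re (cinner u v)"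

definition norm_L2 :: "'a L2 \<Rightarrow> real" where
  "norm_L2 u = sqrt (inner u u)"

definition dist_L2 :: "'a L2 \<Rightarrow> 'a L2 \<Rightarrow> real" where
  "dist_L2 u v = norm (u - v)"

definition sgn_L2 :: "'a L2 \<Rightarrow> 'a L2" where
  "sgn_L2 u = inverse (norm u) *\<^sub>R u"

definition uniformity_L2 :: "('a L2 \<times> 'a L2) filter" where
  "uniformity_L2 = (INF e\<in>{0<..}. principal {(x, y). dist x y < e})"

definition open_L2 :: "'a L2 set \<Rightarrow> bool" where
  "open_L2 U \<longleftrightarrow> (\<forall>x\<in>U. \<forall>\<^sub>F (x', y) in uniformity. x' = x \<longrightarrow> y \<in> U)"

instance
proof
  fix x y z :: "'a L2" and r s :: real and U :: "'a L2 set"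
  show "x + y + z = x + (y + z)" "x + y = y + x" "0 + x = x" "- x + x = 0" "x - y = x + - y"
    by (transfer; simp add: algebra_simps sq_int_add sq_int_diff)+
  show "r *\<^sub>R (x + y) = r *\<^sub>R x + r *\<^sub>R y" 
    by transfer (simp add: distrib_left sq_int_add sq_int_scale)
  show "(r + s) *\<^sub>R x = r *\<^sub>R x + s *\<^sub>R x"
    by transfer (simp add: distrib_right sq_int_add sq_int_scale)
  show "r *\<^sub>R s *\<^sub>R x = (r * s) *\<^sub>R x"
    by transfer (simp add: mult.assoc sq_int_scale)
  show "1 *\<^sub>R x = x"
    by transfer simp
  show "dist x y = norm (x - y)" by (simp add: dist_L2_def)
  show "sgn x = inverse (norm x) *\<^sub>R x" by (simp add: sgn_L2_def)
  show "uniformity = (INF e\<in>{0<..}. principal {(x :: 'a L2, y). dist x y < e})"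
    by (simp add: uniformity_L2_def)
  show "open U \<longleftrightarrow> (\<forall>x\<in>U. \<forall>\<^sub>F (x', y) in uniformity. x' = x \<longrightarrow> y \<in> U)"
    by (simp add: open_L2_def)
  show "inner x y = inner y x"
    unfolding inner_L2_def
  proof transfer
    fix f g :: "real ^ 'a \<Rightarrow> complex"
    have eq: "(LINT x|lborel. f x * cnj (g x)) = cnj (LINT x|lborel. g x * cnj (f x))"
      by (subst Bochner_Integration.integral_cnj[symmetric]) (simp add: mult.commute)
    show "Re (LINT x|lborel. f x * cnj (g x)) = Re (LINT x|lborel. g x * cnj (f x))"
      by (subst eq) simp
  qed
  show "inner (x + y) z = inner x z + inner y z"
    unfolding inner_L2_def
    by transfer (simp add: distrib_right sq_int_product)
  show "inner (r *\<^sub>R x) y = r * inner x y"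
    unfolding inner_L2_def
    by transfer (simp add: mult.assoc)
  have self: "Re (LINT x|lborel. f x * cnj (f x)) = (LINT x|lborel. (cmod (f x))\<^sup>2)"
    for f :: "real ^ 'a \<Rightarrow> complex"
  proof -
    have "(LINT x|lborel. f x * cnj (f x)) = (LINT x|lborel. complex_of_real ((cmod (f x))\<^sup>2))"
      by (simp only: complex_norm_square)
    then show ?thesis by (simp only: integral_complex_of_real Re_complex_of_real)
  qed
  show "0 \<le> inner x x"
    unfolding inner_L2_def by transfer (simp add: self)
  show "inner x x = 0 \<longleftrightarrow> x = 0"
    unfolding inner_L2_def
  proof transfer
    fix f :: "real ^ 'a \<Rightarrow> complex"
    assume "sq_int f \<and> sq_int f \<and> (AE x in lborel. f x = f x)"
    then have f: "sq_int f" by simp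
    then have "(LINT x|lborel. (cmod (f x))\<^sup>2) = 0 \<longleftrightarrow> (AE x in lborel. (cmod (f x))\<^sup>2 = 0)"
      by (intro integral_nonneg_eq_0_iff_AE) (auto simp: sq_int_def)
    then show "Re (LINT x|lborel. f x * cnj (f x)) = 0 \<longleftrightarrow>
        sq_int f \<and> sq_int (\<lambda>x. 0 :: complex) \<and> (AE x in lborel. f x = 0)"
      using f by (simp add: self)
  qed
  show "norm x = sqrt (inner x x)" by (simp add: norm_L2_def)
qed

end

text \<open>Pointwise expressions in elements of \<open>L2\<close> are written with the representative
  \<open>rep_L2 u\<close>; \<open>to_L2\<close> takes a function back to its class.  Its value is a dummy if the function is
  not square integrable.\<close>

definition to_L2 :: "(real ^ 'd::finite \<Rightarrow> complex) \<Rightarrow> 'd L2" where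
  "to_L2 f = (if sq_int f then abs_L2 f else 0)"

definition pmult :: "(real ^ 'd::finite \<Rightarrow> complex) \<Rightarrow> 'd L2 \<Rightarrow> 'd L2" where
  "pmult m u = to_L2 (\<lambda>x. m x * rep_L2 u x)"

definition L2_on :: "(real ^ 'd::finite) set \<Rightarrow> 'd L2 set" where
  "L2_on D = {u. AE x in lborel. x \<notin> D \<longrightarrow> rep_L2 u x = 0}"

definition orthonormal_basis :: "(real ^ 'd::finite) set \<Rightarrow> (nat \<Rightarrow> 'd L2) \<Rightarrow> bool" where
  "orthonormal_basis D e \<longleftrightarrow>
     (\<forall>i j. inner (e i) (e j) = (if i = j then 1 else 0)) \<and> closure (span (range e)) = L2_on D"

text \<open>Every bounded operator on \<open>L2_on D\<close> extends to a bounded operator on the whole type.\<close>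

definition bounded_operator_on :: "(real ^ 'd::finite) set \<Rightarrow> ('d L2 \<Rightarrow> 'd L2) \<Rightarrow> bool" where
  "bounded_operator_on D A \<longleftrightarrow> bounded_linear A \<and> A ` L2_on D \<subseteq> L2_on D"

section \<open>Sobolev spaces and the Laplacian\<close>

definition partial_deriv :: "'d::finite \<Rightarrow> (real ^ 'd \<Rightarrow> complex) \<Rightarrow> real ^ 'd \<Rightarrow> complex" where
  "partial_deriv i f x = frechet_derivative f (at x) (axis i 1)"

primrec C_k :: "nat \<Rightarrow> (real ^ 'd::finite \<Rightarrow> complex) \<Rightarrow> bool" where
  "C_k 0 f \<longleftrightarrow> continuous_on UNIV f"
| "C_k (Suc k) f \<longleftrightarrow> (\<forall>x. f differentiable at x) \<and> (\<forall>i. C_k k (partial_deriv i f))"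

definition smooth :: "(real ^ 'd::finite \<Rightarrow> complex) \<Rightarrow> bool" where
  "smooth f \<longleftrightarrow> (\<forall>k. C_k k f)"

definition test_functions :: "(real ^ 'd::finite) set \<Rightarrow> (real ^ 'd \<Rightarrow> complex) set" where
  "test_functions D = {\<phi>. smooth \<phi> \<and> (\<exists>K. compact K \<and> K \<subseteq> D \<and> (\<forall>x. x \<notin> K \<longrightarrow> \<phi> x = 0))}"

definition is_weak_deriv :: "(real ^ 'd::finite) set \<Rightarrow> 'd \<Rightarrow> 'd L2 \<Rightarrow> 'd L2 \<Rightarrow> bool" where
  "is_weak_deriv D i u g \<longleftrightarrow> g \<in> L2_on D \<and>
     (\<forall>\<phi>\<in>test_functions D.
        (LINT x|lborel. rep_L2 u x * partial_deriv i \<phi> x) = - (LINT x|lborel. rep_L2 g x * \<phi> x))"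

definition weak_deriv :: "(real ^ 'd::finite) set \<Rightarrow> 'd \<Rightarrow> 'd L2 \<Rightarrow> 'd L2" where
  "weak_deriv D i u = (SOME g. is_weak_deriv D i u g)"

definition H1 :: "(real ^ 'd::finite) set \<Rightarrow> 'd L2 set" where
  "H1 D = {u \<in> L2_on D. \<forall>i. \<exists>g. is_weak_deriv D i u g}"

definition H1_norm :: "(real ^ 'd::finite) set \<Rightarrow> 'd::finite L2 \<Rightarrow> real" where
  "H1_norm D u = sqrt ((norm u)\<^sup>2 + (\<Sum>i\<in>UNIV. (norm (weak_deriv D i u))\<^sup>2))"

definition ess_norm :: "'d::finite L2 \<Rightarrow> ereal" where
  "ess_norm u = esssup lborel (\<lambda>x. ereal (cmod (rep_L2 u x)))"

text \<open>On a bounded domain, bounded weak derivatives are in particular square integrable.\<close>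

definition W1inf :: "(real ^ 'd::finite) set \<Rightarrow> 'd L2 set" where
  "W1inf D = {u \<in> H1 D. ess_norm u < \<infinity> \<and> (\<forall>i. ess_norm (weak_deriv D i u) < \<infinity>)}"

definition W1inf_norm :: "(real ^ 'd::finite) set \<Rightarrow> 'd::finite L2 \<Rightarrow> real" where
  "W1inf_norm D u = real_of_ereal (ess_norm u + (\<Sum>i\<in>UNIV. ess_norm (weak_deriv D i u)))"

text \<open>The periodic condition is posed on an open box with corners \<open>a\<close> and \<open>b\<close>, whose opposite
  faces are identified.\<close>

datatype 'd bdry_cond = Dirichlet | Periodic "real ^ 'd" "real ^ 'd"

definition bounded_domain :: "'d::finite bdry_cond \<Rightarrow> (real ^ 'd) set \<Rightarrow> bool" where
  "bounded_domain bc D \<longleftrightarrow> open D \<and> connected D \<and> bounded D \<and> D \<noteq> {} \<and>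
     (case bc of Dirichlet \<Rightarrow> True | Periodic a b \<Rightarrow> D = box a b)"

definition smooth_core :: "'d::finite bdry_cond \<Rightarrow> (real ^ 'd) set \<Rightarrow> (real ^ 'd \<Rightarrow> complex) set" where
  "smooth_core bc D = (case bc of
       Dirichlet \<Rightarrow> test_functions D
     | Periodic a b \<Rightarrow> {\<phi>. smooth \<phi> \<and> (\<forall>i x. \<phi> (x + axis i (b $ i - a $ i)) = \<phi> x)})"

text \<open>The form domain of the Laplacian: the closure in \<open>H1 D\<close> of the smooth functions satisfying the
  boundary condition.\<close>

definition H1_bc :: "'d::finite bdry_cond \<Rightarrow> (real ^ 'd) set \<Rightarrow> 'd L2 set" where
  "H1_bc bc D = {u \<in> H1 D. \<forall>e>0. \<exists>\<phi>\<in>smooth_core bc D.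
     H1_norm D (u - to_L2 (\<lambda>x. indicator D x * \<phi> x)) < e}"

text \<open>\<open>w\<close> lies in the domain of the Laplacian with boundary condition \<open>bc\<close>, and \<open>\<Delta> w = h\<close>.\<close>

definition has_laplacian :: "'d::finite bdry_cond \<Rightarrow> (real ^ 'd) set \<Rightarrow> 'd L2 \<Rightarrow> 'd L2 \<Rightarrow> bool" where
  "has_laplacian bc D w h \<longleftrightarrow> w \<in> H1_bc bc D \<and> h \<in> L2_on D \<and>
     (\<forall>\<phi>\<in>H1_bc bc D.
        cinner h \<phi> = - (\<Sum>i\<in>UNIV. cinner (weak_deriv D i w) (weak_deriv D i \<phi>)))"

section \<open>Wiener process and stochastic integral\<close>

definition filtered_prob_space :: "'w measure \<Rightarrow> (real \<Rightarrow> 'w measure) \<Rightarrow> bool" where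
  "filtered_prob_space M F \<longleftrightarrow> prob_space M \<and> (\<forall>t\<ge>0. subalgebra M (F t)) \<and>
     (\<forall>s\<ge>0. \<forall>t\<ge>s. sets (F s) \<subseteq> sets (F t))"

definition brownian_motion :: "'w measure \<Rightarrow> (real \<Rightarrow> 'w measure) \<Rightarrow> (real \<Rightarrow> 'w \<Rightarrow> real) \<Rightarrow> bool" where
  "brownian_motion M F B \<longleftrightarrow>
     (\<forall>t\<ge>0. B t \<in> borel_measurable (F t)) \<and>
     (AE \<omega> in M. B 0 \<omega> = 0) \<and>
     (\<forall>s\<ge>0. \<forall>t>s. distributed M lborel (\<lambda>\<omega>. B t \<omega> - B s \<omega>) (normal_density 0 (sqrt (t - s)))) \<and>
     (AE \<omega> in M. continuous_on {0..} (\<lambda>t. B t \<omega>))"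

text \<open>Independent Brownian motions with respect to the filtration: the increments after time \<open>s\<close> of
  the whole family are independent of \<open>F s\<close>.\<close>

definition indep_brownian_motions ::
    "'w measure \<Rightarrow> (real \<Rightarrow> 'w measure) \<Rightarrow> (nat \<Rightarrow> real \<Rightarrow> 'w \<Rightarrow> real) \<Rightarrow> bool" where
  "indep_brownian_motions M F \<beta> \<longleftrightarrow>
     (\<forall>k. brownian_motion M F (\<beta> k)) \<and>
     prob_space.indep_vars M (\<lambda>_. PiM {0..} (\<lambda>_. borel)) (\<lambda>k \<omega>. \<lambda>t\<in>{0..}. \<beta> k t \<omega>) UNIV \<and>
     (\<forall>s\<ge>0. \<forall>t>s. prob_space.indep_set M (sets (F s))
        (sets (vimage_algebra (space M) (\<lambda>\<omega> k. \<beta> k t \<omega> - \<beta> k s \<omega>) (PiM UNIV (\<lambda>_. borel)))))"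

text \<open>Convergence in \<open>L2(\<Omega>; H)\<close>.  The nonnegative integral is used because it does not hide
  infinite values.\<close>

definition mean_square_lim ::
    "'w measure \<Rightarrow> (nat \<Rightarrow> 'w \<Rightarrow> 'b::real_normed_vector) \<Rightarrow> ('w \<Rightarrow> 'b) \<Rightarrow> bool" where
  "mean_square_lim M X Y \<longleftrightarrow> Y \<in> borel_measurable M \<and>
     (\<lambda>n. \<integral>\<^sup>+ \<omega>. ennreal ((norm (X n \<omega> - Y \<omega>))\<^sup>2) \<partial>M) \<longlonglongrightarrow> 0"

text \<open>\<open>W(t) = \<Sum>k. \<beta>_k(t) q_k\<close>, where \<open>q k\<close> is the image of the \<open>k\<close>-th basis vector under the square
  root of the covariance operator.\<close>

definition wiener_process ::
    "'w measure \<Rightarrow> (real \<Rightarrow> 'w measure) \<Rightarrow> (real ^ 'd::finite) set \<Rightarrow> (nat \<Rightarrow> real \<Rightarrow> 'w \<Rightarrow> real)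
      \<Rightarrow> (nat \<Rightarrow> 'd L2) \<Rightarrow> (real \<Rightarrow> 'w \<Rightarrow> 'd L2) \<Rightarrow> bool" where
  "wiener_process M F D \<beta> q W \<longleftrightarrow> indep_brownian_motions M F \<beta> \<and>
     (\<forall>t\<ge>0. W t \<in> borel_measurable (F t) \<and> W t ` space M \<subseteq> L2_on D \<and>
        mean_square_lim M (\<lambda>n \<omega>. \<Sum>k<n. \<beta> k t \<omega> *\<^sub>R q k) (W t)) \<and>
     (AE \<omega> in M. continuous_on {0..} (\<lambda>t. W t \<omega>))"

text \<open>The elementary process \<open>\<Sum>i<m. \<xi>_i 1_(t_i, t_(i+1)]\<close> on \<open>[a, b]\<close> and its integral.\<close>

definition elementary ::
    "'w measure \<Rightarrow> (real \<Rightarrow> 'w measure) \<Rightarrow> real \<Rightarrow> real \<Rightarrow> nat \<Rightarrow> (nat \<Rightarrow> real)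
      \<Rightarrow> (nat \<Rightarrow> 'w \<Rightarrow> 'b::real_normed_vector) \<Rightarrow> bool" where
  "elementary M F a b m t \<xi> \<longleftrightarrow> t 0 = a \<and> t m = b \<and>
     (\<forall>i<m. t i \<le> t (Suc i) \<and> \<xi> i \<in> borel_measurable (F (t i)) \<and>
        (\<integral>\<^sup>+ \<omega>. ennreal ((norm (\<xi> i \<omega>))\<^sup>2) \<partial>M) < \<infinity>)"

definition elementary_process ::
    "nat \<Rightarrow> (nat \<Rightarrow> real) \<Rightarrow> (nat \<Rightarrow> 'w \<Rightarrow> 'b::real_normed_vector) \<Rightarrow> real \<Rightarrow> 'w \<Rightarrow> 'b" where
  "elementary_process m t \<xi> r \<omega> = (\<Sum>i<m. indicator {t i<..t (Suc i)} r *\<^sub>R \<xi> i \<omega>)"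

definition elementary_integral ::
    "(real \<Rightarrow> 'w \<Rightarrow> real) \<Rightarrow> nat \<Rightarrow> (nat \<Rightarrow> real) \<Rightarrow> (nat \<Rightarrow> 'w \<Rightarrow> 'b::real_normed_vector)
      \<Rightarrow> 'w \<Rightarrow> 'b" where
  "elementary_integral B m t \<xi> \<omega> = (\<Sum>i<m. (B (t (Suc i)) \<omega> - B (t i) \<omega>) *\<^sub>R \<xi> i \<omega>)"

text \<open>\<open>I\<close> is the Ito integral of \<open>X\<close> over \<open>[a, b]\<close> with respect to the Brownian motion \<open>B\<close>:
  \<open>X\<close> is the limit in \<open>L2(\<Omega> \<times> [a, b])\<close> of elementary processes whose integrals converge to \<open>I\<close>
  in mean square.\<close>

definition has_ito_integral ::
    "'w measure \<Rightarrow> (real \<Rightarrow> 'w measure) \<Rightarrow> (real \<Rightarrow> 'w \<Rightarrow> real) \<Rightarrow> real \<Rightarrow> real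
      \<Rightarrow> (real \<Rightarrow> 'w \<Rightarrow> 'b::real_normed_vector) \<Rightarrow> ('w \<Rightarrow> 'b) \<Rightarrow> bool" where
  "has_ito_integral M F B a b X I \<longleftrightarrow>
     (\<lambda>(\<omega>, r). X r \<omega>) \<in> borel_measurable (M \<Otimes>\<^sub>M restrict_space lborel {a..b}) \<and>
     (\<exists>m t \<xi>. (\<forall>n. elementary M F a b (m n) (t n) (\<xi> n)) \<and>
        (\<lambda>n. \<integral>\<^sup>+ (\<omega>, r). ennreal ((norm (elementary_process (m n) (t n) (\<xi> n) r \<omega> - X r \<omega>))\<^sup>2)
            \<partial>(M \<Otimes>\<^sub>M restrict_space lborel {a..b})) \<longlonglongrightarrow> 0 \<and>
        mean_square_lim M (\<lambda>n. elementary_integral B (m n) (t n) (\<xi> n)) I)"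

text \<open>The stochastic integral of an operator-valued process \<open>G\<close> with respect to \<open>W\<close>, with
  \<open>dW = \<Sum>k. q_k d\<beta>_k\<close>.\<close>

definition has_wiener_integral ::
    "'w measure \<Rightarrow> (real \<Rightarrow> 'w measure) \<Rightarrow> (nat \<Rightarrow> real \<Rightarrow> 'w \<Rightarrow> real) \<Rightarrow> (nat \<Rightarrow> 'd::finite L2)
      \<Rightarrow> real \<Rightarrow> real \<Rightarrow> (real \<Rightarrow> 'w \<Rightarrow> 'd L2 \<Rightarrow> 'd L2) \<Rightarrow> ('w \<Rightarrow> 'd L2) \<Rightarrow> bool" where
  "has_wiener_integral M F \<beta> q a b G J \<longleftrightarrow>
     (\<exists>I. (\<forall>k. has_ito_integral M F (\<beta> k) a b (\<lambda>r \<omega>. G r \<omega> (q k)) (I k)) \<and>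
        mean_square_lim M (\<lambda>n \<omega>. \<Sum>k<n. I k \<omega>) J)"

section \<open>The regularized Crank--Nicolson scheme\<close>

text \<open>\<open>Additive\<close> stands for \<open>g = 1\<close>, \<open>Multiplicative\<close> for \<open>g(x) = i x\<close>.\<close>

datatype noise = Additive | Multiplicative

text \<open>\<open>y\<close> solves \<open>dy = g(y) \<star> dW\<close> on \<open>[a, b]\<close> with \<open>y(a) = v\<close>.\<close>

definition noise_solution ::
    "noise \<Rightarrow> 'w measure \<Rightarrow> (real \<Rightarrow> 'w measure) \<Rightarrow> (real ^ 'd::finite) set
      \<Rightarrow> (nat \<Rightarrow> real \<Rightarrow> 'w \<Rightarrow> real) \<Rightarrow> (nat \<Rightarrow> 'd L2) \<Rightarrow> (real \<Rightarrow> 'w \<Rightarrow> 'd L2)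
      \<Rightarrow> real \<Rightarrow> real \<Rightarrow> ('w \<Rightarrow> 'd L2) \<Rightarrow> (real \<Rightarrow> 'w \<Rightarrow> 'd L2) \<Rightarrow> bool" where
  "noise_solution g M F D \<beta> q W a b v y \<longleftrightarrow>
     (\<forall>r\<in>{a..b}. y r \<in> borel_measurable (F r) \<and> y r ` space M \<subseteq> L2_on D) \<and>
     (AE \<omega> in M. continuous_on {a..b} (\<lambda>r. y r \<omega>)) \<and>
     (\<forall>r\<in>{a..b}. case g of
        Additive \<Rightarrow> AE \<omega> in M. y r \<omega> = v \<omega> + (W r \<omega> - W a \<omega>)
      | Multiplicative \<Rightarrow> \<exists>A J.
          (AE \<omega> in M. ((\<lambda>s. pmult (\<lambda>x. complex_of_real (- (1/2) * (\<Sum>i. (cmod (rep_L2 (q i) x))\<^sup>2)))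
              (y s \<omega>)) has_integral A \<omega>) {a..r}) \<and>
          has_wiener_integral M F \<beta> q a r (\<lambda>s \<omega> h. pmult (\<lambda>x. \<i> * rep_L2 (y s \<omega>) x) h) J \<and>
          (AE \<omega> in M. y r \<omega> = v \<omega> + A \<omega> + J \<omega>))"

definition f_reg :: "real \<Rightarrow> real \<Rightarrow> real" where
  "f_reg \<epsilon> x = ln ((\<epsilon> + x) / (1 + \<epsilon> * x))"

definition cn_step ::
    "'d::finite bdry_cond \<Rightarrow> (real ^ 'd) set \<Rightarrow> real \<Rightarrow> real \<Rightarrow> real \<Rightarrow> 'd L2 \<Rightarrow> 'd L2 \<Rightarrow> bool" where
  "cn_step bc D l \<epsilon> \<tau> v u \<longleftrightarrow> (\<exists>h. has_laplacian bc D ((1/2) *\<^sub>R (v + u)) h \<and>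
     u = v + pmult (\<lambda>_. \<i> * of_real \<tau>) h +
       pmult (\<lambda>x. \<i> * of_real (l * \<tau> * integral {0..1} (\<lambda>\<theta>.
           f_reg \<epsilon> (\<theta> * (cmod (rep_L2 v x))\<^sup>2 + (1 - \<theta>) * (cmod (rep_L2 u x))\<^sup>2))))
         ((1/2) *\<^sub>R (v + u)))"

text \<open>\<open>u\<close> is a numerical solution with \<open>N\<close> steps of size \<open>T / N\<close>.\<close>

definition cn_scheme ::
    "noise \<Rightarrow> 'd::finite bdry_cond \<Rightarrow> 'w measure \<Rightarrow> (real \<Rightarrow> 'w measure) \<Rightarrow> (real ^ 'd) set
      \<Rightarrow> (nat \<Rightarrow> real \<Rightarrow> 'w \<Rightarrow> real) \<Rightarrow> (nat \<Rightarrow> 'd L2) \<Rightarrow> (real \<Rightarrow> 'w \<Rightarrow> 'd L2)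
      \<Rightarrow> real \<Rightarrow> real \<Rightarrow> real \<Rightarrow> 'd L2 \<Rightarrow> nat \<Rightarrow> (nat \<Rightarrow> 'w \<Rightarrow> 'd L2) \<Rightarrow> bool" where
  "cn_scheme g bc M F D \<beta> q W l \<epsilon> T u0 N u \<longleftrightarrow>
     (let \<tau> = T / real N in
       (\<forall>\<omega>\<in>space M. u 0 \<omega> = u0) \<and>
       (\<forall>n\<le>N. u n \<in> borel_measurable (F (real n * \<tau>)) \<and> u n ` space M \<subseteq> L2_on D) \<and>
       (\<forall>n<N. \<exists>y. noise_solution g M F D \<beta> q W (real n * \<tau>) (real (Suc n) * \<tau>) (u n) y \<and>
          (AE \<omega> in M. cn_step bc D l \<epsilon> \<tau> (y (real (Suc n) * \<tau>) \<omega>) (u (Suc n) \<omega>))))"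

definition data_hypothesis ::
    "noise \<Rightarrow> (real ^ 'd::finite) set \<Rightarrow> 'd L2 \<Rightarrow> (nat \<Rightarrow> 'd L2) \<Rightarrow> bool" where
  "data_hypothesis g D u0 q \<longleftrightarrow> u0 \<in> H1 D \<and> (case g of
       Additive \<Rightarrow> range q \<subseteq> H1 D \<and> summable (\<lambda>i. (H1_norm D (q i))\<^sup>2)
     | Multiplicative \<Rightarrow> range q \<subseteq> W1inf D \<and>
         summable (\<lambda>i. (H1_norm D (q i))\<^sup>2 + (W1inf_norm D (q i))\<^sup>2))"

definition mass :: "'d::finite L2 \<Rightarrow> real" where
  "mass u = (norm u)\<^sup>2"

end

theory Submission
  imports Defs
begin

text \<open>
  A Crank--Nicolson step leaves the norm unchanged: its increment is orthogonal to the midpoint,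
  since both the Laplacian term and the nonlinear term are \<open>\<i>\<close> times a symmetric expression in the
  midpoint. So only the noise step changes the mass. In the additive case the increment
  of \<open>W\<close> is independent of the past and has second moment \<open>\<tau> \<Sum>i |Q e_i|^2\<close>. In the multiplicative
  case the Ito correction is \<open>K y\<close> with \<open>2 <K y, y> = - \<Sum>i |q_i y|^2\<close>, where \<open>q_i = Q e_i\<close>, and this
  cancels the quadratic variation of the martingale part. The boundedness of \<open>\<Sum>i |q_i|^2\<close> and the isometry
  make the drift square integrable, so no moment bound on the solution is assumed.
\<close>

section \<open>Representatives\<close>

text \<open>Three weak points of the data shape the proof. The noise solution \<open>y\<close> is
  used as one measurable random vector per time; joint measurability of the drift in time and chance
  is assembled from the Ito integrands, which carry it by definition. The drift integral is an
  existential witness, given almost surely and for each end time separately, without measurability;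
  it is replaced by the measurable difference \<open>y - v - J\<close> and used only after taking
  inner products. The stochastic integrals up to different end times are limits of unrelated
  elementary processes; that they fit together as one martingale has to be derived from the
  isometry. Moreover \<open>'d L2\<close> is available as an inner product space only. Sums and
  inner products of random vectors are measurable once the space is second countable, hence the
  proof of separability; integrating only real quantities avoids completeness.\<close>

lemma sq_int_rep_L2 [simp]: "sq_int (rep_L2 u)"
  using Quotient_rep_reflp[OF Quotient_L2, of u] by simp

lemma abs_rep_L2 [simp]: "abs_L2 (rep_L2 u) = u"
  by (rule Quotient_abs_rep[OF Quotient_L2])

lemma rep_L2_measurable [measurable]: "rep_L2 u \<in> borel_measurable borel"
  using sq_int_rep_L2[of u] by (simp add: sq_int_def)

lemma integrable_rep_L2: "integrable lborel (\<lambda>x. (cmod (rep_L2 u x))\<^sup>2)"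
  using sq_int_rep_L2[of u] by (simp add: sq_int_def)

lemma rep_abs_L2:
  assumes "sq_int f"
  shows "AE x in lborel. rep_L2 (abs_L2 f) x = f x"
  using Quotient_rep_abs[OF Quotient_L2, of f] assms by auto

lemma abs_L2_eqI:
  assumes "sq_int f" "sq_int g" "AE x in lborel. f x = g x"
  shows "abs_L2 f = abs_L2 g"
  using Quotient_rel_abs[OF Quotient_L2, of f g] assms by auto

lemma L2_eqI:
  assumes "AE x in lborel. rep_L2 u x = rep_L2 v x"
  shows "u = v"
  using abs_L2_eqI[OF sq_int_rep_L2 sq_int_rep_L2 assms] by simp

lemma rep_zero_L2: "AE x in lborel. rep_L2 0 x = 0"
  unfolding zero_L2_def by (rule rep_abs_L2) simp

lemma rep_plus_L2: "AE x in lborel. rep_L2 (u + v) x = rep_L2 u x + rep_L2 v x"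
  unfolding plus_L2_def map_fun_def o_def id_def by (rule rep_abs_L2) (simp add: sq_int_add)

lemma rep_minus_L2: "AE x in lborel. rep_L2 (u - v) x = rep_L2 u x - rep_L2 v x"
  unfolding minus_L2_def map_fun_def o_def id_def by (rule rep_abs_L2) (simp add: sq_int_diff)

lemma rep_scaleR_L2: "AE x in lborel. rep_L2 (r *\<^sub>R u) x = of_real r * rep_L2 u x"
  unfolding scaleR_L2_def map_fun_def o_def id_def by (rule rep_abs_L2) (simp add: sq_int_scale)

lemma cinner_rep: "cinner u v = (LINT x|lborel. rep_L2 u x * cnj (rep_L2 v x))"
  unfolding cinner_def map_fun_def o_def id_def ..

lemma inner_rep: "inner u v = (LINT x|lborel. Re (rep_L2 u x * cnj (rep_L2 v x)))"
  unfolding inner_L2_def cinner_rep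
  by (rule integral_Re[symmetric]) (intro sq_int_product sq_int_rep_L2)

lemma norm_sq_rep: "(norm u)\<^sup>2 = (LINT x|lborel. (cmod (rep_L2 u x))\<^sup>2)"
  unfolding power2_norm_eq_inner[of u] inner_rep
  by (intro Bochner_Integration.integral_cong refl)
     (simp only: complex_norm_square[symmetric] Re_complex_of_real)

lemma norm_sq_abs:
  assumes "sq_int f"
  shows "(norm (abs_L2 f))\<^sup>2 = (LINT x|lborel. (cmod (f x))\<^sup>2)"
proof -
  have [measurable]: "f \<in> borel_measurable borel"
    using assms by (simp add: sq_int_def)
  show ?thesis
    unfolding norm_sq_rep using rep_abs_L2[OF assms] by (intro integral_cong_AE) auto
qed

lemma plus_abs_L2:
  assumes "sq_int f" "sq_int g"
  shows "abs_L2 f + abs_L2 g = abs_L2 (\<lambda>x. f x + g x)"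
  using plus_L2.abs_eq[of f g] assms by simp

lemma minus_abs_L2:
  assumes "sq_int f" "sq_int g"
  shows "abs_L2 f - abs_L2 g = abs_L2 (\<lambda>x. f x - g x)"
  using minus_L2.abs_eq[of f g] assms by simp

section \<open>Separability\<close>

text \<open>The balls of radius \<open>1 / real (Suc n)\<close> about the points of \<open>C\<close>
  form a countable base. The conclusion has the form that the class
  \<open>second_countable_topology\<close> asks for.\<close>

lemma second_countable_of_dense:
  fixes C :: "'a::metric_space set"
  assumes "countable C" "closure C = UNIV"
  shows "\<exists>B :: 'a set set. countable B \<and> open = generate_topology B"
proof (intro exI conjI)
  let ?B = "(\<lambda>(c, n). ball c (1 / real (Suc n))) ` (C \<times> (UNIV :: nat set))"
  show "countable ?B"
    using assms by (intro countable_image countable_SIGMA) auto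
  have "topological_basis ?B"
  proof (rule topological_basisI)
    fix U and x :: 'a assume "open U" "x \<in> U"
    then obtain e where e: "e > 0" "ball x e \<subseteq> U"
      by (auto elim: openE)
    obtain n where n: "1 / real (Suc n) < e / 2"
      using e reals_Archimedean[of "e / 2"] by (auto simp: inverse_eq_divide)
    have "x \<in> closure C" using assms by simp
    then obtain c where c: "c \<in> C" "dist c x < 1 / real (Suc n)"
      unfolding closure_approachable by (metis divide_pos_pos of_nat_0_less_iff zero_less_Suc zero_less_one)
    have "ball c (1 / real (Suc n)) \<subseteq> ball x e"
    proof
      fix z assume "z \<in> ball c (1 / real (Suc n))"
      then show "z \<in> ball x e"
        using c(2) n dist_triangle[of x z c] by (simp add: dist_commute)
    qed
    then show "\<exists>B'\<in>?B. x \<in> B' \<and> B' \<subseteq> U"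
      using c e by (intro bexI[of _ "ball c (1 / real (Suc n))"]) auto
  qed auto
  then have basis: "topological_basis ?B" .
  show "open = generate_topology ?B"
  proof (rule ext, rule iffI)
    fix U :: "'a set" assume "open U"
    then obtain B' where "B' \<subseteq> ?B" "U = \<Union>B'"
      using basis unfolding topological_basis_def by metis
    then show "generate_topology ?B U"
      by (auto intro!: generate_topology.UN intro: generate_topology.Basis)
  next
    fix U assume "generate_topology ?B U"
    then show "open U"
      by induction auto
  qed
qed

section \<open>Dominated convergence and approximation in L2\<close>

lemma sq_int_bound:
  assumes "f \<in> borel_measurable borel" "sq_int g" "AE x in lborel. cmod (f x) \<le> c * cmod (g x)"
  shows "sq_int f"
proof -
  have [measurable]: "f \<in> borel_measurable borel" by fact
  have [measurable]: "g \<in> borel_measurable borel" using assms by (simp add: sq_int_def)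
  have "integrable lborel (\<lambda>x. c\<^sup>2 * (cmod (g x))\<^sup>2)"
    using assms by (simp add: sq_int_def)
  then have "integrable lborel (\<lambda>x. (cmod (f x))\<^sup>2)"
  proof (rule Bochner_Integration.integrable_bound)
    show "AE x in lborel. norm ((cmod (f x))\<^sup>2) \<le> norm (c\<^sup>2 * (cmod (g x))\<^sup>2)"
      using assms(3)
    proof eventually_elim
      case (elim x)
      have "(cmod (f x))\<^sup>2 \<le> (c * cmod (g x))\<^sup>2"
        using elim by (intro power_mono) auto
      then show ?case by (simp add: power_mult_distrib)
    qed
  qed simp
  then show ?thesis using assms by (simp add: sq_int_def)
qed

text \<open>Dominated convergence for the squared distance, with
  \<open>4 * (cmod (g x))\<^sup>2\<close> as the dominating function, since both \<open>s k\<close>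
  and its limit lie below \<open>g\<close>.\<close>

lemma L2_dominated_convergence:
  assumes g: "sq_int g" and f[measurable]: "f \<in> borel_measurable borel"
    and s[measurable]: "\<And>k. s k \<in> borel_measurable borel"
    and dom: "\<And>k x. cmod (s k x) \<le> cmod (g x)" and lim: "\<And>x. (\<lambda>k. s k x) \<longlonglongrightarrow> f x"
  shows "sq_int f" "\<And>k. sq_int (s k)" "(\<lambda>k. abs_L2 (s k)) \<longlonglongrightarrow> abs_L2 f"
proof -
  have [measurable]: "g \<in> borel_measurable borel" using g by (simp add: sq_int_def)
  have fdom: "cmod (f x) \<le> cmod (g x)" for x
    by (rule LIMSEQ_le_const2[OF tendsto_norm[OF lim[of x]]]) (use dom in auto)
  show sq: "sq_int f" "sq_int (s k)" for k
    using fdom dom by (auto intro!: sq_int_bound[OF _ g, of _ 1])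
  have "(\<lambda>k. LINT x|lborel. (cmod (s k x - f x))\<^sup>2) \<longlonglongrightarrow> (LINT x::(real^'a)|lborel. 0)"
  proof (rule integral_dominated_convergence[where w="\<lambda>x. 4 * (cmod (g x))\<^sup>2"])
    show "integrable lborel (\<lambda>x. 4 * (cmod (g x))\<^sup>2)"
      using g by (simp add: sq_int_def)
    show "AE x in lborel. (\<lambda>k. (cmod (s k x - f x))\<^sup>2) \<longlonglongrightarrow> 0"
      using lim by (intro AE_I2 tendsto_eq_intros refl) (auto intro: LIM_zero tendsto_norm_zero)
    fix k
    show "AE x in lborel. norm ((cmod (s k x - f x))\<^sup>2) \<le> 4 * (cmod (g x))\<^sup>2"
    proof (rule AE_I2)
      fix x
      have "cmod (s k x - f x) \<le> 2 * cmod (g x)"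
        using norm_triangle_ineq4[of "s k x" "f x"] dom[of k x] fdom[of x] by linarith
      then have "(cmod (s k x - f x))\<^sup>2 \<le> (2 * cmod (g x))\<^sup>2" by (intro power_mono) auto
      then show "norm ((cmod (s k x - f x))\<^sup>2) \<le> 4 * (cmod (g x))\<^sup>2"
        by (simp add: power_mult_distrib)
    qed
  qed auto
  then have "(\<lambda>k. (norm (abs_L2 (s k) - abs_L2 f))\<^sup>2) \<longlonglongrightarrow> 0"
    using sq by (simp add: minus_abs_L2 norm_sq_abs sq_int_diff)
  then have "(\<lambda>k. sqrt ((norm (abs_L2 (s k) - abs_L2 f))\<^sup>2)) \<longlonglongrightarrow> sqrt 0"
    by (rule tendsto_real_sqrt)
  then show "(\<lambda>k. abs_L2 (s k)) \<longlonglongrightarrow> abs_L2 f"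
    by (simp add: LIM_zero_iff tendsto_norm_zero_iff)
qed

lemma sq_int_indicator_bounded:
  assumes [measurable]: "A \<in> sets borel" and "bounded A"
  shows "sq_int (\<lambda>x::real^'d::finite. c * indicator A x)"
proof -
  obtain r where r: "A \<subseteq> ball 0 r"
    using assms(2) bounded_subset_ballD by blast
  have "emeasure lborel A \<le> emeasure lborel (ball (0::real^'d) r)"
    using r by (intro emeasure_mono) auto
  also have "\<dots> < \<infinity>"
    using emeasure_lborel_ball_finite by (simp add: less_top)
  finally have "integrable lborel (indicator A :: real^'d \<Rightarrow> real)" by simp
  then have "integrable lborel (\<lambda>x. (cmod (indicator A x :: complex))\<^sup>2)"
    by (rule Bochner_Integration.integrable_cong[THEN iffD1, rotated 2]) (auto simp: indicator_def)
  then show ?thesis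
    by (intro sq_int_scale) (simp add: sq_int_def)
qed

lemma bound_indicator_ball: "bounded (A \<inter> ball (0::'a::real_normed_vector) r)"
  by (meson Int_lower2 bounded_ball bounded_subset)

text \<open>The closure \<open>?K\<close> of a countable additive group is again a group and is
  closed under limits. This suffices to climb from finite unions of basic open sets to open sets,
  Borel sets, simple functions and finally to every element.\<close>

lemma L2_separable: "\<exists>C :: ('d::finite L2) set. countable C \<and> closure C = UNIV"
proof -
  obtain \<B> :: "(real^'d) set set" where \<B>: "countable \<B>" "\<And>C. C \<in> \<B> \<Longrightarrow> open C"
    "\<And>S. open S \<Longrightarrow> \<exists>U. U \<subseteq> \<B> \<and> S = \<Union>U"
    using univ_second_countable by blast
  obtain Z :: "complex set" where Z: "countable Z" "\<And>X. open X \<Longrightarrow> X \<noteq> {} \<Longrightarrow> \<exists>d\<in>Z. d \<in> X"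
    by (erule countable_dense_setE)
  define I where "I c A = abs_L2 (\<lambda>x. c * indicator A x :: complex)" for c and A :: "(real^'d) set"
  define Bn where "Bn n = ball (0::real^'d) (real n)" for n :: nat
  \<comment> \<open>Cutting with the ball \<open>Bn n\<close> gives the sets finite measure, so that
    the indicators are square integrable and no class is the dummy value of a non-integrable
    function.\<close>
  define E where "E = (\<lambda>(c, F, n). I c (\<Union>F \<inter> Bn n)) ` (Z \<times> {F. finite F \<and> F \<subseteq> \<B>} \<times> UNIV)"
  have "countable E"
    unfolding E_def using Z \<B>
    by (intro countable_image countable_SIGMA countable_Collect_finite_subset) auto
  \<comment> \<open>Sums over lists of signed generators are the additive group generated by
    \<open>E\<close>; it is countable because the lists over a countable set are.\<close>
  define C where "C = sum_list ` lists (E \<union> uminus ` E)"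
  have C: "countable C"
    unfolding C_def using \<open>countable E\<close> by (intro countable_image countable_lists) auto
  have C_add: "x + y \<in> C" if xy: "x \<in> C" "y \<in> C" for x y
  proof -
    obtain xs ys where "xs \<in> lists (E \<union> uminus ` E)" "ys \<in> lists (E \<union> uminus ` E)"
      "x = sum_list xs" "y = sum_list ys"
      using xy unfolding C_def by blast
    then show ?thesis unfolding C_def by (intro image_eqI[of _ _ "xs @ ys"]) auto
  qed
  have C_minus: "- x \<in> C" if x: "x \<in> C" for x
  proof -
    obtain xs where xs: "xs \<in> lists (E \<union> uminus ` E)" "x = sum_list xs"
      using x unfolding C_def by blast
    have "sum_list (map uminus xs) = - sum_list xs"
      by (induction xs) auto
    moreover have "- y \<in> E \<union> uminus ` E" if "y \<in> E \<union> uminus ` E" for y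
      using that by (auto simp: image_iff)
    then have "map uminus xs \<in> lists (E \<union> uminus ` E)"
      using xs(1) by (simp only: in_lists_conv_set set_map) blast
    ultimately show ?thesis
      using xs(2) unfolding C_def by (metis image_eqI)
  qed
  let ?K = "closure C"
  have K_lim: "x \<in> ?K" if "\<And>n. s n \<in> ?K" "s \<longlonglongrightarrow> x" for s x
    using that closed_sequentially[OF closed_closure] by blast
  have K_add: "x + y \<in> ?K" if xy: "x \<in> ?K" "y \<in> ?K" for x y
  proof -
    obtain s t where "\<And>n. s n \<in> C" "s \<longlonglongrightarrow> x" "\<And>n. t n \<in> C" "t \<longlonglongrightarrow> y"
      using xy unfolding closure_sequential by metis
    then show ?thesis
      unfolding closure_sequential
      by (intro exI[of _ "\<lambda>n. s n + t n"]) (auto intro: C_add tendsto_add)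
  qed
  have K_minus: "- x \<in> ?K" if xy: "x \<in> ?K" for x
  proof -
    obtain s where "\<And>n. s n \<in> C" "s \<longlonglongrightarrow> x"
      using xy unfolding closure_sequential by metis
    then show ?thesis
      unfolding closure_sequential
      by (intro exI[of _ "\<lambda>n. - s n"]) (auto intro: C_minus tendsto_minus)
  qed
  have K_diff: "x - y \<in> ?K" if "x \<in> ?K" "y \<in> ?K" for x y
    using K_add[OF that(1) K_minus[OF that(2)]] by simp
  have K0: "0 \<in> ?K"
  proof -
    have "0 \<in> C" unfolding C_def by (intro image_eqI[of _ _ "[]"]) auto
    then show ?thesis using closure_subset by blast
  qed
  have K_sum: "finite S \<Longrightarrow> (\<And>i. i \<in> S \<Longrightarrow> f i \<in> ?K) \<Longrightarrow> sum f S \<in> ?K" for f and S :: "complex set"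
    by (induction S rule: finite_induct) (auto intro: K0 K_add)
  have sqI: "sq_int (\<lambda>x. c * indicator (A \<inter> Bn n) x)" if "A \<in> sets borel" for A c n
    using that unfolding Bn_def by (intro sq_int_indicator_bounded bound_indicator_ball) auto
  have [measurable]: "Bn n \<in> sets borel" for n by (simp add: Bn_def)
  have ind_lim: "(\<lambda>k. c * indicator (\<Union>i\<le>k. A i) x :: complex) \<longlonglongrightarrow> c * indicator (\<Union>i. A i) x"
    for A :: "nat \<Rightarrow> (real^'d) set" and x c
    using LIMSEQ_Suc[OF LIMSEQ_indicator_UN[of A x]]
    by (intro tendsto_mult tendsto_const) (simp only: lessThan_Suc_atMost)
  have I_UN: "I c ((\<Union>i::nat. A i) \<inter> Bn n) \<in> ?K"
    if A: "\<And>i. A i \<in> sets borel" and K: "\<And>k. I c ((\<Union>i\<le>k. A i) \<inter> Bn n) \<in> ?K" for A c n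
  proof (rule K_lim[OF K])
    have [measurable]: "A i \<in> sets borel" for i by fact
    show "(\<lambda>k. I c ((\<Union>i\<le>k. A i) \<inter> Bn n)) \<longlonglongrightarrow> I c ((\<Union>i. A i) \<inter> Bn n)"
      unfolding I_def
    proof (rule L2_dominated_convergence(3))
      show "sq_int (\<lambda>x. c * indicator (UNIV \<inter> Bn n) x)" by (rule sqI) simp
      show "cmod (c * indicator ((\<Union>i\<le>k. A i) \<inter> Bn n) x) \<le> cmod (c * indicator (UNIV \<inter> Bn n) x)" for k x
        by (auto simp: indicator_def norm_mult)
      show "(\<lambda>k. c * indicator ((\<Union>i\<le>k. A i) \<inter> Bn n) x) \<longlonglongrightarrow> c * indicator ((\<Union>i. A i) \<inter> Bn n) x" for x
        using tendsto_mult[OF ind_lim[of c A x] tendsto_const[of "indicator (Bn n) x"]]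
        by (simp only: indicator_inter_arith mult.assoc)
    qed measurable
  qed
  \<comment> \<open>Here \<open>c\<close> is an arbitrary complex number. Approximating it from
    \<open>Z\<close> puts all multiples of the indicators into \<open>?K\<close>, so closure under
    scalar multiplication never has to be shown.\<close>
  have I_fin: "I c (\<Union>F \<inter> Bn n) \<in> ?K" if F: "finite F" "F \<subseteq> \<B>" for c F n
  proof -
    have UF[measurable]: "\<Union>F \<in> sets borel" using F \<B> by (intro borel_open) auto
    have "\<exists>z\<in>Z. z \<in> ball c (1 / real (Suc k))" for k by (intro Z(2)) auto
    then obtain z where z: "\<And>k. z k \<in> Z" "\<And>k. z k \<in> ball c (1 / real (Suc k))" by metis
    have "z \<longlonglongrightarrow> c"
    proof (rule metric_LIMSEQ_I)
      fix e :: real assume "e > 0"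
      then obtain m where m: "1 / real (Suc m) < e"
        using reals_Archimedean[of e] by (auto simp: inverse_eq_divide)
      have "dist (z k) c < e" if "k \<ge> m" for k
      proof -
        have "1 / real (Suc k) \<le> 1 / real (Suc m)" using that by (intro divide_left_mono) auto
        then show ?thesis using z(2)[of k] m by (simp add: dist_commute)
      qed
      then show "\<exists>m. \<forall>k\<ge>m. dist (z k) c < e" by blast
    qed
    have "cmod (z k) \<le> cmod c + 1" for k
    proof -
      have "1 / real (Suc k) \<le> 1" by simp
      then have "dist c (z k) \<le> 1" using z(2)[of k] by (simp only: mem_ball)
      then show ?thesis using norm_triangle_ineq2[of "z k" c] by (simp add: dist_norm norm_minus_commute)
    qed
    show ?thesis
    proof (rule K_lim)
      show "I (z k) (\<Union>F \<inter> Bn n) \<in> ?K" for k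
      proof -
        have "I (z k) (\<Union>F \<inter> Bn n) \<in> E" unfolding E_def using z F
          by (intro image_eqI[of _ _ "(z k, F, n)"]) auto
        then have "I (z k) (\<Union>F \<inter> Bn n) \<in> C" unfolding C_def
          by (intro image_eqI[of _ _ "[I (z k) (\<Union>F \<inter> Bn n)]"]) auto
        then show ?thesis using closure_subset by blast
      qed
      show "(\<lambda>k. I (z k) (\<Union>F \<inter> Bn n)) \<longlonglongrightarrow> I c (\<Union>F \<inter> Bn n)"
        unfolding I_def
      proof (rule L2_dominated_convergence(3))
        show "sq_int (\<lambda>x. of_real (cmod c + 1) * indicator (UNIV \<inter> Bn n) x)" by (rule sqI) simp
        show "cmod (z k * indicator (\<Union>F \<inter> Bn n) x) \<le> cmod (of_real (cmod c + 1) * indicator (UNIV \<inter> Bn n) x)" for k x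
          using \<open>cmod (z k) \<le> cmod c + 1\<close> by (auto simp: indicator_def norm_mult)
        show "(\<lambda>k. z k * indicator (\<Union>F \<inter> Bn n) x) \<longlonglongrightarrow> c * indicator (\<Union>F \<inter> Bn n) x" for x
          using \<open>z \<longlonglongrightarrow> c\<close> by (intro tendsto_intros)
      qed measurable
    qed
  qed
  have I_open: "I c (U \<inter> Bn n) \<in> ?K" if U: "open U" for c U n
  proof -
    obtain V where V: "V \<subseteq> \<B>" "U = \<Union>V" using \<B>(3)[OF U] by blast
    show ?thesis
    proof (cases "V = {}")
      case True
      then show ?thesis using I_fin[of "{}" c n] V by simp
    next
      case False
      have "countable V" using V \<B> countable_subset by blast
      then have U_eq: "U = (\<Union>i. from_nat_into V i)"
        using False V by (metis range_from_nat_into)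
      have sub: "from_nat_into V i \<in> \<B>" for i
        using from_nat_into[OF False, of i] V(1) by (rule rev_subsetD)
      show ?thesis
        unfolding U_eq
      proof (rule I_UN)
        show "from_nat_into V i \<in> sets borel" for i by (intro borel_open \<B>(2) sub)
        show "I c ((\<Union>i\<le>k. from_nat_into V i) \<inter> Bn n) \<in> ?K" for k
        proof -
          have "I c (\<Union>(from_nat_into V ` {..k}) \<inter> Bn n) \<in> ?K"
            using sub by (intro I_fin image_subsetI finite_imageI finite_atMost)
          then show ?thesis .
        qed
      qed
    qed
  qed
  \<comment> \<open>Induction over the sigma algebra from its intersection-stable generator of open
    sets: complements use differences in \<open>?K\<close>, disjoint countable unions use finite
    sums followed by the limit \<open>I_UN\<close>.\<close>
  have I_borel: "I c (A \<inter> Bn n) \<in> ?K" if "A \<in> sets borel" for c A n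
  proof -
    have "Int_stable {S :: (real^'d) set. open S}" by (auto simp: Int_stable_def)
    moreover have "{S :: (real^'d) set. open S} \<subseteq> Pow UNIV" by simp
    moreover have "A \<in> sigma_sets UNIV {S. open S}" using that by (simp add: borel_def)
    ultimately show ?thesis
    proof (induction rule: sigma_sets_induct_disjoint[consumes 3])
      case (basic A) then show ?case using I_open by auto
    next
      case empty then show ?case using I_open[of "{}"] by simp
    next
      case (compl A)
      have [measurable]: "A \<in> sets borel" using compl(1) by (simp add: borel_def)
      have "I c ((UNIV - A) \<inter> Bn n) = I c (UNIV \<inter> Bn n) - I c (A \<inter> Bn n)"
        unfolding I_def
        apply (subst minus_abs_L2)
        subgoal by (intro sqI) measurable
        subgoal by (intro sqI) measurable
        subgoal by (intro arg_cong[where f=abs_L2] ext) (auto simp: indicator_def)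
        done
      then show ?case using compl I_open[of UNIV] by (auto intro: K_diff)
    next
      case (union A)
      have A[measurable]: "A i \<in> sets borel" for i using union(2) by (auto simp: borel_def)
      show ?case
      proof (rule I_UN[OF A])
        fix k
        show "I c ((\<Union>i\<le>k. A i) \<inter> Bn n) \<in> ?K"
        proof (induction k)
          case 0 then show ?case using union(3) by simp
        next
          case (Suc k)
          have disj: "A (Suc k) \<inter> A i = {}" if "i \<le> k" for i
            using union(1) that unfolding disjoint_family_on_def by auto
          have "I c ((\<Union>i\<le>Suc k. A i) \<inter> Bn n) = I c ((\<Union>i\<le>k. A i) \<inter> Bn n) + I c (A (Suc k) \<inter> Bn n)"
            unfolding I_def
            apply (subst plus_abs_L2)
            subgoal by (intro sqI) measurable
            subgoal by (intro sqI) measurable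
            subgoal using disj by (intro arg_cong[where f=abs_L2] ext) (auto simp: indicator_def atMost_Suc)
            done
          then show ?case using K_add[OF Suc union(3)[of "Suc k"]] by simp
        qed
      qed
    qed
  qed
  have "u \<in> ?K" for u
  proof -
    let ?f = "rep_L2 u"
    \<comment> \<open>The third property supplies \<open>2 * ?f\<close> as the dominating function
      below. The simple functions are also cut off outside \<open>Bn i\<close>, a ball that grows
      with \<open>i\<close>, so that their level sets fall under \<open>I_borel\<close>.\<close>
    obtain s where s: "\<And>i. simple_function lborel (s i)" "\<And>x. (\<lambda>i. s i x) \<longlonglongrightarrow> ?f x"
      "\<And>i x. dist (s i x) 0 \<le> 2 * dist (?f x) 0"
      using borel_measurable_implies_sequence_metric[of ?f lborel 0] by auto
    have [measurable]: "s i \<in> borel_measurable borel" for i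
      using borel_measurable_simple_function[OF s(1)[of i]] by simp
    have "abs_L2 (\<lambda>x. s i x * indicator (Bn i) x) \<in> ?K" for i
    proof -
      have fin: "finite (range (s i))" using simple_functionD(1)[OF s(1)[of i]] by simp
      have meas: "s i -` {y} \<in> sets borel" for y
        using simple_functionD(2)[OF s(1)[of i], of "{y}"] by simp
      have sum: "finite S \<Longrightarrow> sq_int (\<lambda>x. \<Sum>y\<in>S. y * indicator (s i -` {y} \<inter> Bn i) x) \<and>
        abs_L2 (\<lambda>x. \<Sum>y\<in>S. y * indicator (s i -` {y} \<inter> Bn i) x) = (\<Sum>y\<in>S. I y (s i -` {y} \<inter> Bn i))" for S
      proof (induction S rule: finite_induct)
        case empty then show ?case by (simp add: zero_L2_def)
      next
        case (insert y S)
        define h where "h y x = y * indicator (s i -` {y} \<inter> Bn i) x" for y :: complex and x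
        have "sq_int (h y)" unfolding h_def by (rule sqI[OF meas])
        moreover have "sq_int (\<lambda>x. \<Sum>y\<in>S. h y x)"
          "abs_L2 (\<lambda>x. \<Sum>y\<in>S. h y x) = (\<Sum>y\<in>S. I y (s i -` {y} \<inter> Bn i))"
          using insert.IH unfolding h_def by blast+
        moreover have "I y (s i -` {y} \<inter> Bn i) = abs_L2 (h y)"
          unfolding I_def h_def ..
        ultimately show ?case
          unfolding h_def[symmetric] using insert.hyps
          by (simp add: sq_int_add plus_abs_L2[symmetric])
      qed
      have eq: "s i x * indicator (Bn i) x = (\<Sum>y\<in>range (s i). y * indicator (s i -` {y} \<inter> Bn i) x)" for x
      proof -
        have "(\<Sum>y\<in>range (s i). y * indicator (s i -` {y} \<inter> Bn i) x) =
          (\<Sum>y\<in>range (s i). if y = s i x then s i x * indicator (Bn i) x else 0)"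
          by (intro sum.cong) (auto simp: indicator_def)
        then show ?thesis using fin by simp
      qed
      show ?thesis
        unfolding eq conjunct2[OF sum[OF fin]] by (intro K_sum fin I_borel meas)
    qed
    moreover have "(\<lambda>i. abs_L2 (\<lambda>x. s i x * indicator (Bn i) x)) \<longlonglongrightarrow> abs_L2 ?f"
    proof (rule L2_dominated_convergence(3))
      show "sq_int (\<lambda>x. 2 * ?f x)" by (intro sq_int_scale) simp
      show "cmod (s k x * indicator (Bn k) x) \<le> cmod (2 * ?f x)" for k x
        using s(3)[of k x] by (cases "x \<in> Bn k") (simp_all add: norm_mult)
      fix x
      have "(\<lambda>i. s i x * indicator (Bn i) x) \<longlonglongrightarrow> ?f x * 1"
      proof (intro tendsto_mult s(2) tendsto_eventually)
        obtain m :: nat where m: "norm x < real m" using reals_Archimedean2 by blast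
        show "\<forall>\<^sub>F i in sequentially. indicator (Bn i) x = (1::complex)"
          using eventually_ge_at_top[of m] by eventually_elim (use m in \<open>auto simp: Bn_def\<close>)
      qed
      then show "(\<lambda>i. s i x * indicator (Bn i) x) \<longlonglongrightarrow> ?f x" by simp
    qed measurable
    ultimately have "abs_L2 ?f \<in> ?K" by (rule K_lim)
    then show ?thesis by (simp only: abs_rep_L2)
  qed
  then show ?thesis using C by blast
qed

text \<open>Measurability of sums and inner products of \<open>L2\<close>-valued random variables
  rests on this instance.\<close>

instance L2 :: (finite) second_countable_topology
proof
  show "\<exists>B :: 'a L2 set set. countable B \<and> open = generate_topology B"
    using L2_separable second_countable_of_dense by blast
qed

section \<open>Square integrable random vectors\<close>

text \<open>The elements of L2(M; H). The type class leaves completeness of H out, so only real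
  functions, norms and inner products, are integrated.\<close>

definition sqi :: "'a measure \<Rightarrow> ('a \<Rightarrow> 'h::{real_inner, second_countable_topology}) \<Rightarrow> bool" where
  "sqi M f \<longleftrightarrow> f \<in> borel_measurable M \<and> integrable M (\<lambda>x. (norm (f x))\<^sup>2)"

lemma sqi_measurable: "sqi M f \<Longrightarrow> f \<in> borel_measurable M"
  by (simp add: sqi_def)

lemma sqi_integrable: "sqi M f \<Longrightarrow> integrable M (\<lambda>x. (norm (f x))\<^sup>2)"
  by (simp add: sqi_def)

lemma sqi_iff_nn_integral:
  "sqi M f \<longleftrightarrow> f \<in> borel_measurable M \<and> (\<integral>\<^sup>+ x. ennreal ((norm (f x))\<^sup>2) \<partial>M) < \<infinity>"
  by (auto simp: sqi_def integrable_iff_bounded)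

lemma nn_integral_sqi:
  assumes "sqi M f"
  shows "(\<integral>\<^sup>+ x. ennreal ((norm (f x))\<^sup>2) \<partial>M) = ennreal (LINT x|M. (norm (f x))\<^sup>2)"
  by (rule nn_integral_eq_integral[OF sqi_integrable[OF assms]]) simp

lemma sqi_bound:
  assumes f: "f \<in> borel_measurable M" and g: "sqi M g"
    and le: "AE x in M. norm (f x) \<le> c * norm (g x)"
  shows "sqi M f"
  unfolding sqi_def
proof
  have [measurable]: "f \<in> borel_measurable M" by fact
  have "integrable M (\<lambda>x. c\<^sup>2 * (norm (g x))\<^sup>2)"
    using sqi_integrable[OF g] by simp
  then show "integrable M (\<lambda>x. (norm (f x))\<^sup>2)"
  proof (rule Bochner_Integration.integrable_bound)
    show "AE x in M. norm ((norm (f x))\<^sup>2) \<le> norm (c\<^sup>2 * (norm (g x))\<^sup>2)"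
      using le
    proof eventually_elim
      case (elim x)
      have "(norm (f x))\<^sup>2 \<le> (c * norm (g x))\<^sup>2"
        using elim by (intro power_mono) auto
      then show ?case by (simp add: power_mult_distrib)
    qed
  qed measurable
qed fact

lemma sqi_cong_AE:
  assumes "sqi M g" "f \<in> borel_measurable M" "AE x in M. f x = g x"
  shows "sqi M f"
  by (rule sqi_bound[OF assms(2,1), of 1]) (use assms(3) in auto)

lemma sqi_zero [simp]: "sqi M (\<lambda>x. 0)"
  by (simp add: sqi_def)

lemma sqi_const: "finite_measure M \<Longrightarrow> sqi M (\<lambda>x. c)"
  by (simp add: sqi_def finite_measure.integrable_const)

lemma sqi_scaleR: "sqi M f \<Longrightarrow> sqi M (\<lambda>x. c *\<^sub>R f x)"
  by (rule sqi_bound[where g=f and c="\<bar>c\<bar>"])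
    (auto intro: borel_measurable_scaleR dest: sqi_measurable)

lemma sqi_uminus: "sqi M f \<Longrightarrow> sqi M (\<lambda>x. - f x)"
  using sqi_scaleR[of M f "-1"] by simp

lemma sqi_inner:
  assumes f: "sqi M f" and g: "sqi M g"
  shows "integrable M (\<lambda>x. f x \<bullet> g x)"
proof -
  have [measurable]: "f \<in> borel_measurable M" "g \<in> borel_measurable M"
    using f g by (auto dest: sqi_measurable)
  have "integrable M (\<lambda>x. (norm (f x))\<^sup>2 + (norm (g x))\<^sup>2)"
    using f g by (intro Bochner_Integration.integrable_add sqi_integrable)
  then show ?thesis
  proof (rule Bochner_Integration.integrable_bound)
    have "\<bar>f x \<bullet> g x\<bar> \<le> (norm (f x))\<^sup>2 + (norm (g x))\<^sup>2" for x
    proof -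
      have "2 * (norm (f x) * norm (g x)) \<le> (norm (f x))\<^sup>2 + (norm (g x))\<^sup>2"
        using sum_squares_bound[of "norm (f x)" "norm (g x)"] by (simp add: mult.assoc)
      then show ?thesis
        using Cauchy_Schwarz_ineq2[of "f x" "g x"] mult_nonneg_nonneg[OF norm_ge_zero norm_ge_zero, of "f x" "g x"]
        by linarith
    qed
    then show "AE x in M. norm (f x \<bullet> g x) \<le> norm ((norm (f x))\<^sup>2 + (norm (g x))\<^sup>2)"
      by (intro AE_I2) (auto intro: order_trans)
  qed measurable
qed

lemma norm_add_sq: "(norm (a + b))\<^sup>2 = (norm a)\<^sup>2 + 2 * (a \<bullet> b) + (norm (b :: 'h::real_inner))\<^sup>2"
  by (simp add: power2_norm_eq_inner inner_add inner_commute)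

lemma norm_add_sq_le: "(norm (a + b))\<^sup>2 \<le> 2 * (norm a)\<^sup>2 + 2 * (norm (b :: 'h::real_inner))\<^sup>2"
  using norm_add_sq[of a b] norm_add_sq[of a "- b"] zero_le_power2[of "norm (a + - b)"] by simp

lemma sqi_add:
  assumes f: "sqi M f" and g: "sqi M g"
  shows "sqi M (\<lambda>x. f x + g x)"
  unfolding sqi_def norm_add_sq
  using f g
  by (intro conjI borel_measurable_add Bochner_Integration.integrable_add integrable_mult_right
      sqi_inner sqi_integrable sqi_measurable)

lemma sqi_diff: "sqi M f \<Longrightarrow> sqi M g \<Longrightarrow> sqi M (\<lambda>x. f x - g x)"
  using sqi_add[of M f "\<lambda>x. - g x"] by (simp add: sqi_uminus)

lemma sqi_sum: "(\<And>i. i \<in> S \<Longrightarrow> sqi M (f i)) \<Longrightarrow> sqi M (\<lambda>x. \<Sum>i\<in>S. f i x)"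
  by (induction S rule: infinite_finite_induct) (auto intro: sqi_add)

lemma integral_inner_sum_right:
  assumes "sqi M f" "\<And>i. i \<in> S \<Longrightarrow> sqi M (g i)"
  shows "(LINT x|M. f x \<bullet> (\<Sum>i\<in>S. g i x)) = (\<Sum>i\<in>S. LINT x|M. f x \<bullet> g i x)"
  unfolding inner_sum_right
  by (rule Bochner_Integration.integral_sum) (use assms in \<open>auto intro: sqi_inner\<close>)

lemma integral_inner_sum:
  assumes "\<And>i. i \<in> S \<Longrightarrow> sqi M (f i)" "\<And>i. i \<in> S' \<Longrightarrow> sqi M (g i)"
  shows "(LINT x|M. (\<Sum>i\<in>S. f i x) \<bullet> (\<Sum>j\<in>S'. g j x)) = (\<Sum>i\<in>S. \<Sum>j\<in>S'. LINT x|M. f i x \<bullet> g j x)"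
proof -
  have "(LINT x|M. (\<Sum>i\<in>S. f i x) \<bullet> (\<Sum>j\<in>S'. g j x)) = (\<Sum>i\<in>S. LINT x|M. f i x \<bullet> (\<Sum>j\<in>S'. g j x))"
    unfolding inner_sum_left
    by (rule Bochner_Integration.integral_sum) (intro sqi_inner sqi_sum assms)
  also have "\<dots> = (\<Sum>i\<in>S. \<Sum>j\<in>S'. LINT x|M. f i x \<bullet> g j x)"
    by (intro sum.cong refl integral_inner_sum_right assms)
  finally show ?thesis .
qed

lemma integral_norm_add_sq:
  assumes f: "sqi M f" and g: "sqi M g"
  shows "(LINT x|M. (norm (f x + g x))\<^sup>2) =
    (LINT x|M. (norm (f x))\<^sup>2) + 2 * (LINT x|M. f x \<bullet> g x) + (LINT x|M. (norm (g x))\<^sup>2)"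
  unfolding norm_add_sq using f g by (simp add: sqi_inner sqi_integrable)

lemma integral_norm_diff_sq:
  assumes f: "sqi M f" and g: "sqi M g"
  shows "(LINT x|M. (norm (f x - g x))\<^sup>2) =
    (LINT x|M. (norm (f x))\<^sup>2) - 2 * (LINT x|M. f x \<bullet> g x) + (LINT x|M. (norm (g x))\<^sup>2)"
  using integral_norm_add_sq[OF f sqi_uminus[OF g]] by simp

lemma discriminant_le_of_nonneg:
  fixes a b c :: real
  assumes pos: "\<And>t. 0 \<le> a + 2 * t * c + t\<^sup>2 * b" and nonneg: "0 \<le> a" "0 \<le> b"
  shows "c\<^sup>2 \<le> a * b"
proof (cases "b = 0")
  case True
  have "c = 0"
  proof (rule ccontr)
    assume "c \<noteq> 0"
    \<comment> \<open>The chosen \<open>t\<close> turns the expression into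
      \<open>a - (a + 1) = -1\<close>.\<close>
    then show False
      using pos[of "- (a + 1) / (2 * c)"] True nonneg by (simp add: field_simps)
  qed
  then show ?thesis using True by simp
next
  case False
  then have "0 < b" using nonneg by simp
  \<comment> \<open>The value at the minimum \<open>t = - c / b\<close> of the quadratic.\<close>
  have "0 \<le> a - c\<^sup>2 / b"
    using pos[of "- c / b"] False by (simp add: power2_eq_square field_simps)
  then show ?thesis using \<open>0 < b\<close> by (simp add: field_simps)
qed

text \<open>The classical argument in L2(M; H): the expectation of the squared norm of
  \<open>f + t g\<close> is a nonnegative quadratic polynomial in \<open>t\<close>.\<close>

lemma sqi_Cauchy_Schwarz:
  assumes f: "sqi M f" and g: "sqi M g"
  shows "\<bar>LINT x|M. f x \<bullet> g x\<bar> \<le> sqrt (LINT x|M. (norm (f x))\<^sup>2) * sqrt (LINT x|M. (norm (g x))\<^sup>2)"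
proof -
  let ?A = "LINT x|M. (norm (f x))\<^sup>2" and ?B = "LINT x|M. (norm (g x))\<^sup>2" and ?C = "LINT x|M. f x \<bullet> g x"
  have nonneg: "0 \<le> ?A" "0 \<le> ?B" by simp_all
  have pos: "0 \<le> ?A + 2 * t * ?C + t\<^sup>2 * ?B" for t
  proof -
    have "0 \<le> (LINT x|M. (norm (f x + t *\<^sub>R g x))\<^sup>2)" by simp
    also have "\<dots> = ?A + 2 * t * ?C + t\<^sup>2 * ?B"
      using integral_norm_add_sq[OF f sqi_scaleR[OF g, of t]] by (simp add: power_mult_distrib)
    finally show ?thesis .
  qed
  have "?C\<^sup>2 \<le> ?A * ?B"
    by (rule discriminant_le_of_nonneg[OF pos nonneg])
  then have "sqrt (?C\<^sup>2) \<le> sqrt (?A * ?B)" by (rule real_sqrt_le_mono)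
  then show ?thesis by (simp add: real_sqrt_mult)
qed

section \<open>Mean-square limits with finite second moments\<close>

definition ms_lim ::
    "'a measure \<Rightarrow> (nat \<Rightarrow> 'a \<Rightarrow> 'h::{real_inner, second_countable_topology}) \<Rightarrow> ('a \<Rightarrow> 'h) \<Rightarrow> bool" where
  "ms_lim M X Y \<longleftrightarrow> (\<forall>n. sqi M (X n)) \<and> sqi M Y \<and> (\<lambda>n. LINT x|M. (norm (X n x - Y x))\<^sup>2) \<longlonglongrightarrow> 0"

text \<open>A single index at finite distance shows that \<open>Y\<close> is square integrable, as a
  term minus a square integrable difference. From then on the nonnegative integrals are ordinary
  ones.\<close>

lemma ms_limI:
  assumes X: "\<And>n. sqi M (X n)" and Y[measurable]: "Y \<in> borel_measurable M"
    and lim: "(\<lambda>n. \<integral>\<^sup>+ x. ennreal ((norm (X n x - Y x))\<^sup>2) \<partial>M) \<longlonglongrightarrow> 0"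
  shows "ms_lim M X Y"
proof -
  have [measurable]: "X n \<in> borel_measurable M" for n using X by (rule sqi_measurable)
  have "\<forall>\<^sub>F n in sequentially. (\<integral>\<^sup>+ x. ennreal ((norm (X n x - Y x))\<^sup>2) \<partial>M) < 1"
    using order_tendstoD(2)[OF lim, of 1] by simp
  then obtain n where "(\<integral>\<^sup>+ x. ennreal ((norm (X n x - Y x))\<^sup>2) \<partial>M) < 1"
    by (auto simp: eventually_sequentially)
  then have "sqi M (\<lambda>x. X n x - Y x)"
    by (auto simp: sqi_iff_nn_integral less_top intro: less_trans)
  from sqi_diff[OF X[of n] this] have Ys: "sqi M Y" by simp
  have "(\<lambda>n. enn2real (\<integral>\<^sup>+ x. ennreal ((norm (X n x - Y x))\<^sup>2) \<partial>M)) \<longlonglongrightarrow> 0"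
    using lim by (intro tendsto_enn2real) auto
  then have "(\<lambda>n. LINT x|M. (norm (X n x - Y x))\<^sup>2) \<longlonglongrightarrow> 0"
    by (simp add: integral_eq_nn_integral)
  then show ?thesis using X Ys by (simp add: ms_lim_def)
qed

lemma ms_lim_of_mean_square_lim:
  assumes "\<And>n. sqi M (X n)" "mean_square_lim M X Y"
  shows "ms_lim M X Y"
  using assms by (intro ms_limI) (auto simp: mean_square_lim_def)

lemma ms_lim_const: "sqi M Y \<Longrightarrow> ms_lim M (\<lambda>n. Y) Y"
  by (simp add: ms_lim_def)

lemma LIMSEQ_null_bound:
  fixes a b :: "nat \<Rightarrow> real"
  assumes "\<And>n. \<bar>a n\<bar> \<le> b n" "b \<longlonglongrightarrow> 0"
  shows "a \<longlonglongrightarrow> 0"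
  by (rule Lim_null_comparison[OF _ assms(2)]) (simp add: assms(1))

lemma ms_lim_add:
  assumes "ms_lim M X Y" "ms_lim M X' Y'"
  shows "ms_lim M (\<lambda>n x. X n x + X' n x) (\<lambda>x. Y x + Y' x)"
proof -
  have sq: "sqi M (\<lambda>x. X n x - Y x)" "sqi M (\<lambda>x. X' n x - Y' x)" for n
    using assms by (auto simp: ms_lim_def intro: sqi_diff)
  have sq': "sqi M (\<lambda>x. X n x + X' n x - (Y x + Y' x))" for n
    unfolding add_diff_add by (rule sqi_add[OF sq])
  have "(LINT x|M. (norm (X n x + X' n x - (Y x + Y' x)))\<^sup>2) \<le>
      2 * (LINT x|M. (norm (X n x - Y x))\<^sup>2) + 2 * (LINT x|M. (norm (X' n x - Y' x))\<^sup>2)" for n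
  proof -
    have "(norm (X n x + X' n x - (Y x + Y' x)))\<^sup>2 \<le>
        2 * (norm (X n x - Y x))\<^sup>2 + 2 * (norm (X' n x - Y' x))\<^sup>2" for x
      unfolding add_diff_add by (rule norm_add_sq_le)
    then have "(LINT x|M. (norm (X n x + X' n x - (Y x + Y' x)))\<^sup>2) \<le>
        (LINT x|M. 2 * (norm (X n x - Y x))\<^sup>2 + 2 * (norm (X' n x - Y' x))\<^sup>2)"
      by (intro integral_mono Bochner_Integration.integrable_add integrable_mult_right
          sqi_integrable sq sq')
    then show ?thesis using sq by (simp add: sqi_integrable)
  qed
  moreover have "(\<lambda>n. 2 * (LINT x|M. (norm (X n x - Y x))\<^sup>2) + 2 * (LINT x|M. (norm (X' n x - Y' x))\<^sup>2))
      \<longlonglongrightarrow> 2 * 0 + 2 * 0"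
    using assms unfolding ms_lim_def by (intro tendsto_intros) auto
  ultimately have "(\<lambda>n. LINT x|M. (norm (X n x + X' n x - (Y x + Y' x)))\<^sup>2) \<longlonglongrightarrow> 0"
    by (intro LIMSEQ_null_bound[of "\<lambda>n. LINT x|M. (norm (X n x + X' n x - (Y x + Y' x)))\<^sup>2"]) auto
  then show ?thesis
    using assms by (auto simp: ms_lim_def intro: sqi_add)
qed

lemma ms_lim_uminus: "ms_lim M X Y \<Longrightarrow> ms_lim M (\<lambda>n x. - X n x) (\<lambda>x. - Y x)"
  unfolding ms_lim_def minus_diff_minus norm_minus_cancel by (auto intro: sqi_uminus)

lemma ms_lim_diff:
  "ms_lim M X Y \<Longrightarrow> ms_lim M X' Y' \<Longrightarrow> ms_lim M (\<lambda>n x. X n x - X' n x) (\<lambda>x. Y x - Y' x)"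
  using ms_lim_add[of M X Y "\<lambda>n x. - X' n x"] ms_lim_uminus by fastforce

text \<open>Continuity of the inner product of L2(M; H): the difference splits into three products,
  each with a factor that tends to zero. Isometries and martingale identities pass to the limit
  through this lemma.\<close>

lemma ms_lim_inner:
  assumes X: "ms_lim M X Y" and X': "ms_lim M X' Y'"
  shows "(\<lambda>n. LINT x|M. X n x \<bullet> X' n x) \<longlonglongrightarrow> (LINT x|M. Y x \<bullet> Y' x)"
proof -
  have sq: "sqi M Y" "sqi M Y'" "sqi M (X n)" "sqi M (X' n)"
      "sqi M (\<lambda>x. X n x - Y x)" "sqi M (\<lambda>x. X' n x - Y' x)" for n
    using assms by (auto simp: ms_lim_def intro: sqi_diff)
  let ?a = "\<lambda>n. LINT x|M. (norm (X n x - Y x))\<^sup>2" and ?b = "\<lambda>n. LINT x|M. (norm (X' n x - Y' x))\<^sup>2"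
  let ?A = "LINT x|M. (norm (Y x))\<^sup>2" and ?B = "LINT x|M. (norm (Y' x))\<^sup>2"
  have lims: "?a \<longlonglongrightarrow> 0" "?b \<longlonglongrightarrow> 0" using assms by (auto simp: ms_lim_def)
  have "\<bar>(LINT x|M. X n x \<bullet> X' n x) - (LINT x|M. Y x \<bullet> Y' x)\<bar> \<le>
      sqrt (?a n) * sqrt (?b n) + sqrt (?a n) * sqrt ?B + sqrt ?A * sqrt (?b n)" for n
  proof -
    have "(LINT x|M. X n x \<bullet> X' n x) - (LINT x|M. Y x \<bullet> Y' x) =
        (LINT x|M. X n x \<bullet> X' n x - Y x \<bullet> Y' x)"
      using sq by (simp add: sqi_inner)
    also have "\<dots> = (LINT x|M. (X n x - Y x) \<bullet> (X' n x - Y' x) + (X n x - Y x) \<bullet> Y' x + Y x \<bullet> (X' n x - Y' x))"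
      by (simp add: inner_diff algebra_simps)
    also have "\<dots> = (LINT x|M. (X n x - Y x) \<bullet> (X' n x - Y' x)) +
        (LINT x|M. (X n x - Y x) \<bullet> Y' x) + (LINT x|M. Y x \<bullet> (X' n x - Y' x))"
      using sq by (simp add: sqi_inner)
    finally show ?thesis
      using sqi_Cauchy_Schwarz[OF sq(5) sq(6), of n n] sqi_Cauchy_Schwarz[OF sq(5) sq(2), of n]
        sqi_Cauchy_Schwarz[OF sq(1) sq(6), of n] by linarith
  qed
  moreover have "(\<lambda>n. sqrt (?a n) * sqrt (?b n) + sqrt (?a n) * sqrt ?B + sqrt ?A * sqrt (?b n))
      \<longlonglongrightarrow> sqrt 0 * sqrt 0 + sqrt 0 * sqrt ?B + sqrt ?A * sqrt 0"
    by (intro tendsto_intros lims)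
  ultimately have "(\<lambda>n. \<bar>(LINT x|M. X n x \<bullet> X' n x) - (LINT x|M. Y x \<bullet> Y' x)\<bar>) \<longlonglongrightarrow> 0"
    by (intro LIMSEQ_null_bound[of "\<lambda>n. \<bar>(LINT x|M. X n x \<bullet> X' n x) - (LINT x|M. Y x \<bullet> Y' x)\<bar>"]) auto
  then show ?thesis
    by (simp add: tendsto_rabs_zero_iff LIM_zero_iff)
qed

lemma ms_lim_norm:
  assumes "ms_lim M X Y"
  shows "(\<lambda>n. LINT x|M. (norm (X n x))\<^sup>2) \<longlonglongrightarrow> (LINT x|M. (norm (Y x))\<^sup>2)"
  using ms_lim_inner[OF assms assms] by (simp add: power2_norm_eq_inner)

section \<open>Brownian increments\<close>

locale brownian_family = prob_space M for M :: "'w measure" +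
  fixes F :: "real \<Rightarrow> 'w measure" and \<beta> :: "nat \<Rightarrow> real \<Rightarrow> 'w \<Rightarrow> real"
  assumes filtered: "filtered_prob_space M F" and bm: "indep_brownian_motions M F \<beta>"
begin

lemma subalg: "0 \<le> t \<Longrightarrow> subalgebra M (F t)"
  using filtered by (simp add: filtered_prob_space_def)

lemma space_F: "0 \<le> t \<Longrightarrow> space (F t) = space M"
  using subalg by (auto simp: subalgebra_def)

lemma F_measurable: "0 \<le> t \<Longrightarrow> X \<in> measurable (F t) N \<Longrightarrow> X \<in> measurable M N"
  by (rule measurable_from_subalg[OF subalg])

lemma F_mono: "0 \<le> s \<Longrightarrow> s \<le> t \<Longrightarrow> X \<in> measurable (F s) N \<Longrightarrow> X \<in> measurable (F t) N"
  by (rule measurable_from_subalg[of "F t" "F s"])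
    (use filtered in \<open>auto simp: subalgebra_def filtered_prob_space_def\<close>)

lemma bm_measurable_F: "0 \<le> t \<Longrightarrow> \<beta> k t \<in> borel_measurable (F t)"
  using bm by (auto simp: indep_brownian_motions_def brownian_motion_def)

abbreviation incr :: "nat \<Rightarrow> real \<Rightarrow> real \<Rightarrow> 'w \<Rightarrow> real" where
  "incr k s t \<omega> \<equiv> \<beta> k t \<omega> - \<beta> k s \<omega>"

lemma incr_measurable_F:
  assumes "0 \<le> s" "s \<le> t" "t \<le> r"
  shows "incr k s t \<in> borel_measurable (F r)"
proof (rule borel_measurable_diff)
  show "\<beta> k t \<in> borel_measurable (F r)"
    using assms by (intro F_mono[OF _ _ bm_measurable_F]) auto
  show "\<beta> k s \<in> borel_measurable (F r)"
    using assms by (intro F_mono[OF _ _ bm_measurable_F]) auto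
qed

lemma incr_measurable: "0 \<le> s \<Longrightarrow> s \<le> t \<Longrightarrow> incr k s t \<in> borel_measurable M"
  by (rule F_measurable[OF _ incr_measurable_F[of s t t]]) auto

lemma incr_normal:
  "0 \<le> s \<Longrightarrow> s < t \<Longrightarrow> distributed M lborel (incr k s t) (normal_density 0 (sqrt (t - s)))"
  using bm by (auto simp: indep_brownian_motions_def brownian_motion_def)

lemma incr_moments:
  assumes "0 \<le> s" "s < t"
  shows "integrable M (incr k s t)" "expectation (incr k s t) = 0"
    "integrable M (\<lambda>\<omega>. (incr k s t \<omega>)\<^sup>2)" "expectation (\<lambda>\<omega>. (incr k s t \<omega>)\<^sup>2) = t - s"
proof -
  note D = incr_normal[OF assms, of k]
  show "integrable M (incr k s t)"
    by (rule distributed_integrable[OF D, of "\<lambda>x. x", THEN iffD1]) (use assms in \<open>auto intro: integrable_normal_moment_nz_1\<close>)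
  show e: "expectation (incr k s t) = 0"
    by (rule normal_distributed_expectation[OF _ D]) (use assms in simp)
  show "integrable M (\<lambda>\<omega>. (incr k s t \<omega>)\<^sup>2)"
    by (rule distributed_integrable[OF D, of "\<lambda>x. x\<^sup>2", THEN iffD1])
      (use integrable_normal_moment[of "sqrt (t - s)" 0 2] assms in auto)
  show "expectation (\<lambda>\<omega>. (incr k s t \<omega>)\<^sup>2) = t - s"
    using normal_distributed_variance[OF _ D] e assms by simp
qed

text \<open>Independence is assumed for whole paths; the map \<open>p \<mapsto> p t - p s\<close>
  transfers it to the increments, so the mean of a product with \<open>k \<noteq> l\<close>
  factorizes into zeros.\<close>

lemma incr_product:
  assumes "0 \<le> s" "s < t"
  shows "integrable M (\<lambda>\<omega>. incr k s t \<omega> * incr l s t \<omega>)"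
    "expectation (\<lambda>\<omega>. incr k s t \<omega> * incr l s t \<omega>) = (if k = l then t - s else 0)"
proof -
  have "indep_vars (\<lambda>_. PiM {0..} (\<lambda>_. borel)) (\<lambda>k \<omega>. \<lambda>t\<in>{0..}. \<beta> k t \<omega>) UNIV"
    using bm by (simp add: indep_brownian_motions_def)
  then have "indep_vars (\<lambda>_. borel) (\<lambda>k \<omega>. (\<lambda>p. p t - p s) (\<lambda>t\<in>{0..}. \<beta> k t \<omega>)) UNIV"
    by (rule indep_vars_compose2[where Y="\<lambda>_ p. p t - p s"])
      (use assms in \<open>auto intro!: borel_measurable_diff measurable_component_singleton\<close>)
  then have "indep_vars (\<lambda>_. borel) (\<lambda>k. incr k s t) UNIV"
    using assms by simp
  then have ind: "indep_vars (\<lambda>_. borel) (\<lambda>k. incr k s t) {k, l}"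
    by (rule indep_vars_subset) simp
  note m = incr_moments[OF assms]
  have "integrable M (\<lambda>\<omega>. incr k s t \<omega> * incr l s t \<omega>) \<and>
      expectation (\<lambda>\<omega>. incr k s t \<omega> * incr l s t \<omega>) = (if k = l then t - s else 0)"
  proof (cases "k = l")
    case True
    then show ?thesis using m(3,4)[of k] by (simp add: power2_eq_square)
  next
    case False
    then show ?thesis
      using indep_vars_integrable[OF _ ind] indep_vars_lebesgue_integral[OF _ ind] m(1,2) by simp
  qed
  then show "integrable M (\<lambda>\<omega>. incr k s t \<omega> * incr l s t \<omega>)"
    "expectation (\<lambda>\<omega>. incr k s t \<omega> * incr l s t \<omega>) = (if k = l then t - s else 0)" by auto
qed

text \<open>The function \<open>h\<close> sees the increments of the whole family, since products of
  increments of two different Brownian motions must be independent of the past as well.\<close>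

lemma indep_incr:
  assumes st: "0 \<le> s" "s < t" and Z: "Z \<in> borel_measurable (F s)"
    and h: "h \<in> borel_measurable (PiM UNIV (\<lambda>_. borel))"
  shows "indep_var borel Z borel (\<lambda>\<omega>. h (\<lambda>k. incr k s t \<omega>))"
proof -
  let ?V = "vimage_algebra (space M) (\<lambda>\<omega> k. incr k s t \<omega>) (PiM UNIV (\<lambda>_. borel))"
  have "(\<lambda>\<omega> k. incr k s t \<omega>) \<in> measurable M (PiM UNIV (\<lambda>_. borel))"
    using st by (intro measurable_PiM_single') (auto intro: incr_measurable)
  then have rv: "(\<lambda>\<omega>. h (\<lambda>k. incr k s t \<omega>)) \<in> borel_measurable M"
    using h by (rule measurable_compose)
  have "(\<lambda>\<omega> k. incr k s t \<omega>) \<in> measurable ?V (PiM UNIV (\<lambda>_. borel))"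
    by (rule measurable_vimage_algebra1) (auto simp: space_PiM)
  then have V: "(\<lambda>\<omega>. h (\<lambda>k. incr k s t \<omega>)) \<in> borel_measurable ?V"
    using h by (rule measurable_compose)
  have "indep_set (sets (F s)) (sets ?V)"
    using bm st by (simp add: indep_brownian_motions_def)
  then have "indep_set
      (sigma_sets (space M) {Z -` A \<inter> space M |A. A \<in> sets borel})
      (sigma_sets (space M) {(\<lambda>\<omega>. h (\<lambda>k. incr k s t \<omega>)) -` A \<inter> space M |A. A \<in> sets borel})"
    unfolding indep_set_def
  proof (rule indep_sets_mono_sets)
    fix i :: bool
    have "sigma_sets (space (F s)) {Z -` A \<inter> space (F s) |A. A \<in> sets borel} \<subseteq> sets (F s)"
      using Z by (intro sets.sigma_sets_subset) (auto intro: measurable_sets)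
    moreover have "sigma_sets (space ?V) {(\<lambda>\<omega>. h (\<lambda>k. incr k s t \<omega>)) -` A \<inter> space ?V |A. A \<in> sets borel} \<subseteq> sets ?V"
      using measurable_sets[OF V] by (intro sets.sigma_sets_subset) blast
    ultimately show "case_bool
        (sigma_sets (space M) {Z -` A \<inter> space M |A. A \<in> sets borel})
        (sigma_sets (space M) {(\<lambda>\<omega>. h (\<lambda>k. incr k s t \<omega>)) -` A \<inter> space M |A. A \<in> sets borel}) i
      \<subseteq> case_bool (sets (F s)) (sets ?V) i"
      using space_F[OF st(1)] by (cases i) simp_all
  qed
  then show ?thesis
    unfolding indep_var_eq using rv F_measurable[OF st(1) Z] by simp
qed

section \<open>Increments multiplied by factors known at the left end point\<close>

lemma expectation_incr:
  assumes st: "0 \<le> s" "s < t" and Z: "Z \<in> borel_measurable (F s)" "integrable M Z"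
  shows "integrable M (\<lambda>\<omega>. Z \<omega> * incr k s t \<omega>)" "expectation (\<lambda>\<omega>. Z \<omega> * incr k s t \<omega>) = 0"
proof -
  have "indep_var borel Z borel (incr k s t)"
    using indep_incr[OF st Z(1), of "\<lambda>p. p k"] by simp
  from indep_var_integrable[OF this Z(2)] indep_var_lebesgue_integral[OF this Z(2)]
  show "integrable M (\<lambda>\<omega>. Z \<omega> * incr k s t \<omega>)" "expectation (\<lambda>\<omega>. Z \<omega> * incr k s t \<omega>) = 0"
    using incr_moments[OF st, of k] by auto
qed

lemma expectation_incr_product:
  assumes st: "0 \<le> s" "s < t" and Z: "Z \<in> borel_measurable (F s)" "integrable M Z"
  shows "integrable M (\<lambda>\<omega>. Z \<omega> * (incr k s t \<omega> * incr l s t \<omega>))"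
    "expectation (\<lambda>\<omega>. Z \<omega> * (incr k s t \<omega> * incr l s t \<omega>)) = (if k = l then t - s else 0) * expectation Z"
proof -
  have "indep_var borel Z borel (\<lambda>\<omega>. incr k s t \<omega> * incr l s t \<omega>)"
    using indep_incr[OF st Z(1), of "\<lambda>p. p k * p l"] by simp
  from indep_var_integrable[OF this Z(2)] indep_var_lebesgue_integral[OF this Z(2)]
  show "integrable M (\<lambda>\<omega>. Z \<omega> * (incr k s t \<omega> * incr l s t \<omega>))"
    "expectation (\<lambda>\<omega>. Z \<omega> * (incr k s t \<omega> * incr l s t \<omega>)) = (if k = l then t - s else 0) * expectation Z"
    using incr_product[OF st, of k l] by auto
qed

text \<open>For \<open>s = t\<close> the product is zero, so adaptedness is asked only for
  \<open>s < t\<close>. Intervals truncated at an earlier time degenerate in this way and lose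
  adaptedness of their coefficient.\<close>

lemma sqi_incr:
  assumes st: "0 \<le> s" "s \<le> t" and \<xi>: "sqi M \<xi>" "s < t \<Longrightarrow> \<xi> \<in> borel_measurable (F s)"
  shows "sqi M (\<lambda>\<omega>. incr k s t \<omega> *\<^sub>R \<xi> \<omega>)"
proof (cases "s < t")
  case True
  have [measurable]: "\<xi> \<in> borel_measurable M" "\<xi> \<in> borel_measurable (F s)" "incr k s t \<in> borel_measurable M"
    using assms True by (auto intro: sqi_measurable incr_measurable)
  have "integrable M (\<lambda>\<omega>. (norm (\<xi> \<omega>))\<^sup>2 * (incr k s t \<omega> * incr k s t \<omega>))"
    by (rule expectation_incr_product(1)) (use st True \<xi> in \<open>auto intro: sqi_integrable\<close>)
  then show ?thesis
    by (simp add: sqi_def power_mult_distrib power2_eq_square[of "incr k s t _"] mult.commute)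
next
  case False
  then have "s = t" using st by simp
  then show ?thesis by simp
qed

lemma incr_orth:
  assumes st: "0 \<le> s" "s \<le> t" and Z: "sqi M Z" and \<xi>: "sqi M \<xi>"
    and meas: "s < t \<Longrightarrow> Z \<in> borel_measurable (F s)" "s < t \<Longrightarrow> \<xi> \<in> borel_measurable (F s)"
  shows "expectation (\<lambda>\<omega>. Z \<omega> \<bullet> (incr k s t \<omega> *\<^sub>R \<xi> \<omega>)) = 0"
proof (cases "s < t")
  case True
  have [measurable]: "Z \<in> borel_measurable (F s)" "\<xi> \<in> borel_measurable (F s)"
    using meas True by auto
  have "expectation (\<lambda>\<omega>. (Z \<omega> \<bullet> \<xi> \<omega>) * incr k s t \<omega>) = 0"
    by (rule expectation_incr(2)[OF st(1) True _ sqi_inner[OF Z \<xi>]]) measurable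
  then show ?thesis by (simp add: mult.commute)
next
  case False
  then have "s = t" using st by simp
  then show ?thesis by simp
qed

lemma incr_diag:
  assumes st: "0 \<le> s" "s \<le> t" and \<xi>: "sqi M \<xi>" "sqi M \<xi>'"
    and meas: "\<xi> \<in> borel_measurable (F s)" "\<xi>' \<in> borel_measurable (F s)"
  shows "expectation (\<lambda>\<omega>. (incr k s t \<omega> *\<^sub>R \<xi> \<omega>) \<bullet> (incr l s t \<omega> *\<^sub>R \<xi>' \<omega>)) =
    (if k = l then (t - s) * expectation (\<lambda>\<omega>. \<xi> \<omega> \<bullet> \<xi>' \<omega>) else 0)"
proof (cases "s < t")
  case True
  note [measurable] = meas
  have "expectation (\<lambda>\<omega>. (\<xi> \<omega> \<bullet> \<xi>' \<omega>) * (incr k s t \<omega> * incr l s t \<omega>)) =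
      (if k = l then t - s else 0) * expectation (\<lambda>\<omega>. \<xi> \<omega> \<bullet> \<xi>' \<omega>)"
    by (rule expectation_incr_product(2)[OF st(1) True _ sqi_inner[OF \<xi>]]) measurable
  then show ?thesis by (simp add: mult_ac cong: if_cong)
next
  case False
  then have "s = t" using st by simp
  then show ?thesis by simp
qed

text \<open>Both increments are cut at the end points of the overlap; all products but that of the two
  increments over the overlap have mean zero.\<close>

lemma incr_bilinear_le:
  assumes p: "0 \<le> p" "p < q" "p' < q'" and pp: "p \<le> p'"
    and \<xi>: "sqi M \<xi>" "sqi M \<xi>'" and meas: "\<xi> \<in> borel_measurable (F p)" "\<xi>' \<in> borel_measurable (F p')"
  shows "expectation (\<lambda>\<omega>. (incr k p q \<omega> *\<^sub>R \<xi> \<omega>) \<bullet> (incr l p' q' \<omega> *\<^sub>R \<xi>' \<omega>)) =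
    (if k = l then measure lborel ({p<..q} \<inter> {p'<..q'}) * expectation (\<lambda>\<omega>. \<xi> \<omega> \<bullet> \<xi>' \<omega>) else 0)"
proof -
  let ?a = "\<lambda>s t \<omega>. incr k s t \<omega> *\<^sub>R \<xi> \<omega>" and ?b = "\<lambda>s t \<omega>. incr l s t \<omega> *\<^sub>R \<xi>' \<omega>"
  have ma: "\<xi> \<in> borel_measurable (F r)" if "p \<le> r" for r
    using F_mono[OF p(1) that meas(1)] .
  have mb: "\<xi>' \<in> borel_measurable (F r)" if "p' \<le> r" for r
    using F_mono[OF _ that meas(2)] p pp by simp
  have sa: "sqi M (?a s t)" if "p \<le> s" "s \<le> t" for s t
    using that p \<xi> ma by (intro sqi_incr) auto
  have sb: "sqi M (?b s t)" if "p' \<le> s" "s \<le> t" for s t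
    using that p pp \<xi> mb by (intro sqi_incr) auto
  have am: "?a s t \<in> borel_measurable (F r)" if "p \<le> s" "s \<le> t" "t \<le> r" for s t r
    using that p by (intro borel_measurable_scaleR incr_measurable_F ma) auto
  have bm: "?b s t \<in> borel_measurable (F r)" if "p' \<le> s" "s \<le> t" "t \<le> r" for s t r
    using that p pp by (intro borel_measurable_scaleR incr_measurable_F mb) auto
  have orth1: "expectation (\<lambda>\<omega>. ?a s t \<omega> \<bullet> ?b s' t' \<omega>) = 0"
    if "p \<le> s" "s \<le> t" "t \<le> s'" "s' \<le> t'" "p' \<le> s'" for s t s' t'
    using that p pp by (intro incr_orth sa am mb \<xi>) auto
  have orth2: "expectation (\<lambda>\<omega>. ?a s t \<omega> \<bullet> ?b s' t' \<omega>) = 0"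
    if "p' \<le> s'" "s' \<le> t'" "t' \<le> s" "s \<le> t" for s t s' t'
  proof -
    have "expectation (\<lambda>\<omega>. ?b s' t' \<omega> \<bullet> ?a s t \<omega>) = 0"
      using that p pp by (intro incr_orth sb bm ma \<xi>) auto
    then show ?thesis by (simp add: inner_commute)
  qed
  have diag: "expectation (\<lambda>\<omega>. ?a p' t \<omega> \<bullet> ?b p' t \<omega>) =
      (if k = l then (t - p') * expectation (\<lambda>\<omega>. \<xi> \<omega> \<bullet> \<xi>' \<omega>) else 0)" if "p' \<le> t" for t
    using that p pp by (intro incr_diag \<xi> ma mb) auto
  have split_a: "?a s t \<omega> = ?a s r \<omega> + ?a r t \<omega>" for s r t \<omega>
    by (simp add: scaleR_left.add[symmetric])
  have split_b: "?b s t \<omega> = ?b s r \<omega> + ?b r t \<omega>" for s r t \<omega>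
    by (simp add: scaleR_left.add[symmetric])
  consider "q \<le> p'" | "p' < q" "q \<le> q'" | "p' < q" "q' < q" by linarith
  then show ?thesis
  proof cases
    case 1
    then have "{p<..q} \<inter> {p'<..q'} = {}" by auto
    then show ?thesis using orth1[of p q p' q'] 1 p pp by simp
  next
    case 2
    then have eq: "{p<..q} \<inter> {p'<..q'} = {p'<..q}" using pp by auto
    have "expectation (\<lambda>\<omega>. ?a p q \<omega> \<bullet> ?b p' q' \<omega>) =
        expectation (\<lambda>\<omega>. ?a p p' \<omega> \<bullet> ?b p' q' \<omega> + ?a p' q \<omega> \<bullet> ?b p' q \<omega> + ?a p' q \<omega> \<bullet> ?b q q' \<omega>)"
      unfolding split_a[of q _ p p'] split_b[of q' _ p' q] by (simp add: inner_add algebra_simps)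
    also have "\<dots> = expectation (\<lambda>\<omega>. ?a p p' \<omega> \<bullet> ?b p' q' \<omega>) + expectation (\<lambda>\<omega>. ?a p' q \<omega> \<bullet> ?b p' q \<omega>)
        + expectation (\<lambda>\<omega>. ?a p' q \<omega> \<bullet> ?b q q' \<omega>)"
      using 2 p pp by (subst Bochner_Integration.integral_add |
          intro Bochner_Integration.integrable_add sqi_inner sa sb refl | simp)+
    also have "\<dots> = (if k = l then (q - p') * expectation (\<lambda>\<omega>. \<xi> \<omega> \<bullet> \<xi>' \<omega>) else 0)"
      using 2 p pp diag[of q] orth1[of p p' p' q'] orth1[of p' q q q'] by simp
    finally show ?thesis unfolding eq using 2 by simp
  next
    case 3
    then have eq: "{p<..q} \<inter> {p'<..q'} = {p'<..q'}" using pp by auto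
    have "expectation (\<lambda>\<omega>. ?a p q \<omega> \<bullet> ?b p' q' \<omega>) =
        expectation (\<lambda>\<omega>. ?a p p' \<omega> \<bullet> ?b p' q' \<omega> + ?a p' q' \<omega> \<bullet> ?b p' q' \<omega> + ?a q' q \<omega> \<bullet> ?b p' q' \<omega>)"
      unfolding split_a[of q _ p p'] split_a[of q _ p' q'] by (simp add: inner_add algebra_simps)
    also have "\<dots> = expectation (\<lambda>\<omega>. ?a p p' \<omega> \<bullet> ?b p' q' \<omega>) + expectation (\<lambda>\<omega>. ?a p' q' \<omega> \<bullet> ?b p' q' \<omega>)
        + expectation (\<lambda>\<omega>. ?a q' q \<omega> \<bullet> ?b p' q' \<omega>)"
      using 3 p pp by (subst Bochner_Integration.integral_add |
          intro Bochner_Integration.integrable_add sqi_inner sa sb refl | simp)+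
    also have "\<dots> = (if k = l then (q' - p') * expectation (\<lambda>\<omega>. \<xi> \<omega> \<bullet> \<xi>' \<omega>) else 0)"
      using 3 p pp diag[of q'] orth1[of p p' p' q'] orth2[of p' q' q' q] by simp
    finally show ?thesis unfolding eq using p by simp
  qed
qed

text \<open>The ordered case and its mirror image; if one interval is degenerate, both sides are
  zero.\<close>

lemma incr_bilinear:
  assumes p: "0 \<le> p" "p \<le> q" "0 \<le> p'" "p' \<le> q'" and \<xi>: "sqi M \<xi>" "sqi M \<xi>'"
    and meas: "p < q \<Longrightarrow> \<xi> \<in> borel_measurable (F p)" "p' < q' \<Longrightarrow> \<xi>' \<in> borel_measurable (F p')"
  shows "expectation (\<lambda>\<omega>. (incr k p q \<omega> *\<^sub>R \<xi> \<omega>) \<bullet> (incr l p' q' \<omega> *\<^sub>R \<xi>' \<omega>)) =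
    (if k = l then measure lborel ({p<..q} \<inter> {p'<..q'}) * expectation (\<lambda>\<omega>. \<xi> \<omega> \<bullet> \<xi>' \<omega>) else 0)"
proof -
  consider "p = q \<or> p' = q'" | "p < q" "p' < q'" "p \<le> p'" | "p < q" "p' < q'" "p' \<le> p"
    using p by linarith
  then show ?thesis
  proof cases
    case 1
    then show ?thesis by auto
  next
    case 2
    then show ?thesis using assms by (intro incr_bilinear_le) auto
  next
    case 3
    then have "expectation (\<lambda>\<omega>. (incr l p' q' \<omega> *\<^sub>R \<xi>' \<omega>) \<bullet> (incr k p q \<omega> *\<^sub>R \<xi> \<omega>)) =
      (if l = k then measure lborel ({p'<..q'} \<inter> {p<..q}) * expectation (\<lambda>\<omega>. \<xi>' \<omega> \<bullet> \<xi> \<omega>) else 0)"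
      using assms by (intro incr_bilinear_le) auto
    then show ?thesis by (simp only: inner_commute Int_commute eq_commute)
  qed
qed

end

section \<open>Simple integrands\<close>

lemma (in pair_sigma_finite)
  fixes f :: "_ \<Rightarrow> real" and g :: "_ \<Rightarrow> real"
  assumes f: "integrable M1 f" and g: "integrable M2 g"
  shows integrable_times: "integrable (M1 \<Otimes>\<^sub>M M2) (\<lambda>z. f (fst z) * g (snd z))"
    and integral_times: "(LINT z|(M1 \<Otimes>\<^sub>M M2). f (fst z) * g (snd z)) = (LINT x|M1. f x) * (LINT y|M2. g y)"
proof -
  have [measurable]: "f \<in> borel_measurable M1" "g \<in> borel_measurable M2"
    using f g by auto
  show int: "integrable (M1 \<Otimes>\<^sub>M M2) (\<lambda>z. f (fst z) * g (snd z))"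
  proof (rule Fubini_integrable)
    show "integrable M1 (\<lambda>x. LINT y|M2. norm (f (fst (x, y)) * g (snd (x, y))))"
      using f by (simp add: abs_mult)
    show "AE x in M1. integrable M2 (\<lambda>y. f (fst (x, y)) * g (snd (x, y)))"
      using g by simp
  qed measurable
  show "(LINT z|(M1 \<Otimes>\<^sub>M M2). f (fst z) * g (snd z)) = (LINT x|M1. f x) * (LINT y|M2. g y)"
    by (subst integral_fst'[OF int, symmetric]) simp
qed

abbreviation Leb :: "real \<Rightarrow> real \<Rightarrow> real measure" where
  "Leb a b \<equiv> restrict_space lborel {a..b}"

lemma finite_measure_Leb: "finite_measure (Leb a b)"
  by (rule finite_measureI) (simp add: emeasure_restrict_space space_restrict_space emeasure_lborel_Icc_eq)

lemma integrable_indicator_Leb: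
  assumes "A \<in> sets borel"
  shows "integrable (Leb a b) (indicator A :: real \<Rightarrow> real)"
proof (rule finite_measure.integrable_const_bound[OF finite_measure_Leb])
  show "(indicator A :: real \<Rightarrow> real) \<in> borel_measurable (Leb a b)"
    using assms by (intro measurable_restrict_space1) simp
  show "AE r in Leb a b. norm (indicator A r :: real) \<le> 1"
    by (simp add: indicator_def)
qed

text \<open>The left and right end points are separate sequences, and the process is a function on
  the product space, so that \<open>sqi\<close> over the product measure applies to it.\<close>

definition simple_process ::
    "nat \<Rightarrow> (nat \<Rightarrow> real) \<Rightarrow> (nat \<Rightarrow> real) \<Rightarrow> (nat \<Rightarrow> 'w \<Rightarrow> 'h::real_vector) \<Rightarrow> 'w \<times> real \<Rightarrow> 'h" where
  "simple_process m p q \<xi> z = (\<Sum>i<m. indicator {p i<..q i} (snd z) *\<^sub>R \<xi> i (fst z))"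

definition simple_integral ::
    "(real \<Rightarrow> 'w \<Rightarrow> real) \<Rightarrow> nat \<Rightarrow> (nat \<Rightarrow> real) \<Rightarrow> (nat \<Rightarrow> real) \<Rightarrow> (nat \<Rightarrow> 'w \<Rightarrow> 'h::real_vector) \<Rightarrow> 'w \<Rightarrow> 'h" where
  "simple_integral B m p q \<xi> \<omega> = (\<Sum>i<m. (B (q i) \<omega> - B (p i) \<omega>) *\<^sub>R \<xi> i \<omega>)"

context brownian_family
begin

lemma pair_Leb: "pair_sigma_finite M (Leb a b)"
proof -
  interpret R: finite_measure "Leb a b" by (rule finite_measure_Leb)
  show ?thesis ..
qed

text \<open>Unlike in \<^const>\<open>elementary\<close>, the intervals may overlap, so that cutting off all of them at a
  common time stays within the class.\<close>

definition simple_family ::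
    "real \<Rightarrow> real \<Rightarrow> nat \<Rightarrow> (nat \<Rightarrow> real) \<Rightarrow> (nat \<Rightarrow> real) \<Rightarrow>
      (nat \<Rightarrow> 'w \<Rightarrow> 'h::{real_inner, second_countable_topology}) \<Rightarrow> bool" where
  "simple_family a b m p q \<xi> \<longleftrightarrow> (\<forall>i<m. a \<le> p i \<and> p i \<le> q i \<and> q i \<le> b \<and> sqi M (\<xi> i) \<and>
     (p i < q i \<longrightarrow> \<xi> i \<in> borel_measurable (F (p i))))"

lemma sqi_simple_term:
  assumes "sqi M \<xi>"
  shows "sqi (M \<Otimes>\<^sub>M Leb a b) (\<lambda>z. indicator {p<..q} (snd z) *\<^sub>R \<xi> (fst z))"
proof -
  interpret P: pair_sigma_finite M "Leb a b" by (rule pair_Leb)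
  have "integrable (M \<Otimes>\<^sub>M Leb a b) (\<lambda>z. (norm (\<xi> (fst z)))\<^sup>2 * indicator {p<..q} (snd z))"
    by (rule P.integrable_times[OF sqi_integrable[OF assms] integrable_indicator_Leb]) simp
  moreover have "(norm (indicator {p<..q} (snd z) *\<^sub>R \<xi> (fst z)))\<^sup>2 = (norm (\<xi> (fst z)))\<^sup>2 * indicator {p<..q} (snd z)"
    for z :: "'w \<times> real"
    by (simp add: indicator_def)
  moreover have "(\<lambda>z. indicator {p<..q} (snd z) *\<^sub>R \<xi> (fst z)) \<in> borel_measurable (M \<Otimes>\<^sub>M Leb a b)"
    by (intro borel_measurable_scaleR measurable_compose[OF measurable_fst sqi_measurable[OF assms]]
        measurable_compose[OF measurable_snd borel_measurable_integrable[OF integrable_indicator_Leb]]) simp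
  ultimately show ?thesis unfolding sqi_def by simp
qed

lemma inner_simple_term:
  assumes \<xi>: "sqi M \<xi>" "sqi M \<xi>'" and p: "a \<le> p" "q \<le> b"
  shows "(LINT z|(M \<Otimes>\<^sub>M Leb a b). (indicator {p<..q} (snd z) *\<^sub>R \<xi> (fst z)) \<bullet>
      (indicator {p'<..q'} (snd z) *\<^sub>R \<xi>' (fst z))) =
    measure lborel ({p<..q} \<inter> {p'<..q'}) * expectation (\<lambda>\<omega>. \<xi> \<omega> \<bullet> \<xi>' \<omega>)"
proof -
  interpret P: pair_sigma_finite M "Leb a b" by (rule pair_Leb)
  let ?I = "{p<..q} \<inter> {p'<..q'}"
  have sub: "?I \<subseteq> {a..b}" using p by auto
  have int: "integrable (Leb a b) (indicator ?I :: real \<Rightarrow> real)"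
    by (rule integrable_indicator_Leb) simp
  have "(LINT r|Leb a b. indicator ?I r) = (LINT r|lborel. indicator {a..b} r *\<^sub>R (indicator ?I r :: real))"
    by (rule integral_restrict_space) simp
  also have "\<dots> = (LINT r|lborel. indicator ?I r)"
    using sub by (intro Bochner_Integration.integral_cong) (auto simp: indicator_def)
  finally have "(LINT r|Leb a b. indicator ?I r) = measure lborel ?I" by simp
  moreover have eq: "(indicator {p<..q} (snd z) *\<^sub>R \<xi> (fst z)) \<bullet> (indicator {p'<..q'} (snd z) *\<^sub>R \<xi>' (fst z)) =
      (\<xi> (fst z) \<bullet> \<xi>' (fst z)) * indicator ?I (snd z)" for z :: "'w \<times> real"
    by (auto simp: indicator_def)
  ultimately show ?thesis
    unfolding eq P.integral_times[OF sqi_inner[OF \<xi>] int] by (simp only: mult.commute)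
qed

lemma sqi_simple_process:
  "simple_family a b m p q \<xi> \<Longrightarrow> sqi (M \<Otimes>\<^sub>M Leb a b) (simple_process m p q \<xi>)"
  unfolding simple_process_def [abs_def]
  by (intro sqi_sum sqi_simple_term) (auto simp: simple_family_def)

lemma sqi_simple_integral:
  "simple_family a b m p q \<xi> \<Longrightarrow> 0 \<le> a \<Longrightarrow> sqi M (simple_integral (\<beta> k) m p q \<xi>)"
  unfolding simple_integral_def [abs_def]
  by (intro sqi_sum sqi_incr) (auto simp: simple_family_def)

text \<open>For \<open>k = l\<close> both sides expand into the same double sum, the lengths of the
  overlaps of the intervals times the mean inner products of the coefficients. The polarized form
  with two Brownian motions will give the orthogonality of the components of the Wiener
  integral.\<close>

lemma simple_isometry:
  assumes S: "simple_family a b m p q \<xi>" "simple_family a b m' p' q' \<xi>'" and a: "0 \<le> a"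
  shows "expectation (\<lambda>\<omega>. simple_integral (\<beta> k) m p q \<xi> \<omega> \<bullet> simple_integral (\<beta> l) m' p' q' \<xi>' \<omega>) =
    (if k = l then LINT z|(M \<Otimes>\<^sub>M Leb a b). simple_process m p q \<xi> z \<bullet> simple_process m' p' q' \<xi>' z else 0)"
proof -
  have s: "a \<le> p i" "p i \<le> q i" "q i \<le> b" "sqi M (\<xi> i)" "p i < q i \<Longrightarrow> \<xi> i \<in> borel_measurable (F (p i))"
    "0 \<le> p i" if "i < m" for i using S(1) that a by (auto simp: simple_family_def)
  have s': "a \<le> p' i" "p' i \<le> q' i" "q' i \<le> b" "sqi M (\<xi>' i)" "p' i < q' i \<Longrightarrow> \<xi>' i \<in> borel_measurable (F (p' i))"
    "0 \<le> p' i" if "i < m'" for i using S(2) that a by (auto simp: simple_family_def)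
  have "expectation (\<lambda>\<omega>. simple_integral (\<beta> k) m p q \<xi> \<omega> \<bullet> simple_integral (\<beta> l) m' p' q' \<xi>' \<omega>) =
      (\<Sum>i<m. \<Sum>j<m'. expectation (\<lambda>\<omega>. (incr k (p i) (q i) \<omega> *\<^sub>R \<xi> i \<omega>) \<bullet> (incr l (p' j) (q' j) \<omega> *\<^sub>R \<xi>' j \<omega>)))"
    unfolding simple_integral_def
    using s s' by (intro integral_inner_sum sqi_incr) auto
  also have "\<dots> = (\<Sum>i<m. \<Sum>j<m'. if k = l then
      measure lborel ({p i<..q i} \<inter> {p' j<..q' j}) * expectation (\<lambda>\<omega>. \<xi> i \<omega> \<bullet> \<xi>' j \<omega>) else 0)"
    using s s' by (intro sum.cong refl incr_bilinear) auto
  also have "\<dots> = (if k = l then \<Sum>i<m. \<Sum>j<m'. LINT z|(M \<Otimes>\<^sub>M Leb a b).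
      (indicator {p i<..q i} (snd z) *\<^sub>R \<xi> i (fst z)) \<bullet> (indicator {p' j<..q' j} (snd z) *\<^sub>R \<xi>' j (fst z)) else 0)"
  proof (cases "k = l")
    case True
    have "(\<Sum>i<m. \<Sum>j<m'. measure lborel ({p i<..q i} \<inter> {p' j<..q' j}) * expectation (\<lambda>\<omega>. \<xi> i \<omega> \<bullet> \<xi>' j \<omega>)) =
        (\<Sum>i<m. \<Sum>j<m'. LINT z|(M \<Otimes>\<^sub>M Leb a b).
          (indicator {p i<..q i} (snd z) *\<^sub>R \<xi> i (fst z)) \<bullet> (indicator {p' j<..q' j} (snd z) *\<^sub>R \<xi>' j (fst z)))"
      using s s' by (intro sum.cong refl inner_simple_term[symmetric]) auto
    then show ?thesis unfolding if_P[OF True] .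
  next
    case False
    then show ?thesis by simp
  qed
  also have "(\<Sum>i<m. \<Sum>j<m'. LINT z|(M \<Otimes>\<^sub>M Leb a b).
      (indicator {p i<..q i} (snd z) *\<^sub>R \<xi> i (fst z)) \<bullet> (indicator {p' j<..q' j} (snd z) *\<^sub>R \<xi>' j (fst z))) =
    (LINT z|(M \<Otimes>\<^sub>M Leb a b). simple_process m p q \<xi> z \<bullet> simple_process m' p' q' \<xi>' z)"
    unfolding simple_process_def
    using s s' by (intro integral_inner_sum[symmetric] sqi_simple_term) auto
  finally show ?thesis .
qed

text \<open>Each increment is cut at time \<open>s\<close>; its part after \<open>s\<close> is
  orthogonal to \<open>Z\<close>, which is known at time \<open>s\<close>.\<close>

lemma simple_integral_martingale:
  assumes S: "simple_family a b m p q \<xi>" and a: "0 \<le> a" "a \<le> s"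
    and Z: "sqi M Z" "Z \<in> borel_measurable (F s)"
  shows "expectation (\<lambda>\<omega>. Z \<omega> \<bullet> simple_integral (\<beta> k) m p q \<xi> \<omega>) =
    expectation (\<lambda>\<omega>. Z \<omega> \<bullet> simple_integral (\<beta> k) m (\<lambda>i. min (p i) s) (\<lambda>i. min (q i) s) \<xi> \<omega>)"
proof -
  have s: "a \<le> p i" "p i \<le> q i" "q i \<le> b" "sqi M (\<xi> i)" "p i < q i \<Longrightarrow> \<xi> i \<in> borel_measurable (F (p i))"
    if "i < m" for i using S that by (auto simp: simple_family_def)
  have *: "sqi M (\<lambda>\<omega>. incr k (min (p i) s) (min (q i) s) \<omega> *\<^sub>R \<xi> i \<omega>)" if "i < m" for i
    using s[OF that] a by (intro sqi_incr) (auto simp: min_def split: if_splits)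
  have **: "sqi M (\<lambda>\<omega>. incr k (p i) (q i) \<omega> *\<^sub>R \<xi> i \<omega>)" if "i < m" for i
    using s[OF that] a by (intro sqi_incr) auto
  have "expectation (\<lambda>\<omega>. Z \<omega> \<bullet> (incr k (p i) (q i) \<omega> *\<^sub>R \<xi> i \<omega>)) =
      expectation (\<lambda>\<omega>. Z \<omega> \<bullet> (incr k (min (p i) s) (min (q i) s) \<omega> *\<^sub>R \<xi> i \<omega>))" if i: "i < m" for i
  proof -
    note si = s[OF i]
    consider "q i \<le> s" | "s \<le> p i" | "p i < s" "s < q i" by linarith
    then show ?thesis
    proof cases
      case 1
      then show ?thesis using si by (simp add: min_def)
    next
      \<comment> \<open>The truncated interval is the single point \<open>s\<close>, so its
        contribution vanishes although \<open>\<xi> i\<close> may fail to be known at time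
        \<open>s\<close>.\<close>
      case 2
      have "expectation (\<lambda>\<omega>. Z \<omega> \<bullet> (incr k (p i) (q i) \<omega> *\<^sub>R \<xi> i \<omega>)) = 0"
        using 2 si a Z by (intro incr_orth) (auto intro: F_mono[of s "p i"])
      moreover have "min (p i) s = s" "min (q i) s = s" using 2 si by auto
      ultimately show ?thesis by simp
    next
      case 3
      have "\<xi> i \<in> borel_measurable (F s)"
        by (rule F_mono[of "p i"]) (use 3 si a in auto)
      then have "sqi M (\<lambda>\<omega>. incr k s (q i) \<omega> *\<^sub>R \<xi> i \<omega>)"
        "expectation (\<lambda>\<omega>. Z \<omega> \<bullet> (incr k s (q i) \<omega> *\<^sub>R \<xi> i \<omega>)) = 0"
        using 3 si(4) a Z by (intro sqi_incr incr_orth; simp)+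
      moreover have "sqi M (\<lambda>\<omega>. incr k (p i) s \<omega> *\<^sub>R \<xi> i \<omega>)"
        using *[OF i] 3 by (simp add: min_def)
      moreover have "Z \<omega> \<bullet> (incr k (p i) (q i) \<omega> *\<^sub>R \<xi> i \<omega>) =
          Z \<omega> \<bullet> (incr k (p i) s \<omega> *\<^sub>R \<xi> i \<omega>) + Z \<omega> \<bullet> (incr k s (q i) \<omega> *\<^sub>R \<xi> i \<omega>)" for \<omega>
        by (simp add: algebra_simps)
      ultimately have "expectation (\<lambda>\<omega>. Z \<omega> \<bullet> (incr k (p i) (q i) \<omega> *\<^sub>R \<xi> i \<omega>)) =
          expectation (\<lambda>\<omega>. Z \<omega> \<bullet> (incr k (p i) s \<omega> *\<^sub>R \<xi> i \<omega>))"
        using Z by (simp only: Bochner_Integration.integral_add sqi_inner)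
      then show ?thesis using 3 by (simp add: min_def)
    qed
  qed
  then have "(\<Sum>i<m. expectation (\<lambda>\<omega>. Z \<omega> \<bullet> (incr k (p i) (q i) \<omega> *\<^sub>R \<xi> i \<omega>))) =
      (\<Sum>i<m. expectation (\<lambda>\<omega>. Z \<omega> \<bullet> (incr k (min (p i) s) (min (q i) s) \<omega> *\<^sub>R \<xi> i \<omega>)))"
    by (intro sum.cong) auto
  moreover have "expectation (\<lambda>\<omega>. Z \<omega> \<bullet> (\<Sum>i<m. incr k (p i) (q i) \<omega> *\<^sub>R \<xi> i \<omega>)) =
      (\<Sum>i<m. expectation (\<lambda>\<omega>. Z \<omega> \<bullet> (incr k (p i) (q i) \<omega> *\<^sub>R \<xi> i \<omega>)))"
    by (rule integral_inner_sum_right[OF Z(1) **]) simp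
  moreover have "expectation (\<lambda>\<omega>. Z \<omega> \<bullet> (\<Sum>i<m. incr k (min (p i) s) (min (q i) s) \<omega> *\<^sub>R \<xi> i \<omega>)) =
      (\<Sum>i<m. expectation (\<lambda>\<omega>. Z \<omega> \<bullet> (incr k (min (p i) s) (min (q i) s) \<omega> *\<^sub>R \<xi> i \<omega>)))"
    by (rule integral_inner_sum_right[OF Z(1) *]) simp
  ultimately show ?thesis
    unfolding simple_integral_def by simp
qed

section \<open>The Ito integral\<close>

lemma nn_integral_pair_Leb:
  assumes f: "f \<in> borel_measurable (M \<Otimes>\<^sub>M Leb a b)"
  shows "(\<integral>\<^sup>+ z. f z \<partial>(M \<Otimes>\<^sub>M Leb a b)) = (\<integral>\<^sup>+ \<omega>. \<integral>\<^sup>+ r. f (\<omega>, r) * indicator {a..b} r \<partial>lborel \<partial>M)"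
proof -
  interpret R: finite_measure "Leb a b" by (rule finite_measure_Leb)
  have "(\<integral>\<^sup>+ z. f z \<partial>(M \<Otimes>\<^sub>M Leb a b)) = (\<integral>\<^sup>+ \<omega>. \<integral>\<^sup>+ r. f (\<omega>, r) \<partial>Leb a b \<partial>M)"
    by (rule R.nn_integral_fst[OF f, symmetric])
  also have "\<dots> = (\<integral>\<^sup>+ \<omega>. \<integral>\<^sup>+ r. f (\<omega>, r) * indicator {a..b} r \<partial>lborel \<partial>M)"
    by (subst nn_integral_restrict_space) auto
  finally show ?thesis .
qed

text \<open>The two product measures live on different spaces; written over \<open>lborel\<close>
  with indicators, the integrands become comparable.\<close>

lemma nn_integral_pair_Leb_mono:
  assumes "f \<in> borel_measurable (M \<Otimes>\<^sub>M Leb a s)" "f \<in> borel_measurable (M \<Otimes>\<^sub>M Leb a b)" "s \<le> b"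
  shows "(\<integral>\<^sup>+ z. f z \<partial>(M \<Otimes>\<^sub>M Leb a s)) \<le> (\<integral>\<^sup>+ z. f z \<partial>(M \<Otimes>\<^sub>M Leb a b))"
  unfolding nn_integral_pair_Leb[OF assms(1)] nn_integral_pair_Leb[OF assms(2)]
  by (intro nn_integral_mono mult_left_mono) (use assms(3) in \<open>auto simp: indicator_def\<close>)

text \<open>Access to the definition in terms of \<open>ms_lim\<close>. The right end points are the
  shifted partition \<open>t n (Suc i)\<close>, and monotonicity of the partition keeps all of them
  in \<open>{a..b}\<close>.\<close>

lemma has_ito_integralE:
  assumes I: "has_ito_integral M F (\<beta> k) a b X I" and a: "0 \<le> a"
  obtains m p q \<xi> where
    "\<And>n. simple_family a b (m n) (p n) (q n) (\<xi> n)"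
    "ms_lim (M \<Otimes>\<^sub>M Leb a b) (\<lambda>n. simple_process (m n) (p n) (q n) (\<xi> n)) (\<lambda>z. X (snd z) (fst z))"
    "ms_lim M (\<lambda>n. simple_integral (\<beta> k) (m n) (p n) (q n) (\<xi> n)) I"
proof -
  have Xm: "(\<lambda>z. X (snd z) (fst z)) \<in> borel_measurable (M \<Otimes>\<^sub>M Leb a b)"
    using I unfolding has_ito_integral_def case_prod_beta by blast
  obtain m t \<xi> where el: "\<And>n. elementary M F a b (m n) (t n) (\<xi> n)"
    and lim: "(\<lambda>n. \<integral>\<^sup>+ z. ennreal ((norm (elementary_process (m n) (t n) (\<xi> n) (snd z) (fst z) - X (snd z) (fst z)))\<^sup>2)
        \<partial>(M \<Otimes>\<^sub>M Leb a b)) \<longlonglongrightarrow> 0"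
    and ms: "mean_square_lim M (\<lambda>n. elementary_integral (\<beta> k) (m n) (t n) (\<xi> n)) I"
    using I unfolding has_ito_integral_def case_prod_beta by blast
  let ?q = "\<lambda>n i. t n (Suc i)"
  have S: "simple_family a b (m n) (t n) (?q n) (\<xi> n)" for n
  proof -
    note e = el[of n, unfolded elementary_def]
    have le: "a \<le> t n i" if "i \<le> m n" for i
      using that e by (induction i) (auto intro: order_trans)
    have ge: "t n i \<le> b" if "i \<le> m n" for i
      using that
    proof (induction i rule: inc_induct)
      case base then show ?case using e by simp
    next
      case (step i) then show ?case using e by (auto intro: order_trans)
    qed
    show ?thesis
      unfolding simple_family_def
    proof (intro allI impI)
      fix i assume i: "i < m n"
      have "\<xi> n i \<in> borel_measurable (F (t n i))" using e i by auto
      moreover have "0 \<le> t n i" using le[of i] i a by simp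
      ultimately show "a \<le> t n i \<and> t n i \<le> ?q n i \<and> ?q n i \<le> b \<and> sqi M (\<xi> n i) \<and>
          (t n i < ?q n i \<longrightarrow> \<xi> n i \<in> borel_measurable (F (t n i)))"
        using e i le[of i] ge[of "Suc i"] F_measurable by (auto simp: sqi_iff_nn_integral)
    qed
  qed
  show ?thesis
  proof (rule that)
    show "simple_family a b (m n) (t n) (?q n) (\<xi> n)" for n by (rule S)
    show "ms_lim M (\<lambda>n. simple_integral (\<beta> k) (m n) (t n) (?q n) (\<xi> n)) I"
      using ms_lim_of_mean_square_lim[OF _ ms] sqi_simple_integral[OF S a]
      by (simp add: elementary_integral_def[abs_def] simple_integral_def[abs_def])
    show "ms_lim (M \<Otimes>\<^sub>M Leb a b) (\<lambda>n. simple_process (m n) (t n) (?q n) (\<xi> n)) (\<lambda>z. X (snd z) (fst z))"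
      using lim by (intro ms_limI sqi_simple_process[OF S] Xm)
        (simp add: elementary_process_def simple_process_def case_prod_beta)
  qed
qed

lemma sqi_ito_integral:
  assumes "has_ito_integral M F (\<beta> k) a b X I" "0 \<le> a"
  shows "sqi M I" "sqi (M \<Otimes>\<^sub>M Leb a b) (\<lambda>z. X (snd z) (fst z))"
proof -
  from has_ito_integralE[OF assms] obtain m p q \<xi> where
    "\<And>n. simple_family a b (m n) (p n) (q n) (\<xi> n)"
    "ms_lim (M \<Otimes>\<^sub>M Leb a b) (\<lambda>n. simple_process (m n) (p n) (q n) (\<xi> n)) (\<lambda>z. X (snd z) (fst z))"
    "ms_lim M (\<lambda>n. simple_integral (\<beta> k) (m n) (p n) (q n) (\<xi> n)) I" by blast
  then show "sqi M I" "sqi (M \<Otimes>\<^sub>M Leb a b) (\<lambda>z. X (snd z) (fst z))"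
    by (simp_all add: ms_lim_def)
qed

text \<open>The limit of \<open>simple_isometry\<close> along the two approximating sequences, which
  need not be related.\<close>

lemma ito_isometry:
  fixes X X' :: "real \<Rightarrow> 'w \<Rightarrow> 'h::{real_inner, second_countable_topology}"
  assumes I: "has_ito_integral M F (\<beta> k) a b X I" "has_ito_integral M F (\<beta> l) a b X' I'" and a: "0 \<le> a"
  shows "expectation (\<lambda>\<omega>. I \<omega> \<bullet> I' \<omega>) =
    (if k = l then LINT z|(M \<Otimes>\<^sub>M Leb a b). X (snd z) (fst z) \<bullet> X' (snd z) (fst z) else 0)"
proof -
  from has_ito_integralE[OF I(1) a] obtain m p q \<xi> where S:
    "\<And>n. simple_family a b (m n) (p n) (q n) (\<xi> n)"
    "ms_lim (M \<Otimes>\<^sub>M Leb a b) (\<lambda>n. simple_process (m n) (p n) (q n) (\<xi> n)) (\<lambda>z. X (snd z) (fst z))"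
    "ms_lim M (\<lambda>n. simple_integral (\<beta> k) (m n) (p n) (q n) (\<xi> n)) I" by blast
  from has_ito_integralE[OF I(2) a] obtain m' p' q' \<xi>' where S':
    "\<And>n. simple_family a b (m' n) (p' n) (q' n) (\<xi>' n)"
    "ms_lim (M \<Otimes>\<^sub>M Leb a b) (\<lambda>n. simple_process (m' n) (p' n) (q' n) (\<xi>' n)) (\<lambda>z. X' (snd z) (fst z))"
    "ms_lim M (\<lambda>n. simple_integral (\<beta> l) (m' n) (p' n) (q' n) (\<xi>' n)) I'" by blast
  have "(\<lambda>n. if k = l then LINT z|(M \<Otimes>\<^sub>M Leb a b). simple_process (m n) (p n) (q n) (\<xi> n) z \<bullet>
        simple_process (m' n) (p' n) (q' n) (\<xi>' n) z else 0) \<longlonglongrightarrow> expectation (\<lambda>\<omega>. I \<omega> \<bullet> I' \<omega>)"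
    using ms_lim_inner[OF S(3) S'(3)] by (simp only: simple_isometry[OF S(1) S'(1) a])
  moreover have "(\<lambda>n. if k = l then LINT z|(M \<Otimes>\<^sub>M Leb a b). simple_process (m n) (p n) (q n) (\<xi> n) z \<bullet>
        simple_process (m' n) (p' n) (q' n) (\<xi>' n) z else 0) \<longlonglongrightarrow>
      (if k = l then LINT z|(M \<Otimes>\<^sub>M Leb a b). X (snd z) (fst z) \<bullet> X' (snd z) (fst z) else 0)"
    using ms_lim_inner[OF S(2) S'(2)] by simp
  ultimately show ?thesis by (rule LIMSEQ_unique)
qed

text \<open>The approximations of \<open>I\<close> truncated at \<open>s\<close> and the given
  approximations of \<open>I'\<close> both tend to \<open>X\<close> on the shorter interval, so by
  the isometry their integrals have the same limit \<open>I'\<close>. For the truncations, pairing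
  with \<open>Z\<close> gives the same value as before the truncation.\<close>

lemma ito_martingale:
  assumes I: "has_ito_integral M F (\<beta> k) a b X I" and I': "has_ito_integral M F (\<beta> k) a s X I'"
    and a: "0 \<le> a" "a \<le> s" "s \<le> b" and Z: "sqi M Z" "Z \<in> borel_measurable (F s)"
  shows "expectation (\<lambda>\<omega>. Z \<omega> \<bullet> I \<omega>) = expectation (\<lambda>\<omega>. Z \<omega> \<bullet> I' \<omega>)"
proof -
  let ?X = "\<lambda>z. X (snd z) (fst z)"
  from has_ito_integralE[OF I a(1)] obtain m p q \<xi> where S:
    "\<And>n. simple_family a b (m n) (p n) (q n) (\<xi> n)"
    "ms_lim (M \<Otimes>\<^sub>M Leb a b) (\<lambda>n. simple_process (m n) (p n) (q n) (\<xi> n)) ?X"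
    "ms_lim M (\<lambda>n. simple_integral (\<beta> k) (m n) (p n) (q n) (\<xi> n)) I" by blast
  from has_ito_integralE[OF I' a(1)] obtain m' p' q' \<xi>' where S':
    "\<And>n. simple_family a s (m' n) (p' n) (q' n) (\<xi>' n)"
    "ms_lim (M \<Otimes>\<^sub>M Leb a s) (\<lambda>n. simple_process (m' n) (p' n) (q' n) (\<xi>' n)) ?X"
    "ms_lim M (\<lambda>n. simple_integral (\<beta> k) (m' n) (p' n) (q' n) (\<xi>' n)) I'" by blast
  let ?p = "\<lambda>n i. min (p n i) s" and ?q = "\<lambda>n i. min (q n i) s"
  let ?P = "\<lambda>n. simple_process (m n) (p n) (q n) (\<xi> n)"
  let ?T = "\<lambda>n. simple_process (m n) (?p n) (?q n) (\<xi> n)"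
  let ?P' = "\<lambda>n. simple_process (m' n) (p' n) (q' n) (\<xi>' n)"
  let ?J = "\<lambda>n. simple_integral (\<beta> k) (m n) (?p n) (?q n) (\<xi> n)"
  let ?J' = "\<lambda>n. simple_integral (\<beta> k) (m' n) (p' n) (q' n) (\<xi>' n)"
  have T: "simple_family a s (m n) (?p n) (?q n) (\<xi> n)" for n
    using S(1)[of n] a by (auto simp: simple_family_def min_def)
  have sq: "sqi (M \<Otimes>\<^sub>M Leb a s) (?T n)" "sqi (M \<Otimes>\<^sub>M Leb a s) (?P' n)"
    "sqi M (?J n)" "sqi M (?J' n)" "sqi (M \<Otimes>\<^sub>M Leb a b) (?P n)" for n
    by (intro sqi_simple_process[OF T] sqi_simple_process[OF S'(1)] sqi_simple_integral[OF T a(1)]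
        sqi_simple_integral[OF S'(1) a(1)] sqi_simple_process[OF S(1)])+
  have sqX: "sqi (M \<Otimes>\<^sub>M Leb a b) ?X" "sqi (M \<Otimes>\<^sub>M Leb a s) ?X"
    using S(2) S'(2) by (auto simp: ms_lim_def)
  \<comment> \<open>Times in this space are at most \<open>s\<close>, and there truncating the end
    points does not change membership in the intervals.\<close>
  have eq: "?T n z = ?P n z" if "z \<in> space (M \<Otimes>\<^sub>M Leb a s)" for n z
    using that unfolding simple_process_def
    by (intro sum.cong refl arg_cong2[where f=scaleR])
      (auto simp: indicator_def space_pair_measure space_restrict_space)
  have lim0: "ms_lim (M \<Otimes>\<^sub>M Leb a s) ?T ?X"
  proof (rule ms_limI[OF sq(1) sqi_measurable[OF sqX(2)]])
    have meas: "(\<lambda>z. ennreal ((norm (?P n z - ?X z))\<^sup>2)) \<in> borel_measurable (M \<Otimes>\<^sub>M Leb a b)" for n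
      using sqi_measurable[OF sq(5)] sqi_measurable[OF sqX(1)] by measurable
    have "(\<lambda>z. ennreal ((norm (?T n z - ?X z))\<^sup>2)) \<in> borel_measurable (M \<Otimes>\<^sub>M Leb a s)" for n
      using sqi_measurable[OF sq(1)] sqi_measurable[OF sqX(2)] by measurable
    then have meas': "(\<lambda>z. ennreal ((norm (?P n z - ?X z))\<^sup>2)) \<in> borel_measurable (M \<Otimes>\<^sub>M Leb a s)" for n
      using eq by (simp cong: measurable_cong)
    have "(\<integral>\<^sup>+ z. ennreal ((norm (?T n z - ?X z))\<^sup>2) \<partial>(M \<Otimes>\<^sub>M Leb a s)) \<le>
        ennreal (LINT z|(M \<Otimes>\<^sub>M Leb a b). (norm (?P n z - ?X z))\<^sup>2)" for n
    proof -
      have "(\<integral>\<^sup>+ z. ennreal ((norm (?T n z - ?X z))\<^sup>2) \<partial>(M \<Otimes>\<^sub>M Leb a s)) =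
          (\<integral>\<^sup>+ z. ennreal ((norm (?P n z - ?X z))\<^sup>2) \<partial>(M \<Otimes>\<^sub>M Leb a s))"
        by (intro nn_integral_cong) (simp add: eq)
      also have "\<dots> \<le> (\<integral>\<^sup>+ z. ennreal ((norm (?P n z - ?X z))\<^sup>2) \<partial>(M \<Otimes>\<^sub>M Leb a b))"
        by (rule nn_integral_pair_Leb_mono[OF meas' meas a(3)])
      also have "\<dots> = ennreal (LINT z|(M \<Otimes>\<^sub>M Leb a b). (norm (?P n z - ?X z))\<^sup>2)"
        by (rule nn_integral_sqi[OF sqi_diff[OF sq(5) sqX(1)]])
      finally show ?thesis .
    qed
    note le = this
    have "(\<lambda>n. ennreal (LINT z|(M \<Otimes>\<^sub>M Leb a b). (norm (?P n z - ?X z))\<^sup>2)) \<longlonglongrightarrow> ennreal 0"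
      using S(2) by (intro tendsto_ennrealI) (simp add: ms_lim_def)
    then have lim: "(\<lambda>n. ennreal (LINT z|(M \<Otimes>\<^sub>M Leb a b). (norm (?P n z - ?X z))\<^sup>2)) \<longlonglongrightarrow> 0"
      unfolding ennreal_0 .
    show "(\<lambda>n. \<integral>\<^sup>+ z. ennreal ((norm (?T n z - ?X z))\<^sup>2) \<partial>(M \<Otimes>\<^sub>M Leb a s)) \<longlonglongrightarrow> 0"
      by (rule tendsto_sandwich[OF always_eventually always_eventually tendsto_const lim]) (use le in auto)
  qed
  \<comment> \<open>Expanding the squares leaves three inner products on each side, and the isometry
    matches them one by one.\<close>
  have "expectation (\<lambda>\<omega>. (norm (?J n \<omega> - ?J' n \<omega>))\<^sup>2) =
      (LINT z|(M \<Otimes>\<^sub>M Leb a s). (norm (?T n z - ?P' n z))\<^sup>2)" for n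
    unfolding integral_norm_diff_sq[OF sq(3) sq(4)] integral_norm_diff_sq[OF sq(1) sq(2)]
    unfolding power2_norm_eq_inner
    by (simp only: simple_isometry[OF T T a(1)] simple_isometry[OF S'(1) S'(1) a(1)]
        simple_isometry[OF T S'(1) a(1)] simp_thms if_True)
  moreover have "(\<lambda>n. LINT z|(M \<Otimes>\<^sub>M Leb a s). (norm (?T n z - ?P' n z))\<^sup>2) \<longlonglongrightarrow> 0"
    using ms_lim_norm[OF ms_lim_diff[OF lim0 S'(2)]] by simp
  ultimately have "ms_lim M (\<lambda>n \<omega>. ?J n \<omega> - ?J' n \<omega>) (\<lambda>\<omega>. 0)"
    unfolding ms_lim_def by (auto intro: sqi_diff sq)
  from ms_lim_add[OF this S'(3)] have "ms_lim M ?J I'" by simp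
  from ms_lim_inner[OF ms_lim_const[OF Z(1)] this]
  have "(\<lambda>n. expectation (\<lambda>\<omega>. Z \<omega> \<bullet> ?J n \<omega>)) \<longlonglongrightarrow> expectation (\<lambda>\<omega>. Z \<omega> \<bullet> I' \<omega>)" .
  moreover have "(\<lambda>n. expectation (\<lambda>\<omega>. Z \<omega> \<bullet> ?J n \<omega>)) \<longlonglongrightarrow> expectation (\<lambda>\<omega>. Z \<omega> \<bullet> I \<omega>)"
    using ms_lim_inner[OF ms_lim_const[OF Z(1)] S(3)]
    by (simp only: simple_integral_martingale[OF S(1) a(1,2) Z])
  ultimately show ?thesis by (rule LIMSEQ_unique[THEN sym])
qed

section \<open>The integral with respect to the Wiener process\<close>

text \<open>The components of different Brownian motions are orthogonal, so Pythagoras holds for the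
  partial sums. Stating the result with \<open>sums\<close> keeps the summability, from which the
  second moments of the drift are later bounded.\<close>

lemma wiener_integral_isometry:
  fixes X :: "nat \<Rightarrow> real \<Rightarrow> 'w \<Rightarrow> 'h::{real_inner, second_countable_topology}"
  assumes I: "\<And>k. has_ito_integral M F (\<beta> k) a b (X k) (I k)" and a: "0 \<le> a"
    and J: "mean_square_lim M (\<lambda>n \<omega>. \<Sum>k<n. I k \<omega>) J"
  shows "sqi M J"
    "(\<lambda>k. LINT z|(M \<Otimes>\<^sub>M Leb a b). (norm (X k (snd z) (fst z)))\<^sup>2) sums expectation (\<lambda>\<omega>. (norm (J \<omega>))\<^sup>2)"
proof -
  have sq: "sqi M (I k)" for k using sqi_ito_integral[OF I a] by blast
  have ms: "ms_lim M (\<lambda>n \<omega>. \<Sum>k<n. I k \<omega>) J"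
    by (rule ms_lim_of_mean_square_lim[OF sqi_sum[OF sq] J])
  then show "sqi M J" by (simp add: ms_lim_def)
  have "expectation (\<lambda>\<omega>. (norm (\<Sum>k<n. I k \<omega>))\<^sup>2) =
      (\<Sum>k<n. LINT z|(M \<Otimes>\<^sub>M Leb a b). (norm (X k (snd z) (fst z)))\<^sup>2)" for n
  proof -
    have "expectation (\<lambda>\<omega>. (norm (\<Sum>k<n. I k \<omega>))\<^sup>2) = (\<Sum>k<n. \<Sum>l<n. expectation (\<lambda>\<omega>. I k \<omega> \<bullet> I l \<omega>))"
      unfolding power2_norm_eq_inner by (intro integral_inner_sum sq)
    also have "\<dots> = (\<Sum>k<n. LINT z|(M \<Otimes>\<^sub>M Leb a b). (norm (X k (snd z) (fst z)))\<^sup>2)"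
      unfolding ito_isometry[OF I I a] by (intro sum.cong refl) (simp add: power2_norm_eq_inner)
    finally show ?thesis .
  qed
  then show "(\<lambda>k. LINT z|(M \<Otimes>\<^sub>M Leb a b). (norm (X k (snd z) (fst z)))\<^sup>2) sums expectation (\<lambda>\<omega>. (norm (J \<omega>))\<^sup>2)"
    using ms_lim_norm[OF ms] by (simp add: sums_def)
qed

lemma wiener_integral_martingale:
  assumes I: "\<And>k. has_ito_integral M F (\<beta> k) a b (X k) (I k)"
    and J: "mean_square_lim M (\<lambda>n \<omega>. \<Sum>k<n. I k \<omega>) J"
    and I': "\<And>k. has_ito_integral M F (\<beta> k) a s (X k) (I' k)"
    and J': "mean_square_lim M (\<lambda>n \<omega>. \<Sum>k<n. I' k \<omega>) J'"
    and a: "0 \<le> a" "a \<le> s" "s \<le> b" and Z: "sqi M Z" "Z \<in> borel_measurable (F s)"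
  shows "expectation (\<lambda>\<omega>. Z \<omega> \<bullet> J \<omega>) = expectation (\<lambda>\<omega>. Z \<omega> \<bullet> J' \<omega>)"
proof -
  have sq: "sqi M (I k)" "sqi M (I' k)" for k
    using sqi_ito_integral[OF I a(1)] sqi_ito_integral[OF I' a(1)] by blast+
  have ms: "ms_lim M (\<lambda>n \<omega>. \<Sum>k<n. I k \<omega>) J" "ms_lim M (\<lambda>n \<omega>. \<Sum>k<n. I' k \<omega>) J'"
    using J J' by (auto intro!: ms_lim_of_mean_square_lim sqi_sum sq)
  have "expectation (\<lambda>\<omega>. Z \<omega> \<bullet> (\<Sum>k<n. I k \<omega>)) = expectation (\<lambda>\<omega>. Z \<omega> \<bullet> (\<Sum>k<n. I' k \<omega>))" for n
    using integral_inner_sum_right[OF Z(1) sq(1), where S="{..<n}"]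
      integral_inner_sum_right[OF Z(1) sq(2), where S="{..<n}"] ito_martingale[OF I I' a Z] by simp
  with ms_lim_inner[OF ms_lim_const[OF Z(1)] ms(1)] ms_lim_inner[OF ms_lim_const[OF Z(1)] ms(2)]
  show ?thesis by (simp add: LIMSEQ_unique)
qed

end

section \<open>Integrals along a path\<close>

lemma integrable_Leb_indicator:
  fixes g :: "real \<Rightarrow> real"
  assumes g: "integrable (Leb a b) g" and A: "A \<in> sets borel"
  shows "integrable (Leb a b) (\<lambda>s. indicator A s * g s)"
proof (rule Bochner_Integration.integrable_bound[OF g])
  have [measurable]: "g \<in> borel_measurable (Leb a b)" using g by simp
  have [measurable]: "(indicator A :: real \<Rightarrow> real) \<in> borel_measurable (Leb a b)"
    using integrable_indicator_Leb[OF A] by simp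
  show "(\<lambda>s. indicator A s * g s) \<in> borel_measurable (Leb a b)" by measurable
  show "AE s in Leb a b. norm (indicator A s * g s) \<le> norm (g s)"
    by (auto simp: indicator_def)
qed

text \<open>Pairing with \<open>z\<close> turns the vector-valued \<open>has_integral\<close> into a
  real integral, where it agrees with the Lebesgue integral. The indicator allows one measure
  \<open>Leb a b\<close> to serve all end times \<open>r\<close>.\<close>

lemma has_integral_inner_Leb:
  fixes f :: "real \<Rightarrow> 'h::{real_inner, second_countable_topology}"
  assumes f: "sqi (Leb a b) f" and A: "(f has_integral A) {a..r}" and r: "r \<le> b"
  shows "A \<bullet> z = (LINT s|Leb a b. indicator {a..r} s * (f s \<bullet> z))"
proof -
  have int: "integrable (Leb a b) (\<lambda>s. f s \<bullet> z)"
    by (rule sqi_inner[OF f sqi_const[OF finite_measure_Leb]])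
  then have "set_integrable lborel {a..b} (\<lambda>s. f s \<bullet> z)"
    by (subst (asm) integrable_restrict_space) (simp_all add: set_integrable_def)
  then have S: "set_integrable lborel {a..r} (\<lambda>s. f s \<bullet> z)"
    by (rule set_integrable_subset) (use r in auto)
  have "((\<lambda>s. f s \<bullet> z) has_integral (A \<bullet> z)) {a..r}"
    using has_integral_linear[OF A bounded_linear_inner_left[of z]] by (simp add: o_def)
  then have "A \<bullet> z = (LINT s:{a..r}|lborel. f s \<bullet> z)"
    using set_borel_integral_eq_integral(2)[OF S] by (simp add: integral_unique)
  also have "\<dots> = (LINT s|lborel. indicator {a..b} s *\<^sub>R (indicator {a..r} s * (f s \<bullet> z)))"
    unfolding set_lebesgue_integral_def using r
    by (intro Bochner_Integration.integral_cong) (auto simp: indicator_def)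
  also have "\<dots> = (LINT s|Leb a b. indicator {a..r} s * (f s \<bullet> z))"
    by (rule integral_restrict_space[symmetric]) simp
  finally show ?thesis .
qed

text \<open>Tested with \<open>z = A\<close>, the identity gives the squared norm of
  \<open>A\<close>. Young's inequality with weight \<open>?T\<close> bounds the integrand, and after
  integration at most half of that squared norm stands on the right, where it is absorbed.\<close>

lemma norm_le_of_inner_Leb:
  fixes f :: "real \<Rightarrow> 'h::{real_inner, second_countable_topology}"
  assumes f: "sqi (Leb a b) f" and ab: "a \<le> b" and A: "\<And>z. A \<bullet> z = (LINT s|Leb a b. indicator {a..r} s * (f s \<bullet> z))"
  shows "(norm A)\<^sup>2 \<le> (b - a + 1) * (LINT s|Leb a b. (norm (f s))\<^sup>2)"
proof -
  interpret R: finite_measure "Leb a b" by (rule finite_measure_Leb)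
  \<comment> \<open>One is added to the length to keep the weight positive for
    \<open>a = b\<close>.\<close>
  let ?T = "b - a + 1"
  have T: "0 < ?T" using ab by simp
  have meas: "measure (Leb a b) {a..b} = b - a"
    using ab by (simp add: measure_restrict_space space_restrict_space)
  have "indicator {a..r} s * (f s \<bullet> A) \<le> (?T * (norm (f s))\<^sup>2 + (norm A)\<^sup>2 / ?T) / 2" for s
  proof -
    have "0 \<le> (norm (?T *\<^sub>R f s - A))\<^sup>2" by simp
    also have "\<dots> = ?T\<^sup>2 * (norm (f s))\<^sup>2 - 2 * ?T * (f s \<bullet> A) + (norm A)\<^sup>2"
      using norm_add_sq[of "?T *\<^sub>R f s" "- A"] by (simp add: power_mult_distrib)
    finally have "0 \<le> (?T\<^sup>2 * (norm (f s))\<^sup>2 - 2 * ?T * (f s \<bullet> A) + (norm A)\<^sup>2) / (2 * ?T)"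
      using T by simp
    also have "\<dots> = (?T * (norm (f s))\<^sup>2 + (norm A)\<^sup>2 / ?T) / 2 - f s \<bullet> A"
      using T by (simp add: field_simps power2_eq_square)
    finally have "f s \<bullet> A \<le> (?T * (norm (f s))\<^sup>2 + (norm A)\<^sup>2 / ?T) / 2" by simp
    moreover have "0 \<le> (?T * (norm (f s))\<^sup>2 + (norm A)\<^sup>2 / ?T) / 2" using T by simp
    ultimately show ?thesis by (simp add: indicator_def)
  qed
  then have "(LINT s|Leb a b. indicator {a..r} s * (f s \<bullet> A)) \<le>
      (LINT s|Leb a b. (?T * (norm (f s))\<^sup>2 + (norm A)\<^sup>2 / ?T) / 2)"
    by (intro integral_mono integrable_Leb_indicator sqi_inner f sqi_const finite_measure_Leb
        Bochner_Integration.integrable_divide Bochner_Integration.integrable_add integrable_mult_right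
        sqi_integrable R.integrable_const) auto
  also have "\<dots> = (?T * (LINT s|Leb a b. (norm (f s))\<^sup>2) + (b - a) * ((norm A)\<^sup>2 / ?T)) / 2"
    using sqi_integrable[OF f] by (simp add: meas space_restrict_space)
  also have "\<dots> \<le> (?T * (LINT s|Leb a b. (norm (f s))\<^sup>2) + (norm A)\<^sup>2) / 2"
  proof -
    have "(b - a) * ((norm A)\<^sup>2 / ?T) \<le> ?T * ((norm A)\<^sup>2 / ?T)"
      using T by (intro mult_right_mono) auto
    also have "\<dots> = (norm A)\<^sup>2" using T by simp
    finally show ?thesis by (intro divide_right_mono add_left_mono) auto
  qed
  finally have "(norm A)\<^sup>2 \<le> (?T * (LINT s|Leb a b. (norm (f s))\<^sup>2) + (norm A)\<^sup>2) / 2"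
    using A[of A] by (simp add: power2_norm_eq_inner)
  then show ?thesis by simp
qed

section \<open>Symmetric double integrals over a time square\<close>

lemma pair_Leb_Leb: "pair_sigma_finite (Leb a b) (Leb a b)"
proof -
  interpret R: finite_measure "Leb a b" by (rule finite_measure_Leb)
  show ?thesis ..
qed

lemma AE_Leb_neq: "AE r in Leb a b. r \<noteq> s"
proof -
  have "AE r in lborel. r \<noteq> s" by (rule AE_lborel_singleton)
  then show ?thesis by (subst AE_restrict_space_iff) auto
qed

text \<open>The integrand is symmetric and the diagonal is null, so the square splits into two triangles
  of equal weight.\<close>

lemma triangle_integral:
  fixes f :: "real \<Rightarrow> 'h::{real_inner, second_countable_topology}"
  assumes f: "sqi (Leb a b) f"
  shows "(LINT s|Leb a b. LINT r|Leb a b. indicator {a..s} r * (f r \<bullet> f s)) =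
    (LINT s|Leb a b. LINT r|Leb a b. f r \<bullet> f s) / 2"
proof -
  interpret R: finite_measure "Leb a b" by (rule finite_measure_Leb)
  interpret P: pair_sigma_finite "Leb a b" "Leb a b" by (rule pair_Leb_Leb)
  let ?P = "Leb a b \<Otimes>\<^sub>M Leb a b"
  have [measurable]: "f \<in> borel_measurable (Leb a b)" using f by (rule sqi_measurable)
  have id[measurable]: "(\<lambda>x. x) \<in> borel_measurable (Leb a b)"
    by (rule measurable_restrict_space1) simp
  have "integrable ?P (\<lambda>z. (norm (f (fst z)))\<^sup>2 * 1)" "integrable ?P (\<lambda>z. 1 * (norm (f (snd z)))\<^sup>2)"
    using P.integrable_times[OF sqi_integrable[OF f] R.integrable_const[of 1]]
      P.integrable_times[OF R.integrable_const[of 1] sqi_integrable[OF f]] by auto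
  then have "sqi ?P (\<lambda>z. f (fst z))" "sqi ?P (\<lambda>z. f (snd z))"
    by (auto simp: sqi_def)
  from sqi_inner[OF this] have int: "integrable ?P (\<lambda>z. f (fst z) \<bullet> f (snd z))" .
  let ?g = "\<lambda>s r. indicator {a..s} r * (f r \<bullet> f s)"
  let ?h = "\<lambda>s r. indicator {a..r} s * (f r \<bullet> f s)"
  have meas: "(\<lambda>z. indicator {z. snd z \<le> fst z} z :: real) \<in> borel_measurable ?P"
    "(\<lambda>z. indicator {z. fst z \<le> snd z} z :: real) \<in> borel_measurable ?P"
  proof -
    have [measurable]: "fst \<in> borel_measurable ?P" "snd \<in> borel_measurable ?P"
      using measurable_compose[OF measurable_fst id] measurable_compose[OF measurable_snd id] by simp_all
    have "(\<lambda>z. indicator {0..} (fst z - snd z :: real) :: real) \<in> borel_measurable ?P"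
      "(\<lambda>z. indicator {0..} (snd z - fst z :: real) :: real) \<in> borel_measurable ?P" by measurable
    moreover have "(\<lambda>z. indicator {0..} (fst z - snd z :: real) :: real) = (\<lambda>z. indicator {z. snd z \<le> fst z} z)"
      "(\<lambda>z. indicator {0..} (snd z - fst z :: real) :: real) = (\<lambda>z. indicator {z. fst z \<le> snd z} z)"
      by (auto simp: fun_eq_iff indicator_def)
    ultimately show "(\<lambda>z. indicator {z. snd z \<le> fst z} z :: real) \<in> borel_measurable ?P"
      "(\<lambda>z. indicator {z. fst z \<le> snd z} z :: real) \<in> borel_measurable ?P" by simp_all
  qed
  have in_space: "fst z \<in> {a..b}" "snd z \<in> {a..b}" if "z \<in> space ?P" for z
    using that by (auto simp: space_pair_measure space_restrict_space)
  have mg: "(\<lambda>z. indicator {z. snd z \<le> fst z} z * (f (snd z) \<bullet> f (fst z))) \<in> borel_measurable ?P"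
    "(\<lambda>z. indicator {z. fst z \<le> snd z} z * (f (snd z) \<bullet> f (fst z))) \<in> borel_measurable ?P"
    by (intro borel_measurable_times meas borel_measurable_inner measurable_compose[OF measurable_fst]
        measurable_compose[OF measurable_snd] sqi_measurable[OF f])+
  have eq: "indicator {z. snd z \<le> fst z} z * (f (snd z) \<bullet> f (fst z)) = case_prod ?g z"
    "indicator {z. fst z \<le> snd z} z * (f (snd z) \<bullet> f (fst z)) = case_prod ?h z" if "z \<in> space ?P" for z
    using in_space[OF that] by (auto simp: indicator_def split: prod.splits)
  have "case_prod ?g \<in> borel_measurable ?P"
    by (rule measurable_cong[THEN iffD1, OF _ mg(1)]) (rule eq(1))
  moreover have "case_prod ?h \<in> borel_measurable ?P"
    by (rule measurable_cong[THEN iffD1, OF _ mg(2)]) (rule eq(2))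
  ultimately have ig: "integrable ?P (case_prod ?g)" and ih: "integrable ?P (case_prod ?h)"
    by (auto intro!: Bochner_Integration.integrable_bound[OF int] simp: indicator_def inner_commute split: prod.splits)
  have swap: "(LINT s|Leb a b. LINT r|Leb a b. ?g s r) = (LINT s|Leb a b. LINT r|Leb a b. ?h s r)"
    using P.Fubini_integral[OF ig] by (simp add: inner_commute)
  have "AE s in Leb a b. (LINT r|Leb a b. ?g s r) + (LINT r|Leb a b. ?h s r) = (LINT r|Leb a b. f r \<bullet> f s)"
    using P.AE_integrable_fst[OF ig] P.AE_integrable_fst[OF ih] AE_space
  proof eventually_elim
    case (elim s)
    have s: "s \<in> {a..b}" using elim(3) by (simp add: space_restrict_space)
    have "(LINT r|Leb a b. ?g s r) + (LINT r|Leb a b. ?h s r) = (LINT r|Leb a b. ?g s r + ?h s r)"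
      using elim by simp
    also have "\<dots> = (LINT r|Leb a b. f r \<bullet> f s)"
    proof (rule integral_cong_AE)
      show "(\<lambda>r. ?g s r + ?h s r) \<in> borel_measurable (Leb a b)"
        using elim by (intro borel_measurable_add) simp_all
      show "(\<lambda>r. f r \<bullet> f s) \<in> borel_measurable (Leb a b)" by measurable
      show "AE r in Leb a b. ?g s r + ?h s r = f r \<bullet> f s"
        using AE_Leb_neq[where s=s] AE_space
        by eventually_elim (use s in \<open>auto simp: indicator_def space_restrict_space\<close>)
    qed
    finally show ?case .
  qed
  then have "(LINT s|Leb a b. (LINT r|Leb a b. ?g s r) + (LINT r|Leb a b. ?h s r)) =
      (LINT s|Leb a b. LINT r|Leb a b. f r \<bullet> f s)"
    using P.integrable_fst[OF ig] P.integrable_fst[OF ih] P.integrable_fst'[OF int]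
    by (intro integral_cong_AE borel_measurable_add) (auto simp: inner_commute)
  then show ?thesis
    using P.integrable_fst[OF ig] P.integrable_fst[OF ih] swap by simp
qed

text \<open>Over the full square the inner integral is \<open>A \<bullet> f s\<close>, by the weak
  description of \<open>A\<close>, and the outer one is then \<open>A \<bullet> A\<close>.\<close>

lemma triangle_integral_norm:
  fixes f :: "real \<Rightarrow> 'h::{real_inner, second_countable_topology}"
  assumes f: "sqi (Leb a b) f" and A: "\<And>z. A \<bullet> z = (LINT s|Leb a b. indicator {a..b} s * (f s \<bullet> z))"
  shows "(LINT s|Leb a b. LINT r|Leb a b. indicator {a..s} r * (f r \<bullet> f s)) = (norm A)\<^sup>2 / 2"
proof -
  have A': "(LINT s|Leb a b. f s \<bullet> z) = A \<bullet> z" for z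
    unfolding A by (intro Bochner_Integration.integral_cong) (auto simp: space_restrict_space)
  have "(LINT s|Leb a b. LINT r|Leb a b. f r \<bullet> f s) = (norm A)\<^sup>2"
    unfolding A' using A'[of A] by (simp add: power2_norm_eq_inner inner_commute)
  then show ?thesis using triangle_integral[OF f] by simp
qed

section \<open>The energy identity\<close>

context brownian_family
begin

section \<open>Sections and Fubini on the product of the probability space and time\<close>

lemma sqi_pair_fst:
  assumes "sqi M Z"
  shows "sqi (M \<Otimes>\<^sub>M Leb a b) (\<lambda>z. Z (fst z))"
proof -
  interpret P: pair_sigma_finite M "Leb a b" by (rule pair_Leb)
  interpret R: finite_measure "Leb a b" by (rule finite_measure_Leb)
  have "integrable (M \<Otimes>\<^sub>M Leb a b) (\<lambda>z. (norm (Z (fst z)))\<^sup>2 * 1)"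
    by (rule P.integrable_times[OF sqi_integrable[OF assms] R.integrable_const])
  then show ?thesis
    using measurable_compose[OF measurable_fst sqi_measurable[OF assms]] by (simp add: sqi_def)
qed

lemma sqi_pair_sections:
  assumes f: "sqi (M \<Otimes>\<^sub>M Leb a b) f"
  shows "AE \<omega> in M. sqi (Leb a b) (\<lambda>s. f (\<omega>, s))" "AE s in Leb a b. sqi M (\<lambda>\<omega>. f (\<omega>, s))"
proof -
  interpret P: pair_sigma_finite M "Leb a b" by (rule pair_Leb)
  note m = sqi_measurable[OF f] and i = sqi_integrable[OF f]
  show "AE \<omega> in M. sqi (Leb a b) (\<lambda>s. f (\<omega>, s))"
    using P.AE_integrable_fst'[OF i] AE_space
    by eventually_elim (use m in \<open>auto simp: sqi_def intro: measurable_compose[OF measurable_Pair1']\<close>)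
  have "integrable (M \<Otimes>\<^sub>M Leb a b) (case_prod (\<lambda>x y. (norm (f (x, y)))\<^sup>2))"
    using i unfolding split_beta' prod.collapse .
  from P.AE_integrable_snd[OF this] AE_space
  show "AE s in Leb a b. sqi M (\<lambda>\<omega>. f (\<omega>, s))"
    by eventually_elim (use m in \<open>auto simp: sqi_def intro: measurable_compose[OF measurable_Pair2']\<close>)
qed

lemma pair_Leb_Fubini:
  fixes f :: "'w \<times> real \<Rightarrow> real"
  assumes f: "integrable (M \<Otimes>\<^sub>M Leb a b) f"
  shows "integrable M (\<lambda>\<omega>. LINT s|Leb a b. f (\<omega>, s))"
    "(LINT z|(M \<Otimes>\<^sub>M Leb a b). f z) = expectation (\<lambda>\<omega>. LINT s|Leb a b. f (\<omega>, s))"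
    "integrable (Leb a b) (\<lambda>s. expectation (\<lambda>\<omega>. f (\<omega>, s)))"
    "(LINT z|(M \<Otimes>\<^sub>M Leb a b). f z) = (LINT s|Leb a b. expectation (\<lambda>\<omega>. f (\<omega>, s)))"
proof -
  interpret P: pair_sigma_finite M "Leb a b" by (rule pair_Leb)
  have f': "integrable (M \<Otimes>\<^sub>M Leb a b) (case_prod (\<lambda>x y. f (x, y)))" using f by simp
  show "integrable M (\<lambda>\<omega>. LINT s|Leb a b. f (\<omega>, s))" by (rule P.integrable_fst'[OF f])
  show "(LINT z|(M \<Otimes>\<^sub>M Leb a b). f z) = expectation (\<lambda>\<omega>. LINT s|Leb a b. f (\<omega>, s))"
    using P.integral_fst'[OF f] by simp
  show "integrable (Leb a b) (\<lambda>s. expectation (\<lambda>\<omega>. f (\<omega>, s)))" by (rule P.integrable_snd[OF f'])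
  show "(LINT z|(M \<Otimes>\<^sub>M Leb a b). f z) = (LINT s|Leb a b. expectation (\<lambda>\<omega>. f (\<omega>, s)))"
    using P.integral_snd[OF f'] by simp
qed

text \<open>The integral \<open>A\<close> of \<open>B\<close> is given weakly, tested against every \<open>z\<close>, because the space is not
  assumed to be complete.\<close>

lemma drift_sqi:
  assumes B: "sqi (M \<Otimes>\<^sub>M Leb a b) B" and ab: "a \<le> b" and A[measurable]: "A \<in> borel_measurable M"
    and path: "AE \<omega> in M. \<forall>z. A \<omega> \<bullet> z = (LINT s|Leb a b. indicator {a..r} s * (B (\<omega>, s) \<bullet> z))"
  shows "sqi M A"
  unfolding sqi_def
proof
  have "integrable M (\<lambda>\<omega>. (b - a + 1) * (LINT s|Leb a b. (norm (B (\<omega>, s)))\<^sup>2))"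
    by (intro integrable_mult_right pair_Leb_Fubini(1)[OF sqi_integrable[OF B]])
  then show "integrable M (\<lambda>\<omega>. (norm (A \<omega>))\<^sup>2)"
  proof (rule Bochner_Integration.integrable_bound)
    show "AE \<omega> in M. norm ((norm (A \<omega>))\<^sup>2) \<le> norm ((b - a + 1) * (LINT s|Leb a b. (norm (B (\<omega>, s)))\<^sup>2))"
      using path sqi_pair_sections(1)[OF B]
    proof eventually_elim
      case (elim \<omega>)
      have "(norm (A \<omega>))\<^sup>2 \<le> (b - a + 1) * (LINT s|Leb a b. (norm (B (\<omega>, s)))\<^sup>2)"
        using elim(1) by (intro norm_le_of_inner_Leb[OF elim(2) ab]) blast
      then show ?case by (simp add: order_trans[OF _ abs_ge_self])
    qed
  qed measurable
qed fact

text \<open>This replaces integrating the derivative \<open>2 * (B s \<bullet> A s)\<close> of the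
  squared norm of \<open>A s\<close>: inserting the integral for \<open>A s\<close> produces a
  triangle integral along each path, to which \<open>triangle_integral_norm\<close> applies.\<close>

lemma drift_triangle:
  assumes B: "sqi (M \<Otimes>\<^sub>M Leb a b) B" and ab: "a \<le> b" and A: "\<And>r. r \<in> {a..b} \<Longrightarrow> A r \<in> borel_measurable M"
    and path: "\<And>r. r \<in> {a..b} \<Longrightarrow>
      AE \<omega> in M. \<forall>z. A r \<omega> \<bullet> z = (LINT s|Leb a b. indicator {a..r} s * (B (\<omega>, s) \<bullet> z))"
  shows "integrable (Leb a b) (\<lambda>s. expectation (\<lambda>\<omega>. B (\<omega>, s) \<bullet> A s \<omega>))" (is ?int)
    "(LINT s|Leb a b. expectation (\<lambda>\<omega>. B (\<omega>, s) \<bullet> A s \<omega>)) = expectation (\<lambda>\<omega>. (norm (A b \<omega>))\<^sup>2) / 2" (is ?eq)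
proof -
  interpret P: pair_sigma_finite M "Leb a b" by (rule pair_Leb)
  interpret R: finite_measure "Leb a b" by (rule finite_measure_Leb)
  have Bm[measurable]: "B \<in> borel_measurable (M \<Otimes>\<^sub>M Leb a b)" using B by (rule sqi_measurable)
  let ?P = "M \<Otimes>\<^sub>M Leb a b"
  define h where "h z r = indicator {a..snd z} r * (B (fst z, r) \<bullet> B z)" for z r
  \<comment> \<open>\<open>H (\<omega>, s)\<close> equals
    \<open>B (\<omega>, s) \<bullet> A s \<omega>\<close> outside a null set that depends on
    \<open>s\<close>. Unlike that expression it is jointly measurable, so Fubini can be applied to
    it.\<close>
  define H where "H z = (LINT r|Leb a b. h z r)" for z
  have id[measurable]: "(\<lambda>x. x) \<in> borel_measurable (Leb a b)"
    by (rule measurable_restrict_space1) simp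
  have "case_prod h \<in> borel_measurable (?P \<Otimes>\<^sub>M Leb a b)"
  proof -
    let ?Q = "?P \<Otimes>\<^sub>M Leb a b"
    have 1: "(\<lambda>x. B (fst (fst x), snd x)) \<in> borel_measurable ?Q" by measurable
    have 2: "(\<lambda>x. B (fst x)) \<in> borel_measurable ?Q" by measurable
    have s: "(\<lambda>x. snd (fst x)) \<in> borel_measurable ?Q" "(\<lambda>x. snd x) \<in> borel_measurable ?Q"
      using measurable_compose[OF measurable_compose[OF measurable_fst measurable_snd] id]
        measurable_compose[OF measurable_snd id] by simp_all
    have 3: "(\<lambda>x. indicator {0..} (snd (fst x) - snd x) :: real) \<in> borel_measurable ?Q"
      using s by measurable
    have "(\<lambda>x. indicator {0..} (snd (fst x) - snd x) * (B (fst (fst x), snd x) \<bullet> B (fst x))) \<in> borel_measurable ?Q"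
      using 1 2 3 by measurable
    then show ?thesis
      by (rule measurable_cong[THEN iffD1, rotated])
        (auto simp: h_def space_pair_measure space_restrict_space indicator_def)
  qed
  then have Hm[measurable]: "H \<in> borel_measurable ?P"
    unfolding H_def by (rule P.M2.borel_measurable_lebesgue_integral)
  define D where "D \<omega> = (LINT r|Leb a b. (norm (B (\<omega>, r)))\<^sup>2)" for \<omega>
  have D: "integrable M D" unfolding D_def by (rule pair_Leb_Fubini(1)[OF sqi_integrable[OF B]])
  then have [measurable]: "D \<in> borel_measurable M" by simp
  \<comment> \<open>The integrand \<open>h z r\<close> is at most the sum of the squared norms of
    \<open>B (fst z, r)\<close> and \<open>B z\<close>; this is its integral over \<open>r\<close>.
    The factor \<open>1\<close> gives the first summand the product form of
    \<open>integrable_times\<close>.\<close>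
  let ?bd = "\<lambda>z. D (fst z) * 1 + (b - a) * (norm (B z))\<^sup>2"
  have bound: "\<bar>H z\<bar> \<le> ?bd z" if "sqi (Leb a b) (\<lambda>s. B (fst z, s))" for z
  proof -
    have meas: "measure (Leb a b) (space (Leb a b)) = b - a"
      using ab by (simp add: measure_restrict_space space_restrict_space)
    have le: "\<bar>h z r\<bar> \<le> (norm (B (fst z, r)))\<^sup>2 + (norm (B z))\<^sup>2" for r
    proof -
      have "2 * (norm (B (fst z, r)) * norm (B z)) \<le> (norm (B (fst z, r)))\<^sup>2 + (norm (B z))\<^sup>2"
        using sum_squares_bound[of "norm (B (fst z, r))" "norm (B z)"] by (simp add: mult.assoc)
      then have "\<bar>B (fst z, r) \<bullet> B z\<bar> \<le> (norm (B (fst z, r)))\<^sup>2 + (norm (B z))\<^sup>2"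
        using Cauchy_Schwarz_ineq2[of "B (fst z, r)" "B z"]
          mult_nonneg_nonneg[OF norm_ge_zero norm_ge_zero, of "B (fst z, r)" "B z"] by linarith
      then show ?thesis by (auto simp: h_def indicator_def)
    qed
    have "\<bar>H z\<bar> \<le> (LINT r|Leb a b. \<bar>h z r\<bar>)"
      unfolding H_def by (rule integral_abs_bound)
    also have "\<dots> \<le> (LINT r|Leb a b. (norm (B (fst z, r)))\<^sup>2 + (norm (B z))\<^sup>2)"
    proof (rule integral_mono)
      show "integrable (Leb a b) (\<lambda>r. \<bar>h z r\<bar>)"
        unfolding h_def
        by (intro integrable_abs integrable_Leb_indicator sqi_inner that sqi_const finite_measure_Leb) simp
      show "integrable (Leb a b) (\<lambda>r. (norm (B (fst z, r)))\<^sup>2 + (norm (B z))\<^sup>2)"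
        by (intro Bochner_Integration.integrable_add sqi_integrable that R.integrable_const)
    qed (rule le)
    also have "\<dots> = ?bd z"
      unfolding D_def using sqi_integrable[OF that] meas by (simp add: mult.commute)
    finally show ?thesis .
  qed
  have Hint: "integrable ?P H"
  proof (rule Bochner_Integration.integrable_bound)
    show "integrable ?P ?bd"
      by (intro Bochner_Integration.integrable_add integrable_mult_right sqi_integrable B
          P.integrable_times D R.integrable_const)
    have "AE z in ?P. \<bar>H z\<bar> \<le> ?bd z"
    proof (rule P.AE_pair_measure)
      show "{z \<in> space ?P. \<bar>H z\<bar> \<le> ?bd z} \<in> sets ?P" by measurable
      show "AE x in M. AE y in Leb a b. \<bar>H (x, y)\<bar> \<le> ?bd (x, y)"
        using sqi_pair_sections(1)[OF B]
      proof eventually_elim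
        case (elim x)
        then show ?case by (intro AE_I2 bound) simp
      qed
    qed
    then show "AE z in ?P. norm (H z) \<le> norm (?bd z)"
      by eventually_elim (simp add: order_trans[OF _ abs_ge_self])
  qed fact
  have EH: "expectation (\<lambda>\<omega>. B (\<omega>, s) \<bullet> A s \<omega>) = expectation (\<lambda>\<omega>. H (\<omega>, s))"
    if s: "s \<in> space (Leb a b)" for s
  proof (rule integral_cong_AE)
    have s': "s \<in> {a..b}" using s by (simp add: space_restrict_space)
    have [measurable]: "A s \<in> borel_measurable M" by (rule A[OF s'])
    have [measurable]: "(\<lambda>\<omega>. B (\<omega>, s)) \<in> borel_measurable M" "(\<lambda>\<omega>. H (\<omega>, s)) \<in> borel_measurable M"
      using s by (auto intro: measurable_compose[OF measurable_Pair2'] Bm Hm)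
    show "(\<lambda>\<omega>. B (\<omega>, s) \<bullet> A s \<omega>) \<in> borel_measurable M" "(\<lambda>\<omega>. H (\<omega>, s)) \<in> borel_measurable M"
      by measurable
    show "AE \<omega> in M. B (\<omega>, s) \<bullet> A s \<omega> = H (\<omega>, s)"
      using path[OF s']
    proof eventually_elim
      case (elim \<omega>)
      have "A s \<omega> \<bullet> B (\<omega>, s) = H (\<omega>, s)"
        using elim[rule_format, of "B (\<omega>, s)"] by (simp add: H_def h_def)
      then show ?case by (simp add: inner_commute)
    qed
  qed
  have "integrable (Leb a b) (\<lambda>s. expectation (\<lambda>\<omega>. H (\<omega>, s)))"
    by (rule pair_Leb_Fubini(3)[OF Hint])
  then show ?int
    by (rule Bochner_Integration.integrable_cong[THEN iffD1, rotated 2]) (simp_all add: EH)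
  have "(LINT s|Leb a b. expectation (\<lambda>\<omega>. B (\<omega>, s) \<bullet> A s \<omega>)) = (LINT s|Leb a b. expectation (\<lambda>\<omega>. H (\<omega>, s)))"
    by (intro Bochner_Integration.integral_cong refl EH)
  also have "\<dots> = expectation (\<lambda>\<omega>. LINT s|Leb a b. H (\<omega>, s))"
    using pair_Leb_Fubini(2,4)[OF Hint] by simp
  also have "\<dots> = expectation (\<lambda>\<omega>. (norm (A b \<omega>))\<^sup>2 / 2)"
  proof (rule integral_cong_AE)
    show "(\<lambda>\<omega>. LINT s|Leb a b. H (\<omega>, s)) \<in> borel_measurable M"
      using pair_Leb_Fubini(1)[OF Hint] by simp
    have [measurable]: "A b \<in> borel_measurable M" using A ab by simp
    show "(\<lambda>\<omega>. (norm (A b \<omega>))\<^sup>2 / 2) \<in> borel_measurable M" by measurable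
    have "AE \<omega> in M. \<forall>z. A b \<omega> \<bullet> z = (LINT s|Leb a b. indicator {a..b} s * (B (\<omega>, s) \<bullet> z))"
      using path[of b] ab by simp
    then show "AE \<omega> in M. (LINT s|Leb a b. H (\<omega>, s)) = (norm (A b \<omega>))\<^sup>2 / 2"
      using sqi_pair_sections(1)[OF B]
    proof eventually_elim
      case (elim \<omega>)
      show ?case
        unfolding H_def h_def fst_conv snd_conv
        by (rule triangle_integral_norm[OF elim(2)]) (use elim(1) in blast)
    qed
  qed
  finally show ?eq by simp
qed

text \<open>With \<open>y = v + A + J\<close> and \<open>B = K y\<close>, the martingale property gives
  \<open>E <A b, v + J b> = \<integral> E <B s, v + J s> ds = \<integral> E <B s, y s - A s> ds\<close>. Here the first part cancels
  the Ito isometry \<open>E |J b|^2 = - 2 \<integral> E <B s, y s> ds\<close>, and the second part cancels \<open>E |A b|^2\<close>. No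
  Ito formula is needed.\<close>

lemma energy_identity:
  fixes y :: "real \<Rightarrow> 'w \<Rightarrow> 'h::{real_inner, second_countable_topology}"
  assumes ab: "0 \<le> a" "a \<le> b"
    and K: "bounded_linear K" "\<And>x. (norm (K x))\<^sup>2 \<le> c * (- 2 * (K x \<bullet> x))"
    and P: "\<And>x. (\<lambda>k. (norm (P k x))\<^sup>2) sums (- 2 * (K x \<bullet> x))"
    and Q: "\<And>k. bounded_linear (Q k)" "\<And>x. (\<lambda>k. Q k (P k x)) sums K x"
    and v: "sqi M v" "v \<in> borel_measurable (F a)"
    and y: "\<And>r. r \<in> {a..b} \<Longrightarrow> y r \<in> borel_measurable (F r)"
    and A: "\<And>r. r \<in> {a..b} \<Longrightarrow> AE \<omega> in M. ((\<lambda>s. K (y s \<omega>)) has_integral A r \<omega>) {a..r}"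
    and I: "\<And>r k. r \<in> {a..b} \<Longrightarrow> has_ito_integral M F (\<beta> k) a r (\<lambda>s \<omega>. P k (y s \<omega>)) (I r k)"
    and J: "\<And>r. r \<in> {a..b} \<Longrightarrow> mean_square_lim M (\<lambda>n \<omega>. \<Sum>k<n. I r k \<omega>) (J r)"
    and sol: "\<And>r. r \<in> {a..b} \<Longrightarrow> AE \<omega> in M. y r \<omega> = v \<omega> + A r \<omega> + J r \<omega>"
  shows "sqi M (y b)" "expectation (\<lambda>\<omega>. (norm (y b \<omega>))\<^sup>2) = expectation (\<lambda>\<omega>. (norm (v \<omega>))\<^sup>2)"
proof -
  let ?P = "M \<Otimes>\<^sub>M Leb a b"
  have b: "b \<in> {a..b}" and a: "a \<in> {a..b}" using ab by auto
  define X where "X k z = P k (y (snd z) (fst z))" for k and z :: "'w \<times> real"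
  define B where "B z = K (y (snd z) (fst z))" for z :: "'w \<times> real"
  define \<rho> where "\<rho> z = - 2 * (B z \<bullet> y (snd z) (fst z))" for z :: "'w \<times> real"
  have X: "sqi ?P (X k)" for k
    using sqi_ito_integral(2)[OF I[OF b] ab(1)] unfolding X_def [abs_def] .
  \<comment> \<open>Joint measurability of \<open>y\<close> is not at hand. That of \<open>B\<close>
    comes from the Ito integrands \<open>X k\<close>, since the operators \<open>Q k\<close> rebuild
    \<open>K y\<close> from the \<open>P k y\<close>.\<close>
  have Bm: "B \<in> borel_measurable ?P"
  proof (rule borel_measurable_LIMSEQ_metric)
    show "(\<lambda>z. \<Sum>k<n. Q k (X k z)) \<in> borel_measurable ?P" for n
      by (intro borel_measurable_sum measurable_compose[OF sqi_measurable[OF X]]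
          borel_measurable_continuous_onI linear_continuous_on Q(1))
    show "(\<lambda>n. \<Sum>k<n. Q k (X k z)) \<longlonglongrightarrow> B z" for z
      using Q(2) by (simp add: X_def B_def sums_def)
  qed
  have \<rho>_sums: "(\<lambda>k. (norm (X k z))\<^sup>2) sums \<rho> z" for z
    using P by (simp add: X_def \<rho>_def B_def)
  note W = wiener_integral_isometry[OF I[OF b] ab(1) J[OF b]]
  have Wsum: "(\<lambda>k. LINT z|?P. (norm (X k z))\<^sup>2) sums expectation (\<lambda>\<omega>. (norm (J b \<omega>))\<^sup>2)"
    using W(2) by (simp add: X_def)
  have summ: "AE z in ?P. summable (\<lambda>k. norm ((norm (X k z))\<^sup>2))"
    "summable (\<lambda>k. LINT z|?P. norm ((norm (X k z))\<^sup>2))"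
    using \<rho>_sums Wsum by (auto simp: sums_iff)
  have \<rho>_eq: "\<rho> z = (\<Sum>k. (norm (X k z))\<^sup>2)" for z using \<rho>_sums by (rule sums_unique)
  \<comment> \<open>The isometry makes the series of the integrals of the squared norms of
    \<open>X k\<close> converge, so integral and sum may be exchanged.\<close>
  have \<rho>: "integrable ?P \<rho>" and E\<rho>: "(LINT z|?P. \<rho> z) = expectation (\<lambda>\<omega>. (norm (J b \<omega>))\<^sup>2)"
    unfolding \<rho>_eq [abs_def]
    using integrable_suminf[OF sqi_integrable[OF X] summ] integral_suminf[OF sqi_integrable[OF X] summ]
      sums_unique[OF Wsum] by simp_all
  have B: "sqi ?P B"
    unfolding sqi_def
  proof
    have "integrable ?P (\<lambda>z. c * \<rho> z)" using \<rho> by simp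
    then show "integrable ?P (\<lambda>z. (norm (B z))\<^sup>2)"
    proof (rule Bochner_Integration.integrable_bound)
      show "AE z in ?P. norm ((norm (B z))\<^sup>2) \<le> norm (c * \<rho> z)"
      proof (rule AE_I2)
        fix z
        have "(norm (B z))\<^sup>2 \<le> c * \<rho> z" unfolding B_def \<rho>_def by (rule K(2))
        then show "norm ((norm (B z))\<^sup>2) \<le> norm (c * \<rho> z)" by simp
      qed
    qed (use Bm in measurable)
  qed (rule Bm)
  have ym: "y r \<in> borel_measurable M" if "r \<in> {a..b}" for r
    using F_measurable[OF _ y[OF that]] that ab by auto
  have Js: "sqi M (J r)" if "r \<in> {a..b}" for r
    by (rule wiener_integral_isometry(1)[OF I[OF that] ab(1) J[OF that]])
  \<comment> \<open>The witness \<open>A r\<close> need not be measurable. \<open>A'\<close> is a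
    measurable version of it, and with it the decomposition of \<open>y\<close> holds at every point
    instead of almost everywhere.\<close>
  define A' where "A' r \<omega> = y r \<omega> - v \<omega> - J r \<omega>" for r \<omega>
  have A'm: "A' r \<in> borel_measurable M" if "r \<in> {a..b}" for r
    unfolding A'_def [abs_def]
    by (intro borel_measurable_diff ym[OF that] sqi_measurable[OF v(1)] sqi_measurable[OF Js[OF that]])
  \<comment> \<open>The quantifier over \<open>z\<close> stands inside the almost-everywhere
    statement, so \<open>z\<close> may be random: below it is \<open>B (\<omega>, s)\<close> or
    \<open>v \<omega> + J b \<omega>\<close>.\<close>
  have path: "AE \<omega> in M. \<forall>z. A' r \<omega> \<bullet> z = (LINT s|Leb a b. indicator {a..r} s * (B (\<omega>, s) \<bullet> z))"
    if r: "r \<in> {a..b}" for r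
    using A[OF r] sol[OF r] sqi_pair_sections(1)[OF B]
  proof eventually_elim
    case (elim \<omega>)
    have "((\<lambda>s. B (\<omega>, s)) has_integral A' r \<omega>) {a..r}"
      using elim(1,2) by (simp add: B_def A'_def)
    then show ?case using has_integral_inner_Leb[OF elim(3)] r by auto
  qed
  have A's: "sqi M (A' r)" if "r \<in> {a..b}" for r
    by (rule drift_sqi[OF B ab(2) A'm[OF that] path[OF that]])
  have y_eq: "y r \<omega> = A' r \<omega> + (v \<omega> + J r \<omega>)" for r \<omega> by (simp add: A'_def)
  have ys: "sqi M (y r)" if "r \<in> {a..b}" for r
    unfolding y_eq [abs_def] by (intro sqi_add A's[OF that] v Js[OF that])
  show "sqi M (y b)" by (rule ys[OF b])
  have mart: "expectation (\<lambda>\<omega>. Z \<omega> \<bullet> J b \<omega>) = expectation (\<lambda>\<omega>. Z \<omega> \<bullet> J s \<omega>)"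
    if "s \<in> {a..b}" "sqi M Z" "Z \<in> borel_measurable (F s)" for Z s
    using that by (intro wiener_integral_martingale[OF I[OF b] J[OF b] I[OF that(1)] J[OF that(1)] ab(1)]) auto
  \<comment> \<open>By the martingale identity at time \<open>a\<close>, \<open>J b\<close> may be
    replaced by \<open>J a\<close>, an integral over a single point, whose second moment is zero by
    the isometry.\<close>
  have vJ: "expectation (\<lambda>\<omega>. v \<omega> \<bullet> J b \<omega>) = 0"
  proof -
    have "(LINT z|(M \<Otimes>\<^sub>M Leb a a). (norm (P k (y (snd z) (fst z))))\<^sup>2) = 0" for k
    proof -
      have "(\<lambda>z. P k (y (snd z) (fst z))) \<in> borel_measurable (M \<Otimes>\<^sub>M Leb a a)"
        using sqi_measurable[OF sqi_ito_integral(2)[OF I[OF a] ab(1)]] .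
      then have "(\<lambda>z. ennreal ((norm (P k (y (snd z) (fst z))))\<^sup>2)) \<in> borel_measurable (M \<Otimes>\<^sub>M Leb a a)"
        by measurable
      from nn_integral_pair_Leb[OF this]
      have "(\<integral>\<^sup>+ z. ennreal ((norm (P k (y (snd z) (fst z))))\<^sup>2) \<partial>(M \<Otimes>\<^sub>M Leb a a)) = 0"
        by (simp add: nn_integral_cmult_indicator nn_integral_indicator_singleton)
      then have "ennreal (LINT z|(M \<Otimes>\<^sub>M Leb a a). (norm (P k (y (snd z) (fst z))))\<^sup>2) = 0"
        unfolding nn_integral_sqi[OF sqi_ito_integral(2)[OF I[OF a] ab(1)]] .
      moreover have "0 \<le> (LINT z|(M \<Otimes>\<^sub>M Leb a a). (norm (P k (y (snd z) (fst z))))\<^sup>2)"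
        by (rule Bochner_Integration.integral_nonneg) simp
      ultimately show ?thesis unfolding ennreal_eq_0_iff by (rule antisym)
    qed
    with wiener_integral_isometry(2)[OF I[OF a] ab(1) J[OF a]]
    have "expectation (\<lambda>\<omega>. (norm (J a \<omega>))\<^sup>2) = 0" by (simp add: sums_iff)
    then have "expectation (\<lambda>\<omega>. v \<omega> \<bullet> J a \<omega>) = 0"
      using sqi_Cauchy_Schwarz[OF v(1) Js[OF a]] by simp
    then show ?thesis using mart[OF a v] by simp
  qed
  let ?Z = "\<lambda>\<omega>. v \<omega> + J b \<omega>"
  have Z: "sqi M ?Z" by (intro sqi_add v Js[OF b])
  have BZ: "integrable ?P (\<lambda>z. B z \<bullet> ?Z (fst z))"
    by (rule sqi_inner[OF B sqi_pair_fst[OF Z]])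
  have "expectation (\<lambda>\<omega>. A' b \<omega> \<bullet> ?Z \<omega>) = expectation (\<lambda>\<omega>. LINT s|Leb a b. B (\<omega>, s) \<bullet> ?Z \<omega>)"
  proof (rule integral_cong_AE)
    show "(\<lambda>\<omega>. A' b \<omega> \<bullet> ?Z \<omega>) \<in> borel_measurable M"
      using sqi_inner[OF A's[OF b] Z] by simp
    show "(\<lambda>\<omega>. LINT s|Leb a b. B (\<omega>, s) \<bullet> ?Z \<omega>) \<in> borel_measurable M"
      using pair_Leb_Fubini(1)[OF BZ] by simp
    show "AE \<omega> in M. A' b \<omega> \<bullet> ?Z \<omega> = (LINT s|Leb a b. B (\<omega>, s) \<bullet> ?Z \<omega>)"
      using path[OF b]
    proof eventually_elim
      case (elim \<omega>)
      show ?case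
        unfolding elim[rule_format]
        by (intro Bochner_Integration.integral_cong) (auto simp: space_restrict_space)
    qed
  qed
  also have "\<dots> = (LINT s|Leb a b. expectation (\<lambda>\<omega>. B (\<omega>, s) \<bullet> ?Z \<omega>))"
    using pair_Leb_Fubini(2,4)[OF BZ] by simp
  also have "\<dots> = (LINT s|Leb a b. - (1/2) * expectation (\<lambda>\<omega>. \<rho> (\<omega>, s)) - expectation (\<lambda>\<omega>. B (\<omega>, s) \<bullet> A' s \<omega>))"
  proof (rule integral_cong_AE)
    show "(\<lambda>s. expectation (\<lambda>\<omega>. B (\<omega>, s) \<bullet> ?Z \<omega>)) \<in> borel_measurable (Leb a b)"
      using pair_Leb_Fubini(3)[OF BZ] by simp
    show "(\<lambda>s. - (1/2) * expectation (\<lambda>\<omega>. \<rho> (\<omega>, s)) - expectation (\<lambda>\<omega>. B (\<omega>, s) \<bullet> A' s \<omega>)) \<in> borel_measurable (Leb a b)"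
      using pair_Leb_Fubini(3)[OF \<rho>] drift_triangle(1)[OF B ab(2) A'm path]
      by (intro borel_measurable_diff borel_measurable_times) simp_all
    show "AE s in Leb a b. expectation (\<lambda>\<omega>. B (\<omega>, s) \<bullet> ?Z \<omega>) =
        - (1/2) * expectation (\<lambda>\<omega>. \<rho> (\<omega>, s)) - expectation (\<lambda>\<omega>. B (\<omega>, s) \<bullet> A' s \<omega>)"
      using sqi_pair_sections(2)[OF B] AE_space
    proof eventually_elim
      case (elim s)
      have s: "s \<in> {a..b}" using elim(2) by (simp add: space_restrict_space)
      let ?B = "\<lambda>\<omega>. B (\<omega>, s)"
      have "?B \<in> borel_measurable (F s)"
        unfolding B_def fst_conv snd_conv
        by (intro measurable_compose[OF y[OF s]] borel_measurable_continuous_onI linear_continuous_on K(1))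
      note m = mart[OF s elim(1) this]
      have "expectation (\<lambda>\<omega>. ?B \<omega> \<bullet> ?Z \<omega>) = expectation (\<lambda>\<omega>. ?B \<omega> \<bullet> v \<omega>) + expectation (\<lambda>\<omega>. ?B \<omega> \<bullet> J s \<omega>)"
        unfolding inner_add_right m[symmetric]
        by (intro Bochner_Integration.integral_add sqi_inner elim(1) v(1) Js[OF b])
      also have "\<dots> = expectation (\<lambda>\<omega>. ?B \<omega> \<bullet> y s \<omega> - ?B \<omega> \<bullet> A' s \<omega>)"
        unfolding y_eq[of s] inner_add_right
        using sqi_inner[OF elim(1) v(1)] sqi_inner[OF elim(1) Js[OF s]] by simp
      also have "\<dots> = expectation (\<lambda>\<omega>. ?B \<omega> \<bullet> y s \<omega>) - expectation (\<lambda>\<omega>. ?B \<omega> \<bullet> A' s \<omega>)"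
        by (intro Bochner_Integration.integral_diff sqi_inner elim(1) ys[OF s] A's[OF s])
      also have "expectation (\<lambda>\<omega>. ?B \<omega> \<bullet> y s \<omega>) = - (1/2) * expectation (\<lambda>\<omega>. \<rho> (\<omega>, s))"
        by (simp add: \<rho>_def)
      finally show ?case .
    qed
  qed
  also have "\<dots> = - (1/2) * (LINT s|Leb a b. expectation (\<lambda>\<omega>. \<rho> (\<omega>, s))) -
      (LINT s|Leb a b. expectation (\<lambda>\<omega>. B (\<omega>, s) \<bullet> A' s \<omega>))"
    using pair_Leb_Fubini(3)[OF \<rho>] drift_triangle(1)[OF B ab(2) A'm path]
    by (subst Bochner_Integration.integral_diff) simp_all
  also have "\<dots> = - (1/2) * expectation (\<lambda>\<omega>. (norm (J b \<omega>))\<^sup>2) - expectation (\<lambda>\<omega>. (norm (A' b \<omega>))\<^sup>2) / 2"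
    using pair_Leb_Fubini(4)[OF \<rho>] E\<rho> drift_triangle(2)[OF B ab(2) A'm path] by simp
  finally have "2 * expectation (\<lambda>\<omega>. A' b \<omega> \<bullet> ?Z \<omega>) =
      - expectation (\<lambda>\<omega>. (norm (J b \<omega>))\<^sup>2) - expectation (\<lambda>\<omega>. (norm (A' b \<omega>))\<^sup>2)" by simp
  then show "expectation (\<lambda>\<omega>. (norm (y b \<omega>))\<^sup>2) = expectation (\<lambda>\<omega>. (norm (v \<omega>))\<^sup>2)"
    unfolding y_eq[of b] integral_norm_add_sq[OF A's[OF b] Z] integral_norm_add_sq[OF v(1) Js[OF b]]
    using vJ by simp
qed

end

section \<open>The Crank--Nicolson step preserves the mass\<close>

lemma inner_abs_L2:
  assumes f: "sq_int f"
  shows "cinner (abs_L2 f) w = (LINT x|lborel. f x * cnj (rep_L2 w x))"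
proof -
  have [measurable]: "f \<in> borel_measurable borel"
    using f by (simp add: sq_int_def)
  show ?thesis
    unfolding cinner_rep
    by (rule integral_cong_AE) (measurable, use rep_abs_L2[OF f] in eventually_elim, simp)
qed

lemma cinner_self_real: "Im (cinner w w) = 0"
proof -
  have "cinner w w = (LINT x|lborel. complex_of_real ((cmod (rep_L2 w x))\<^sup>2))"
    unfolding cinner_rep by (simp only: complex_norm_square)
  then show ?thesis by (simp only: integral_complex_of_real Im_complex_of_real)
qed

text \<open>An imaginary multiplier times \<open>\<bar>w\<bar>\<^sup>2\<close> has no real part at
  any point. If the product is not square integrable, \<open>pmult\<close> returns its default value
  0, which is orthogonal to \<open>w\<close> too; hence no bound on \<open>m\<close> is
  asked.\<close>

lemma inner_pmult_imaginary:
  assumes "\<And>x. Re (m x) = 0"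
  shows "pmult m w \<bullet> w = 0"
proof (cases "sq_int (\<lambda>x. m x * rep_L2 w x)")
  case True
  have "pmult m w \<bullet> w = Re (LINT x|lborel. m x * rep_L2 w x * cnj (rep_L2 w x))"
    using True by (simp add: pmult_def to_L2_def inner_L2_def inner_abs_L2)
  also have "\<dots> = (LINT x|lborel. Re (m x * rep_L2 w x * cnj (rep_L2 w x)))"
    by (rule integral_Re[symmetric]) (rule sq_int_product[OF True sq_int_rep_L2])
  also have "\<dots> = 0"
  proof -
    have "Re (m x * rep_L2 w x * cnj (rep_L2 w x)) = 0" for x
    proof -
      have "m x * rep_L2 w x * cnj (rep_L2 w x) = m x * complex_of_real ((cmod (rep_L2 w x))\<^sup>2)"
        by (simp only: complex_norm_square mult.assoc)
      then show ?thesis using assms by simp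
    qed
    then show ?thesis by simp
  qed
  finally show ?thesis .
next
  case False
  then show ?thesis by (simp add: pmult_def to_L2_def)
qed

text \<open>Since \<open>w\<close> lies in the form domain, it may be taken as its own test
  function: \<open>cinner h w\<close> is minus a sum of squared norms, hence real, and a factor
  \<open>\<i> * t\<close> makes it imaginary.\<close>

lemma inner_pmult_laplacian:
  assumes "has_laplacian bc D w h"
  shows "pmult (\<lambda>_. \<i> * of_real t) h \<bullet> w = 0"
proof -
  have w: "cinner h w = - (\<Sum>i\<in>UNIV. cinner (weak_deriv D i w) (weak_deriv D i w))"
    using assms by (auto simp: has_laplacian_def)
  have "pmult (\<lambda>_. \<i> * of_real t) h \<bullet> w = Re (LINT x|lborel. \<i> * of_real t * rep_L2 h x * cnj (rep_L2 w x))"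
    using sq_int_scale[OF sq_int_rep_L2, of "\<i> * of_real t" h]
    by (simp add: pmult_def to_L2_def inner_L2_def inner_abs_L2)
  also have "(LINT x|lborel. \<i> * of_real t * rep_L2 h x * cnj (rep_L2 w x)) = \<i> * of_real t * cinner h w"
    unfolding cinner_rep mult.assoc[of "\<i> * of_real t"] by (rule integral_mult_right_zero)
  also have "Re (\<i> * of_real t * cinner h w) = 0"
    unfolding w by (simp add: cinner_self_real)
  finally show ?thesis .
qed

lemma cn_step_norm:
  assumes "cn_step bc D l \<epsilon> \<tau> v u"
  shows "norm u = norm v"
proof -
  let ?w = "(1/2) *\<^sub>R (v + u)"
  obtain h where h: "has_laplacian bc D ?w h"
    and u: "u = v + pmult (\<lambda>_. \<i> * of_real \<tau>) h +
       pmult (\<lambda>x. \<i> * of_real (l * \<tau> * integral {0..1} (\<lambda>\<theta>.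
           f_reg \<epsilon> (\<theta> * (cmod (rep_L2 v x))\<^sup>2 + (1 - \<theta>) * (cmod (rep_L2 u x))\<^sup>2)))) ?w"
    using assms unfolding cn_step_def by blast
  define a b where "a = pmult (\<lambda>_. \<i> * of_real \<tau>) h"
    and "b = pmult (\<lambda>x. \<i> * of_real (l * \<tau> * integral {0..1} (\<lambda>\<theta>.
           f_reg \<epsilon> (\<theta> * (cmod (rep_L2 v x))\<^sup>2 + (1 - \<theta>) * (cmod (rep_L2 u x))\<^sup>2)))) ?w"
  have "a \<bullet> ?w = 0" unfolding a_def by (rule inner_pmult_laplacian[OF h])
  moreover have "b \<bullet> ?w = 0" unfolding b_def by (rule inner_pmult_imaginary) simp
  moreover have "u - v = a + b" using u unfolding a_def b_def by (simp add: algebra_simps)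
  ultimately have "(u - v) \<bullet> ?w = 0" by (simp add: inner_add_left)
  then have "(u - v) \<bullet> (u + v) = 0" by (simp add: add.commute)
  moreover have "(u - v) \<bullet> (u + v) = u \<bullet> u - v \<bullet> v"
    by (simp add: inner_diff_left inner_add_right inner_commute[of v u])
  ultimately have "u \<bullet> u = v \<bullet> v" by simp
  then show ?thesis by (simp add: norm_eq_sqrt_inner)
qed

section \<open>Multiplication operators\<close>

lemma norm_le_rep:
  assumes "AE x in lborel. cmod (rep_L2 u x) \<le> C * cmod (rep_L2 v x)" "0 \<le> C"
  shows "norm u \<le> C * norm v"
proof (rule power2_le_imp_le)
  have "(norm u)\<^sup>2 \<le> (LINT x|lborel. C\<^sup>2 * (cmod (rep_L2 v x))\<^sup>2)"
    unfolding norm_sq_rep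
  proof (rule integral_mono_AE)
    show "AE x in lborel. (cmod (rep_L2 u x))\<^sup>2 \<le> C\<^sup>2 * (cmod (rep_L2 v x))\<^sup>2"
      using assms(1)
    proof eventually_elim
      case (elim x)
      then have "(cmod (rep_L2 u x))\<^sup>2 \<le> (C * cmod (rep_L2 v x))\<^sup>2" by (intro power_mono) auto
      then show ?case by (simp add: power_mult_distrib)
    qed
  qed (auto intro: integrable_rep_L2)
  also have "\<dots> = (C * norm v)\<^sup>2" by (simp add: norm_sq_rep power_mult_distrib)
  finally show "(norm u)\<^sup>2 \<le> (C * norm v)\<^sup>2" .
qed (use assms in simp)

lemma rep_sum_L2: "AE x in lborel. rep_L2 (\<Sum>k<n. u k) x = (\<Sum>k<(n::nat). rep_L2 (u k) x)"
proof (induction n)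
  case 0
  then show ?case using rep_zero_L2 by simp
next
  case (Suc n)
  then show ?case
    using rep_plus_L2[of "\<Sum>k<n. u k" "u n"] by (auto elim: eventually_elim2)
qed

text \<open>The multipliers for which \<open>pmult\<close> never takes its default value and is a
  bounded operator.\<close>

definition ess_bounded :: "(real ^ 'd::finite \<Rightarrow> complex) \<Rightarrow> real \<Rightarrow> bool" where
  "ess_bounded m C \<longleftrightarrow> m \<in> borel_measurable borel \<and> 0 \<le> C \<and> (AE x in lborel. cmod (m x) \<le> C)"

lemma rep_pmult:
  assumes "ess_bounded m C"
  shows "AE x in lborel. rep_L2 (pmult m u) x = m x * rep_L2 u x"
proof -
  have [measurable]: "m \<in> borel_measurable borel" using assms by (simp add: ess_bounded_def)
  have "AE x in lborel. cmod (m x) \<le> C" using assms by (simp add: ess_bounded_def)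
  then have "AE x in lborel. cmod (m x * rep_L2 u x) \<le> C * cmod (rep_L2 u x)"
    by eventually_elim (simp add: norm_mult mult_right_mono)
  then have "sq_int (\<lambda>x. m x * rep_L2 u x)"
    by (intro sq_int_bound[OF _ sq_int_rep_L2]) auto
  then show ?thesis
    unfolding pmult_def to_L2_def by (simp add: rep_abs_L2)
qed

lemma norm_pmult_le:
  assumes "ess_bounded m C"
  shows "norm (pmult m u) \<le> C * norm u"
proof (rule norm_le_rep)
  have "AE x in lborel. cmod (m x) \<le> C" using assms by (simp add: ess_bounded_def)
  then show "AE x in lborel. cmod (rep_L2 (pmult m u) x) \<le> C * cmod (rep_L2 u x)"
    using rep_pmult[OF assms, of u] by eventually_elim (simp add: norm_mult mult_right_mono)
qed (use assms in \<open>simp add: ess_bounded_def\<close>)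

lemma bounded_linear_pmult:
  assumes "ess_bounded m C"
  shows "bounded_linear (pmult m)"
proof (rule bounded_linear_intro[where K=C])
  show "pmult m (u + v) = pmult m u + pmult m v" for u v
  proof (rule L2_eqI)
    show "AE x in lborel. rep_L2 (pmult m (u + v)) x = rep_L2 (pmult m u + pmult m v) x"
      using rep_pmult[OF assms, of "u + v"] rep_pmult[OF assms, of u] rep_pmult[OF assms, of v]
        rep_plus_L2[of u v] rep_plus_L2[of "pmult m u" "pmult m v"]
      by eventually_elim (simp add: distrib_left)
  qed
  show "pmult m (r *\<^sub>R u) = r *\<^sub>R pmult m u" for r u
  proof (rule L2_eqI)
    show "AE x in lborel. rep_L2 (pmult m (r *\<^sub>R u)) x = rep_L2 (r *\<^sub>R pmult m u) x"
      using rep_pmult[OF assms, of "r *\<^sub>R u"] rep_pmult[OF assms, of u]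
        rep_scaleR_L2[of r u] rep_scaleR_L2[of r "pmult m u"]
      by eventually_elim simp
  qed
  show "norm (pmult m u) \<le> norm u * C" for u
    using norm_pmult_le[OF assms, of u] by (simp add: mult.commute)
qed

section \<open>The coefficients of the multiplicative noise\<close>

lemma ess_bounded_rep:
  fixes u :: "'d::finite L2"
  assumes "ess_norm u < \<infinity>"
  shows "0 \<le> ess_norm u" "ess_bounded (rep_L2 u) (real_of_ereal (ess_norm u))"
proof -
  have "(0::ereal) = esssup (lborel :: (real ^ 'd) measure) (\<lambda>x. 0)"
    by (rule esssup_const[symmetric]) simp
  also have "\<dots> \<le> ess_norm u"
    unfolding ess_norm_def by (rule esssup_mono) simp_all
  finally show 0: "0 \<le> ess_norm u" .
  have "AE x in lborel. ereal (cmod (rep_L2 u x)) \<le> ess_norm u"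
    unfolding ess_norm_def by (rule esssup_AE)
  then have "AE x in lborel. cmod (rep_L2 u x) \<le> real_of_ereal (ess_norm u)"
    by eventually_elim (use 0 assms in \<open>cases "ess_norm u"; simp\<close>)
  then show "ess_bounded (rep_L2 u) (real_of_ereal (ess_norm u))"
    using 0 by (simp add: ess_bounded_def real_of_ereal_pos)
qed

text \<open>The constants \<open>c k\<close> are the essential suprema of the coefficients, which
  lie below their \<open>W1inf_norm\<close>.\<close>

lemma data_hypothesis_ess_bounded:
  assumes "data_hypothesis Multiplicative D u0 q"
  obtains c where "\<And>k. ess_bounded (rep_L2 (q k)) (c k)" "summable (\<lambda>k. (c k)\<^sup>2)"
proof
  let ?c = "\<lambda>k. real_of_ereal (ess_norm (q k))"
  have q: "q k \<in> W1inf D" for k using assms by (auto simp: data_hypothesis_def)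
  have fin: "ess_norm (q k) < \<infinity>" "ess_norm (weak_deriv D i (q k)) < \<infinity>" for k i
    using q[of k] by (auto simp: W1inf_def)
  show "ess_bounded (rep_L2 (q k)) (?c k)" for k by (rule ess_bounded_rep(2)[OF fin(1)])
  have le: "?c k \<le> W1inf_norm D (q k)" for k
  proof -
    have "0 \<le> (\<Sum>i\<in>UNIV. ess_norm (weak_deriv D i (q k)))"
      by (intro sum_nonneg ess_bounded_rep(1) fin)
    \<comment> \<open>Since \<open>real_of_ereal\<close> sends \<infinity> to 0, finiteness has to
      be known before monotonicity can be used.\<close>
    moreover have "(\<Sum>i\<in>UNIV. ess_norm (weak_deriv D i (q k))) \<noteq> \<infinity>"
      using fin(2) by (simp add: sum_Pinfty less_top)
    ultimately show ?thesis
      unfolding W1inf_norm_def using ess_bounded_rep(1)[OF fin(1)[of k]] fin(1)[of k]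
      by (intro real_of_ereal_positive_mono) (auto intro: add_increasing2)
  qed
  have "summable (\<lambda>k. (H1_norm D (q k))\<^sup>2 + (W1inf_norm D (q k))\<^sup>2)"
    using assms by (simp add: data_hypothesis_def)
  then show "summable (\<lambda>k. (?c k)\<^sup>2)"
  proof (rule summable_comparison_test[rotated], intro exI allI impI)
    fix k :: nat
    have "0 \<le> ?c k" using ess_bounded_rep(1)[OF fin(1)] by (rule real_of_ereal_pos)
    then have "(?c k)\<^sup>2 \<le> (W1inf_norm D (q k))\<^sup>2" using le by (intro power_mono)
    then show "norm ((?c k)\<^sup>2) \<le> (H1_norm D (q k))\<^sup>2 + (W1inf_norm D (q k))\<^sup>2"
      by (simp add: add_increasing)
  qed
qed

text \<open>\<open>K\<close> is the Ito correction and \<open>P k\<close> the coefficient of the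
  \<open>k\<close>-th Brownian motion. \<open>Q k\<close> is chosen so that
  \<open>Q k (P k z)\<close> is the \<open>k\<close>-th summand of \<open>K z\<close>, because
  \<open>(\<i> / 2) * cnj q * (\<i> * q)\<close> is minus half the squared modulus of
  \<open>q\<close>. In the last claim, one factor of the squared multiplier is bounded by the sum of
  the \<open>(c k)\<^sup>2\<close>, and the other is kept for the inner product with
  \<open>z\<close>.\<close>

lemma noise_operators:
  fixes q :: "nat \<Rightarrow> 'd::finite L2"
  assumes q: "\<And>k. ess_bounded (rep_L2 (q k)) (c k)" and c: "summable (\<lambda>k. (c k)\<^sup>2)"
  defines "K \<equiv> pmult (\<lambda>x. complex_of_real (- (1/2) * (\<Sum>i. (cmod (rep_L2 (q i) x))\<^sup>2)))"
    and "P \<equiv> \<lambda>k. pmult (\<lambda>x. \<i> * rep_L2 (q k) x)"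
    and "Q \<equiv> \<lambda>k. pmult (\<lambda>x. (\<i> / 2) * cnj (rep_L2 (q k) x))"
  shows "bounded_linear K" "\<And>k. bounded_linear (Q k)"
    "\<And>z. (\<lambda>k. (norm (P k z))\<^sup>2) sums (- 2 * (K z \<bullet> z))"
    "\<And>z. (\<lambda>k. Q k (P k z)) sums K z"
    "\<And>z. (norm (K z))\<^sup>2 \<le> ((\<Sum>k. (c k)\<^sup>2) / 4) * (- 2 * (K z \<bullet> z))"
proof -
  let ?S = "\<Sum>k. (c k)\<^sup>2"
  define \<mu> where "\<mu> x = (\<Sum>i. (cmod (rep_L2 (q i) x))\<^sup>2)" for x
  have [measurable]: "\<mu> \<in> borel_measurable borel" unfolding \<mu>_def [abs_def] by measurable
  have q_le: "AE x in lborel. \<forall>k. cmod (rep_L2 (q k) x) \<le> c k"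
    using q by (auto simp: AE_all_countable ess_bounded_def)
  have c0: "0 \<le> c k" for k using q by (simp add: ess_bounded_def)
  \<comment> \<open>The tail bound does not depend on \<open>x\<close>; this uniformity gives
    convergence in norm of the series for \<open>K z\<close>.\<close>
  have facts: "AE x in lborel. summable (\<lambda>i. (cmod (rep_L2 (q i) x))\<^sup>2) \<and> 0 \<le> \<mu> x \<and> \<mu> x \<le> ?S \<and>
      (\<forall>n. \<bar>\<mu> x - (\<Sum>i<n. (cmod (rep_L2 (q i) x))\<^sup>2)\<bar> \<le> (\<Sum>i. (c (i + n))\<^sup>2))"
    using q_le
  proof eventually_elim
    case (elim x)
    have le: "(cmod (rep_L2 (q i) x))\<^sup>2 \<le> (c i)\<^sup>2" for i using elim by (intro power_mono) auto
    have s: "summable (\<lambda>i. (cmod (rep_L2 (q i) x))\<^sup>2)"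
      by (rule summable_comparison_test[OF _ c]) (use le in auto)
    have "\<bar>\<mu> x - (\<Sum>i<n. (cmod (rep_L2 (q i) x))\<^sup>2)\<bar> \<le> (\<Sum>i. (c (i + n))\<^sup>2)" for n
    proof -
      have "\<mu> x - (\<Sum>i<n. (cmod (rep_L2 (q i) x))\<^sup>2) = (\<Sum>i. (cmod (rep_L2 (q (i + n)) x))\<^sup>2)"
        unfolding \<mu>_def by (rule suminf_minus_initial_segment[OF s, symmetric])
      moreover have "0 \<le> (\<Sum>i. (cmod (rep_L2 (q (i + n)) x))\<^sup>2)"
        by (intro suminf_nonneg summable_ignore_initial_segment s) simp
      moreover have "(\<Sum>i. (cmod (rep_L2 (q (i + n)) x))\<^sup>2) \<le> (\<Sum>i. (c (i + n))\<^sup>2)"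
        by (intro suminf_le summable_ignore_initial_segment[OF s] summable_ignore_initial_segment[OF c] le)
      ultimately show ?thesis by simp
    qed
    moreover have "0 \<le> \<mu> x" "\<mu> x \<le> ?S"
      unfolding \<mu>_def using s c le by (auto intro: suminf_nonneg suminf_le)
    ultimately show ?case using s by simp
  qed
  have S0: "0 \<le> ?S" using c by (intro suminf_nonneg) auto
  have bK: "ess_bounded (\<lambda>x. complex_of_real (- (1/2) * \<mu> x)) (?S / 2)"
    unfolding ess_bounded_def
  proof (intro conjI)
    show "AE x in lborel. cmod (complex_of_real (- (1/2) * \<mu> x)) \<le> ?S / 2"
      using facts by eventually_elim (simp only: norm_of_real, simp)
  qed (use S0 in \<open>measurable, simp\<close>)
  have bP: "ess_bounded (\<lambda>x. \<i> * rep_L2 (q k) x) (c k)" for k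
    using q[of k] by (simp add: ess_bounded_def norm_mult)
  have bQ: "ess_bounded (\<lambda>x. (\<i> / 2) * cnj (rep_L2 (q k) x)) (c k)" for k
    unfolding ess_bounded_def
  proof (intro conjI c0)
    have "AE x in lborel. cmod (rep_L2 (q k) x) \<le> c k" using q[of k] by (simp add: ess_bounded_def)
    then show "AE x in lborel. cmod ((\<i> / 2) * cnj (rep_L2 (q k) x)) \<le> c k"
    proof eventually_elim
      case (elim x)
      have "cmod ((\<i> / 2) * cnj (rep_L2 (q k) x)) = cmod (rep_L2 (q k) x) / 2"
        by (simp add: norm_mult norm_divide)
      then show ?case using elim norm_ge_zero[of "rep_L2 (q k) x"] by linarith
    qed
  qed measurable
  have K_eq: "K = pmult (\<lambda>x. complex_of_real (- (1/2) * \<mu> x))" unfolding K_def \<mu>_def ..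
  note rK = rep_pmult[OF bK, folded K_eq]
  have rP: "AE x in lborel. rep_L2 (P k z) x = \<i> * rep_L2 (q k) x * rep_L2 z x" for k z
    unfolding P_def by (rule rep_pmult[OF bP])
  have rQ: "AE x in lborel. rep_L2 (Q k z) x = (\<i> / 2) * cnj (rep_L2 (q k) x) * rep_L2 z x" for k z
    unfolding Q_def by (rule rep_pmult[OF bQ])
  show "bounded_linear K" unfolding K_eq by (rule bounded_linear_pmult[OF bK])
  show "bounded_linear (Q k)" for k unfolding Q_def by (rule bounded_linear_pmult[OF bQ])
  fix z :: "'d L2"
  have iz: "integrable lborel (\<lambda>x. (cmod (rep_L2 z x))\<^sup>2)" by (rule integrable_rep_L2)
  have Kz: "- 2 * (K z \<bullet> z) = (LINT x|lborel. \<mu> x * (cmod (rep_L2 z x))\<^sup>2)"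
  proof -
    have "K z \<bullet> z = (LINT x|lborel. - (1/2) * (\<mu> x * (cmod (rep_L2 z x))\<^sup>2))"
      unfolding inner_rep
    proof (rule integral_cong_AE)
      show "AE x in lborel. Re (rep_L2 (K z) x * cnj (rep_L2 z x)) = - (1/2) * (\<mu> x * (cmod (rep_L2 z x))\<^sup>2)"
        using rK[of z]
      proof eventually_elim
        case (elim x)
        have "rep_L2 (K z) x * cnj (rep_L2 z x) =
            complex_of_real (- (1/2) * \<mu> x) * complex_of_real ((cmod (rep_L2 z x))\<^sup>2)"
          unfolding elim by (simp only: complex_norm_square mult.assoc)
        then show ?case by (simp only: of_real_mult[symmetric] Re_complex_of_real mult.assoc)
      qed
    qed measurable
    then show ?thesis by simp
  qed
  have Pz: "(norm (P k z))\<^sup>2 = (LINT x|lborel. (cmod (rep_L2 (q k) x))\<^sup>2 * (cmod (rep_L2 z x))\<^sup>2)" for k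
    unfolding norm_sq_rep
  proof (rule integral_cong_AE)
    show "AE x in lborel. (cmod (rep_L2 (P k z) x))\<^sup>2 = (cmod (rep_L2 (q k) x))\<^sup>2 * (cmod (rep_L2 z x))\<^sup>2"
      using rP[of k z] by eventually_elim (simp add: norm_mult power_mult_distrib)
  qed measurable
  have iP: "integrable lborel (\<lambda>x. (cmod (rep_L2 (q k) x))\<^sup>2 * (cmod (rep_L2 z x))\<^sup>2)" for k
  proof (rule Bochner_Integration.integrable_bound)
    show "integrable lborel (\<lambda>x. (c k)\<^sup>2 * (cmod (rep_L2 z x))\<^sup>2)" using iz by simp
    show "AE x in lborel. norm ((cmod (rep_L2 (q k) x))\<^sup>2 * (cmod (rep_L2 z x))\<^sup>2)
        \<le> norm ((c k)\<^sup>2 * (cmod (rep_L2 z x))\<^sup>2)"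
      using q_le by eventually_elim (auto intro!: mult_right_mono power_mono)
  qed measurable
  have sumP: "summable (\<lambda>k. LINT x|lborel. norm ((cmod (rep_L2 (q k) x))\<^sup>2 * (cmod (rep_L2 z x))\<^sup>2))"
  proof (rule summable_comparison_test)
    show "summable (\<lambda>k. (c k)\<^sup>2 * (norm z)\<^sup>2)" using c by (rule summable_mult2)
    show "\<exists>N. \<forall>k\<ge>N. norm (LINT x|lborel. norm ((cmod (rep_L2 (q k) x))\<^sup>2 * (cmod (rep_L2 z x))\<^sup>2))
        \<le> (c k)\<^sup>2 * (norm z)\<^sup>2"
    proof (intro exI allI impI)
      fix k :: nat
      have "norm (P k z) \<le> c k * norm z" unfolding P_def by (rule norm_pmult_le[OF bP])
      then have "(norm (P k z))\<^sup>2 \<le> (c k * norm z)\<^sup>2" by (intro power_mono) auto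
      then show "norm (LINT x|lborel. norm ((cmod (rep_L2 (q k) x))\<^sup>2 * (cmod (rep_L2 z x))\<^sup>2))
        \<le> (c k)\<^sup>2 * (norm z)\<^sup>2"
        using Pz[of k] by (simp add: power_mult_distrib)
    qed
  qed
  have sm: "AE x in lborel. summable (\<lambda>k. norm ((cmod (rep_L2 (q k) x))\<^sup>2 * (cmod (rep_L2 z x))\<^sup>2))"
    using facts by eventually_elim (auto intro: summable_mult2)
  have "(\<lambda>k. (norm (P k z))\<^sup>2) sums (LINT x|lborel. (\<Sum>k. (cmod (rep_L2 (q k) x))\<^sup>2 * (cmod (rep_L2 z x))\<^sup>2))"
    unfolding Pz by (rule sums_integral[OF iP sm sumP])
  also have "(LINT x|lborel. (\<Sum>k. (cmod (rep_L2 (q k) x))\<^sup>2 * (cmod (rep_L2 z x))\<^sup>2)) =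
      (LINT x|lborel. \<mu> x * (cmod (rep_L2 z x))\<^sup>2)"
  proof (rule integral_cong_AE)
    show "AE x in lborel. (\<Sum>k. (cmod (rep_L2 (q k) x))\<^sup>2 * (cmod (rep_L2 z x))\<^sup>2) = \<mu> x * (cmod (rep_L2 z x))\<^sup>2"
      using facts by eventually_elim (simp add: \<mu>_def suminf_mult2)
  qed measurable
  finally show "(\<lambda>k. (norm (P k z))\<^sup>2) sums (- 2 * (K z \<bullet> z))" unfolding Kz .
  have i\<mu>: "integrable lborel (\<lambda>x. \<mu> x * (cmod (rep_L2 z x))\<^sup>2)"
  proof (rule Bochner_Integration.integrable_bound)
    show "integrable lborel (\<lambda>x. ?S * (cmod (rep_L2 z x))\<^sup>2)" using iz by simp
    show "AE x in lborel. norm (\<mu> x * (cmod (rep_L2 z x))\<^sup>2) \<le> norm (?S * (cmod (rep_L2 z x))\<^sup>2)"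
      using facts by eventually_elim (auto simp: abs_mult intro!: mult_right_mono)
  qed measurable
  have "(norm (K z))\<^sup>2 \<le> (LINT x|lborel. (?S / 4) * (\<mu> x * (cmod (rep_L2 z x))\<^sup>2))"
    unfolding norm_sq_rep
  proof (rule integral_mono_AE)
    show "AE x in lborel. (cmod (rep_L2 (K z) x))\<^sup>2 \<le> (?S / 4) * (\<mu> x * (cmod (rep_L2 z x))\<^sup>2)"
      using facts rK[of z]
    proof eventually_elim
      case (elim x)
      have "cmod (rep_L2 (K z) x) = (1/2) * \<mu> x * cmod (rep_L2 z x)"
        unfolding elim(2) norm_mult norm_of_real using elim(1) by simp
      then have "(cmod (rep_L2 (K z) x))\<^sup>2 = ((1/2) * \<mu> x * cmod (rep_L2 z x))\<^sup>2"
        by (rule arg_cong)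
      also have "\<dots> = (1/4) * (\<mu> x * \<mu> x) * (cmod (rep_L2 z x))\<^sup>2"
        by (simp add: power2_eq_square)
      also have "\<dots> \<le> (1/4) * (?S * \<mu> x) * (cmod (rep_L2 z x))\<^sup>2"
        using elim(1) by (intro mult_right_mono mult_left_mono) auto
      finally show ?case by simp
    qed
  qed (use i\<mu> in \<open>auto intro: integrable_rep_L2\<close>)
  then show "(norm (K z))\<^sup>2 \<le> (?S / 4) * (- 2 * (K z \<bullet> z))" unfolding Kz by simp
  show "(\<lambda>k. Q k (P k z)) sums K z"
    unfolding sums_def
  proof (rule LIM_zero_cancel, rule tendsto_norm_zero_cancel)
    \<comment> \<open>The difference is multiplication by half of the remainder of the series
      \<open>\<mu>\<close>.\<close>
    have "norm ((\<Sum>k<n. Q k (P k z)) - K z) \<le> (\<Sum>i. (c (i + n))\<^sup>2) * norm z" for n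
    proof (rule norm_le_rep)
      have all: "AE x in lborel. \<forall>k. rep_L2 (Q k (P k z)) x = - (1/2) * of_real ((cmod (rep_L2 (q k) x))\<^sup>2) * rep_L2 z x"
        unfolding AE_all_countable
      proof
        fix k
        show "AE x in lborel. rep_L2 (Q k (P k z)) x = - (1/2) * of_real ((cmod (rep_L2 (q k) x))\<^sup>2) * rep_L2 z x"
          using rQ[of k "P k z"] rP[of k z]
        proof eventually_elim
          case (elim x)
          have "(\<i> / 2) * cnj (rep_L2 (q k) x) * (\<i> * rep_L2 (q k) x * rep_L2 z x) =
              - (1/2) * (rep_L2 (q k) x * cnj (rep_L2 (q k) x)) * rep_L2 z x"
            by (simp add: algebra_simps)
          then show ?case unfolding elim by (simp only: complex_norm_square)
        qed
      qed
      show "AE x in lborel. cmod (rep_L2 ((\<Sum>k<n. Q k (P k z)) - K z) x) \<le> (\<Sum>i. (c (i + n))\<^sup>2) * cmod (rep_L2 z x)"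
        using all facts rK[of z] rep_minus_L2[of "\<Sum>k<n. Q k (P k z)" "K z"] rep_sum_L2[of "\<lambda>k. Q k (P k z)" n]
      proof eventually_elim
        case (elim x)
        let ?s = "\<Sum>i<n. (cmod (rep_L2 (q i) x))\<^sup>2"
        have "rep_L2 ((\<Sum>k<n. Q k (P k z)) - K z) x = of_real ((1/2) * (\<mu> x - ?s)) * rep_L2 z x"
          using elim(1) unfolding elim(3,4,5)
          by (simp add: sum_distrib_left sum_distrib_right sum_negf algebra_simps)
        then have "cmod (rep_L2 ((\<Sum>k<n. Q k (P k z)) - K z) x) = (1/2) * \<bar>\<mu> x - ?s\<bar> * cmod (rep_L2 z x)"
          by (simp only: norm_mult norm_of_real abs_mult abs_divide abs_one abs_numeral)
        also have "\<dots> \<le> (\<Sum>i. (c (i + n))\<^sup>2) * cmod (rep_L2 z x)"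
          using elim(2)[THEN conjunct2, THEN conjunct2, THEN conjunct2, rule_format, of n]
          by (intro mult_right_mono) auto
        finally show ?case .
      qed
      show "0 \<le> (\<Sum>i. (c (i + n))\<^sup>2)"
        by (intro suminf_nonneg summable_ignore_initial_segment[OF c]) simp
    qed
    moreover have "(\<lambda>n. (\<Sum>i. (c (i + n))\<^sup>2) * norm z) \<longlonglongrightarrow> 0 * norm z"
      by (intro tendsto_mult_right suminf_exist_split2 c)
    ultimately show "(\<lambda>n. norm ((\<Sum>k<n. Q k (P k z)) - K z)) \<longlonglongrightarrow> 0"
      by (intro LIMSEQ_null_bound[of "\<lambda>n. norm ((\<Sum>k<n. Q k (P k z)) - K z)"]) simp_all
  qed
qed

section \<open>One step of the scheme\<close>

context brownian_family
begin

lemma additive_noise_step: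
  fixes q :: "nat \<Rightarrow> 'h::{real_inner, second_countable_topology}"
  assumes ab: "0 \<le> a" "a \<le> b"
    and W: "\<And>t. 0 \<le> t \<Longrightarrow> mean_square_lim M (\<lambda>n \<omega>. \<Sum>k<n. \<beta> k t \<omega> *\<^sub>R q k) (W t)"
    and v: "sqi M v" "v \<in> borel_measurable (F a)"
    and y: "y \<in> borel_measurable M" "AE \<omega> in M. y \<omega> = v \<omega> + (W b \<omega> - W a \<omega>)"
  shows "sqi M y" "expectation (\<lambda>\<omega>. (norm (y \<omega>))\<^sup>2) =
    expectation (\<lambda>\<omega>. (norm (v \<omega>))\<^sup>2) + (b - a) * (\<Sum>k. (norm (q k))\<^sup>2)"
proof -
  have sq_const: "sqi M (\<lambda>\<omega>. q k)" for k by (rule sqi_const) (rule finite_measure_axioms)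
  have incr_q: "sqi M (\<lambda>\<omega>. incr k s t \<omega> *\<^sub>R q k)" if "0 \<le> s" "s \<le> t" for k s t
    using that by (intro sqi_incr sq_const) auto
  have "sqi M (\<lambda>\<omega>. \<beta> k t \<omega> *\<^sub>R q k)" if "0 \<le> t" for k t
  proof (rule sqi_cong_AE[OF incr_q[OF order_refl that, of k]])
    show "(\<lambda>\<omega>. \<beta> k t \<omega> *\<^sub>R q k) \<in> borel_measurable M"
      by (intro borel_measurable_scaleR F_measurable[OF that bm_measurable_F[OF that]]) simp
    have "AE \<omega> in M. \<beta> k 0 \<omega> = 0"
      using bm by (simp add: indep_brownian_motions_def brownian_motion_def)
    then show "AE \<omega> in M. \<beta> k t \<omega> *\<^sub>R q k = incr k 0 t \<omega> *\<^sub>R q k"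
      by eventually_elim simp
  qed
  then have "ms_lim M (\<lambda>n \<omega>. \<Sum>k<n. \<beta> k t \<omega> *\<^sub>R q k) (W t)" if "0 \<le> t" for t
    using that by (intro ms_lim_of_mean_square_lim W sqi_sum) auto
  from ms_lim_diff[OF this this] ab
  have "ms_lim M (\<lambda>n \<omega>. (\<Sum>k<n. \<beta> k b \<omega> *\<^sub>R q k) - (\<Sum>k<n. \<beta> k a \<omega> *\<^sub>R q k)) (\<lambda>\<omega>. W b \<omega> - W a \<omega>)"
    by simp
  then have ms: "ms_lim M (\<lambda>n \<omega>. \<Sum>k<n. incr k a b \<omega> *\<^sub>R q k) (\<lambda>\<omega>. W b \<omega> - W a \<omega>)"
    by (simp only: sum_subtractf[symmetric] scaleR_left_diff_distrib[symmetric])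
  then have dW: "sqi M (\<lambda>\<omega>. W b \<omega> - W a \<omega>)" by (simp add: ms_lim_def)
  show ys: "sqi M y" by (rule sqi_cong_AE[OF sqi_add[OF v(1) dW] y])
  have "expectation (\<lambda>\<omega>. (norm (\<Sum>k<n. incr k a b \<omega> *\<^sub>R q k))\<^sup>2) = (\<Sum>k<n. (b - a) * (norm (q k))\<^sup>2)" for n
  proof -
    have "expectation (\<lambda>\<omega>. (norm (\<Sum>k<n. incr k a b \<omega> *\<^sub>R q k))\<^sup>2) =
        (\<Sum>k<n. \<Sum>l<n. expectation (\<lambda>\<omega>. (incr k a b \<omega> *\<^sub>R q k) \<bullet> (incr l a b \<omega> *\<^sub>R q l)))"
      unfolding power2_norm_eq_inner by (intro integral_inner_sum incr_q ab)
    also have "\<dots> = (\<Sum>k<n. \<Sum>l<n. if k = l then (b - a) * expectation (\<lambda>\<omega>. q k \<bullet> q l) else 0)"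
      by (intro sum.cong refl incr_diag ab sq_const) simp_all
    also have "\<dots> = (\<Sum>k<n. (b - a) * (norm (q k))\<^sup>2)"
      by (intro sum.cong refl) (simp add: prob_space power2_norm_eq_inner)
    finally show ?thesis .
  qed
  with ms_lim_norm[OF ms]
  have "(\<lambda>k. (b - a) * (norm (q k))\<^sup>2) sums expectation (\<lambda>\<omega>. (norm (W b \<omega> - W a \<omega>))\<^sup>2)"
    by (simp add: sums_def)
  \<comment> \<open>For \<open>a \<noteq> b\<close> the summability of the squared norms is read off
    from the limit just obtained; for \<open>a = b\<close> both sides are zero.\<close>
  moreover have "(\<Sum>k. (b - a) * (norm (q k))\<^sup>2) = (b - a) * (\<Sum>k. (norm (q k))\<^sup>2)"
  proof (cases "a = b")
    case False
    then have "summable (\<lambda>k. (norm (q k))\<^sup>2)"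
      using sums_summable[OF calculation] by (simp add: summable_cmult_iff)
    then show ?thesis by (rule suminf_mult)
  qed simp
  ultimately have E_dW: "expectation (\<lambda>\<omega>. (norm (W b \<omega> - W a \<omega>))\<^sup>2) = (b - a) * (\<Sum>k. (norm (q k))\<^sup>2)"
    by (simp add: sums_iff)
  have "expectation (\<lambda>\<omega>. v \<omega> \<bullet> (\<Sum>k<n. incr k a b \<omega> *\<^sub>R q k)) = 0" for n
  proof -
    have "expectation (\<lambda>\<omega>. v \<omega> \<bullet> (\<Sum>k<n. incr k a b \<omega> *\<^sub>R q k)) =
        (\<Sum>k<n. expectation (\<lambda>\<omega>. v \<omega> \<bullet> (incr k a b \<omega> *\<^sub>R q k)))"
      by (intro integral_inner_sum_right v incr_q ab)
    also have "\<dots> = 0"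
      by (intro sum.neutral ballI incr_orth ab v sq_const) simp
    finally show ?thesis .
  qed
  with ms_lim_inner[OF ms_lim_const[OF v(1)] ms]
  have "(\<lambda>n::nat. 0) \<longlonglongrightarrow> expectation (\<lambda>\<omega>. v \<omega> \<bullet> (W b \<omega> - W a \<omega>))" by simp
  then have cross: "expectation (\<lambda>\<omega>. v \<omega> \<bullet> (W b \<omega> - W a \<omega>)) = 0"
    by (simp add: LIMSEQ_const_iff)
  have "expectation (\<lambda>\<omega>. (norm (y \<omega>))\<^sup>2) = expectation (\<lambda>\<omega>. (norm (v \<omega> + (W b \<omega> - W a \<omega>)))\<^sup>2)"
  proof (rule integral_cong_AE)
    show "AE \<omega> in M. (norm (y \<omega>))\<^sup>2 = (norm (v \<omega> + (W b \<omega> - W a \<omega>)))\<^sup>2"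
      using y(2) by eventually_elim simp
  qed (use sqi_integrable[OF ys] sqi_integrable[OF sqi_add[OF v(1) dW]] in auto)
  then show "expectation (\<lambda>\<omega>. (norm (y \<omega>))\<^sup>2) =
      expectation (\<lambda>\<omega>. (norm (v \<omega>))\<^sup>2) + (b - a) * (\<Sum>k. (norm (q k))\<^sup>2)"
    unfolding integral_norm_add_sq[OF v(1) dW] cross E_dW by simp
qed

lemma multiplicative_noise_step:
  fixes q :: "nat \<Rightarrow> 'd::finite L2"
  assumes ab: "0 \<le> a" "a \<le> b" and data: "data_hypothesis Multiplicative D u0 q"
    and v: "sqi M v" "v \<in> borel_measurable (F a)"
    and y: "noise_solution Multiplicative M F D \<beta> q W a b v y"
  shows "sqi M (y b)" "expectation (\<lambda>\<omega>. (norm (y b \<omega>))\<^sup>2) = expectation (\<lambda>\<omega>. (norm (v \<omega>))\<^sup>2)"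
proof -
  obtain c where c: "\<And>k. ess_bounded (rep_L2 (q k)) (c k)" "summable (\<lambda>k. (c k)\<^sup>2)"
    using data_hypothesis_ess_bounded[OF data] by blast
  let ?K = "pmult (\<lambda>x. complex_of_real (- (1/2) * (\<Sum>i. (cmod (rep_L2 (q i) x))\<^sup>2)))"
  let ?P = "\<lambda>k. pmult (\<lambda>x. \<i> * rep_L2 (q k) x)"
  \<comment> \<open>The Wiener integrand multiplies the direction \<open>q k\<close> by
    \<open>\<i> * y\<close>. Exchanging the two factors gives a fixed linear operator applied to
    \<open>y\<close>, the form needed for the energy identity.\<close>
  have P_eq: "pmult (\<lambda>x. \<i> * rep_L2 z x) (q k) = ?P k z" for z k
    by (simp add: pmult_def mult_ac)
  have ym: "y r \<in> borel_measurable (F r)" if "r \<in> {a..b}" for r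
    using y that by (simp add: noise_solution_def)
  \<comment> \<open>The witnesses for different end times \<open>r\<close> are unrelated; they are
    collected into functions of \<open>r\<close> by choice.\<close>
  have "\<forall>r\<in>{a..b}. \<exists>A J I. (AE \<omega> in M. ((\<lambda>s. ?K (y s \<omega>)) has_integral A \<omega>) {a..r}) \<and>
      (\<forall>k. has_ito_integral M F (\<beta> k) a r (\<lambda>s \<omega>. ?P k (y s \<omega>)) (I k)) \<and>
      mean_square_lim M (\<lambda>n \<omega>. \<Sum>k<n. I k \<omega>) J \<and> (AE \<omega> in M. y r \<omega> = v \<omega> + A \<omega> + J \<omega>)"
    using y unfolding noise_solution_def has_wiener_integral_def noise.case P_eq by blast
  then obtain A J I where "\<forall>r\<in>{a..b}. (AE \<omega> in M. ((\<lambda>s. ?K (y s \<omega>)) has_integral A r \<omega>) {a..r}) \<and>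
      (\<forall>k. has_ito_integral M F (\<beta> k) a r (\<lambda>s \<omega>. ?P k (y s \<omega>)) (I r k)) \<and>
      mean_square_lim M (\<lambda>n \<omega>. \<Sum>k<n. I r k \<omega>) (J r) \<and> (AE \<omega> in M. y r \<omega> = v \<omega> + A r \<omega> + J r \<omega>)"
    unfolding bchoice_iff by (elim exE)
  then have sol: "\<And>r. r \<in> {a..b} \<Longrightarrow> AE \<omega> in M. ((\<lambda>s. ?K (y s \<omega>)) has_integral A r \<omega>) {a..r}"
    "\<And>r k. r \<in> {a..b} \<Longrightarrow> has_ito_integral M F (\<beta> k) a r (\<lambda>s \<omega>. ?P k (y s \<omega>)) (I r k)"
    "\<And>r. r \<in> {a..b} \<Longrightarrow> mean_square_lim M (\<lambda>n \<omega>. \<Sum>k<n. I r k \<omega>) (J r)"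
    "\<And>r. r \<in> {a..b} \<Longrightarrow> AE \<omega> in M. y r \<omega> = v \<omega> + A r \<omega> + J r \<omega>"
    by blast+
  note op = noise_operators[OF c]
  note energy = energy_identity[OF ab op(1) op(5) op(3) op(2) op(4) v ym sol]
  show "sqi M (y b)" by (rule energy(1))
  show "expectation (\<lambda>\<omega>. (norm (y b \<omega>))\<^sup>2) = expectation (\<lambda>\<omega>. (norm (v \<omega>))\<^sup>2)"
    by (rule energy(2))
qed

lemma noise_step:
  fixes q :: "nat \<Rightarrow> 'd::finite L2"
  assumes ab: "0 \<le> a" "a \<le> b" and W: "wiener_process M F D \<beta> q W" and data: "data_hypothesis g D u0 q"
    and v: "sqi M v" "v \<in> borel_measurable (F a)"
    and y: "noise_solution g M F D \<beta> q W a b v y"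
  shows "sqi M (y b)" "expectation (\<lambda>\<omega>. (norm (y b \<omega>))\<^sup>2) =
    expectation (\<lambda>\<omega>. (norm (v \<omega>))\<^sup>2) + (b - a) * (\<Sum>k. (norm (q k))\<^sup>2) * (if g = Additive then 1 else 0)"
proof -
  have b: "b \<in> {a..b}" using ab by simp
  have ym: "y b \<in> borel_measurable M"
    using F_measurable[of b "y b" borel] y b ab by (simp add: noise_solution_def)
  have "sqi M (y b) \<and> expectation (\<lambda>\<omega>. (norm (y b \<omega>))\<^sup>2) =
    expectation (\<lambda>\<omega>. (norm (v \<omega>))\<^sup>2) + (b - a) * (\<Sum>k. (norm (q k))\<^sup>2) * (if g = Additive then 1 else 0)"
  proof (cases g)
    case Additive
    have "AE \<omega> in M. y b \<omega> = v \<omega> + (W b \<omega> - W a \<omega>)"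
      using y b by (auto simp: noise_solution_def Additive)
    moreover have "\<And>t. 0 \<le> t \<Longrightarrow> mean_square_lim M (\<lambda>n \<omega>. \<Sum>k<n. \<beta> k t \<omega> *\<^sub>R q k) (W t)"
      using W by (simp add: wiener_process_def)
    ultimately show ?thesis
      using additive_noise_step[OF ab _ v ym, of q W] Additive by simp
  next
    case Multiplicative
    then show ?thesis
      using multiplicative_noise_step[OF ab _ v, of D u0 q W y] data y by simp
  qed
  then show "sqi M (y b)" "expectation (\<lambda>\<omega>. (norm (y b \<omega>))\<^sup>2) =
    expectation (\<lambda>\<omega>. (norm (v \<omega>))\<^sup>2) + (b - a) * (\<Sum>k. (norm (q k))\<^sup>2) * (if g = Additive then 1 else 0)"
    by auto
qed

end

section \<open>Induction over the time steps\<close>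

theorem proposition4p4:
  fixes D :: "(real ^ 'd::finite) set" and bc :: "'d bdry_cond"
    and M :: "'w measure" and F :: "real \<Rightarrow> 'w measure"
    and \<beta> :: "nat \<Rightarrow> real \<Rightarrow> 'w \<Rightarrow> real" and W :: "real \<Rightarrow> 'w \<Rightarrow> 'd L2"
    and e :: "nat \<Rightarrow> 'd L2" and Qh :: "'d L2 \<Rightarrow> 'd L2"
    and g :: noise and u0 :: "'d L2" and u :: "nat \<Rightarrow> 'w \<Rightarrow> 'd L2"
    and l T \<epsilon> \<tau> \<tau>0 :: real and N :: nat
  assumes domain: "bounded_domain bc D"
    and params: "l \<noteq> 0" "T > 0" "0 < \<epsilon>" "\<epsilon> < 1"
    and filtered: "filtered_prob_space M F"
    and basis: "orthonormal_basis D e"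
    and Q: "bounded_operator_on D Qh" "summable (\<lambda>i. (norm (Qh (e i)))\<^sup>2)"
    and wiener: "wiener_process M F D \<beta> (\<lambda>i. Qh (e i)) W"
    and data: "data_hypothesis g D u0 (\<lambda>i. Qh (e i))"
    and step: "N > 0" "\<tau> = T / real N"
    and solvable: "\<tau>0 > 0"
      "\<And>K. K > 0 \<Longrightarrow> T / real K < \<tau>0 \<Longrightarrow>
         \<exists>w. cn_scheme g bc M F D \<beta> (\<lambda>i. Qh (e i)) W l \<epsilon> T u0 K w"
    and small: "\<tau> < \<tau>0"
    and scheme: "cn_scheme g bc M F D \<beta> (\<lambda>i. Qh (e i)) W l \<epsilon> T u0 N u"
  shows "\<forall>n<N. integrable M (\<lambda>\<omega>. mass (u n \<omega>)) \<and> integrable M (\<lambda>\<omega>. mass (u (Suc n) \<omega>)) \<and>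
    prob_space.expectation M (\<lambda>\<omega>. mass (u (Suc n) \<omega>)) =
      prob_space.expectation M (\<lambda>\<omega>. mass (u n \<omega>)) +
      \<tau> * (\<Sum>i. (norm (Qh (e i)))\<^sup>2) * (if g = Additive then 1 else 0)"
proof -
  have "prob_space M" using filtered unfolding filtered_prob_space_def by (rule conjunct1)
  moreover have "indep_brownian_motions M F \<beta>" using wiener unfolding wiener_process_def by (rule conjunct1)
  ultimately interpret brownian_family M F \<beta>
    using filtered by (intro brownian_family.intro brownian_family_axioms.intro)
  have \<tau>: "0 < \<tau>" using params step by simp
  have u0: "\<forall>\<omega>\<in>space M. u 0 \<omega> = u0"
    and uF: "\<And>n. n \<le> N \<Longrightarrow> u n \<in> borel_measurable (F (real n * \<tau>))"
    and us: "\<And>n. n < N \<Longrightarrow> \<exists>y. noise_solution g M F D \<beta> (\<lambda>i. Qh (e i)) W (real n * \<tau>) (real (Suc n) * \<tau>) (u n) y \<and>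
      (AE \<omega> in M. cn_step bc D l \<epsilon> \<tau> (y (real (Suc n) * \<tau>) \<omega>) (u (Suc n) \<omega>))"
    using scheme unfolding cn_scheme_def Let_def step(2)[symmetric] by blast+
  have um: "u n \<in> borel_measurable M" if "n \<le> N" for n
    using \<tau> by (intro F_measurable[OF _ uF[OF that]]) simp
  have next_step: "sqi M (u (Suc n)) \<and> expectation (\<lambda>\<omega>. (norm (u (Suc n) \<omega>))\<^sup>2) =
      expectation (\<lambda>\<omega>. (norm (u n \<omega>))\<^sup>2) + \<tau> * (\<Sum>i. (norm (Qh (e i)))\<^sup>2) * (if g = Additive then 1 else 0)"
    if n: "n < N" and sq: "sqi M (u n)" for n
  proof -
    let ?a = "real n * \<tau>" and ?b = "real (Suc n) * \<tau>"
    obtain y where y: "noise_solution g M F D \<beta> (\<lambda>i. Qh (e i)) W ?a ?b (u n) y"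
      and cn: "AE \<omega> in M. cn_step bc D l \<epsilon> \<tau> (y ?b \<omega>) (u (Suc n) \<omega>)"
      using us[OF n] by blast
    have ab: "0 \<le> ?a" "?a \<le> ?b" and diff: "?b - ?a = \<tau>" using \<tau> by (auto simp: algebra_simps)
    note N = noise_step[OF ab wiener data sq uF[OF less_imp_le[OF n]] y, unfolded diff]
    have eq: "AE \<omega> in M. norm (u (Suc n) \<omega>) = norm (y ?b \<omega>)"
      using cn by eventually_elim (rule cn_step_norm)
    have "sqi M (u (Suc n))"
      by (rule sqi_bound[OF um N(1), of _ 1]) (use n eq in auto)
    moreover have "expectation (\<lambda>\<omega>. (norm (u (Suc n) \<omega>))\<^sup>2) = expectation (\<lambda>\<omega>. (norm (y ?b \<omega>))\<^sup>2)"
      using eq by (intro integral_cong_AE borel_measurable_integrable sqi_integrable calculation N(1)) auto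
    ultimately show ?thesis using N(2) by simp
  qed
  \<comment> \<open>Starting from the deterministic \<open>u0\<close>, square integrability is
    propagated by \<open>next_step\<close>. It makes the expectations in the claim genuine, as the
    integral of a non-integrable function is 0 by convention.\<close>
  have sq: "sqi M (u n)" if "n \<le> N" for n
    using that
  proof (induction n)
    case 0
    show ?case
      by (rule sqi_cong_AE[OF sqi_const[OF finite_measure_axioms, of u0] um[OF 0]]) (use u0 in auto)
  next
    case (Suc n)
    then show ?case using next_step[of n] by simp
  qed
  show ?thesis
    unfolding mass_def using next_step sq by (auto intro!: sqi_integrable)
qed

end
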